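(* Let $R$ be a measurable function on the unit circle $\mathbb T$ with $|R(t)|\le 1$ a.e. and $\log(1-|R|)\in L^1(\mathbb T)$. With $\check a_j(0)$, $\check\alpha_j$, $\check\rho_j$ ($j\in\mathbb Z$) defined in the context, the sequence $\check a_j(0)$ is nondecreasing in $j$, the limit $\lim_{j\to\infty}\check a_j(0)$ exists and satisfies $0<\lim_{j\to\infty}\check a_j(0)\le 1$, and $$\lim_{j\to\infty}\check\rho_j=1,\qquad \lim_{j\to\infty}\check\alpha_j=0 .$$
   Context: $L^R$ is the Hilbert space of (classes of) measurable functions $f=\begin{bmatrix}f_1\\ f_2\end{bmatrix}:\mathbb T\to\mathbb C^2$ with finite norm for the inner product $\langle f,g\rangle=\int_{\mathbb T} g(t)^*\begin{bmatrix}1&\overline{R(t)}\\R(t)&1\end{bmatrix}^{-1}f(t)\,dm(t)$, $m$ the normalized Lebesgue measure. $L^2=L^2(\mathbb T)$, $H^2_+$ is the Hardy space of the disk, $H^2_-=L^2\ominus H^2_+$. For $n,m\in\mathbb Z$ let $\check{\mathcal H}_{n,m}$ be the closure in $L^R$ of $\left\{\begin{bmatrix}1&\overline R\\R&1\end{bmatrix}\begin{bmatrix}t^n h_+\\ \overline t^{\,m}h_-\end{bmatrix}: h_+\in H^2_+,\ h_-\in H^2_-\right\}$. The subspaces $\check{\mathcal H}_{n+1,m}$ and $\check{\mathcal H}_{n,m+1}$ have codimension one in $\check{\mathcal H}_{n,m}$. Let $\check K_{n,m}$ be the unit vector in $\check{\mathcal H}_{n,m}\ominus\check{\mathcal H}_{n+1,m}$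 normalized by $\left\langle\begin{bmatrix}1\\R\end{bmatrix}t^n,\check K_{n,m}\right\rangle>0$, and let $\widetilde{\check K}_{n,m}$ be the unit vector in $\check{\mathcal H}_{n,m}\ominus\check{\mathcal H}_{n,m+1}$ normalized by $\left\langle\widetilde{\check K}_{n,m},\begin{bmatrix}\overline R\\1\end{bmatrix}\overline t^{\,m+1}\right\rangle>0$. The numbers $\check\alpha_{n+m}:=\langle\check K_{n,m},\widetilde{\check K}_{n,m}\rangle$ (the Verblunsky coefficients) and $\check a_{n+m}(0):=\left\langle\begin{bmatrix}1\\R\end{bmatrix}t^n,\check K_{n,m}\right\rangle$ depend only on $n+m$, and $\check\rho_j:=\sqrt{1-|\check\alpha_j|^2}$. (The number $\check a_j(0)$ is the value at $0$ of the outer function $\check a_{n+m}(\zeta)=\left\langle(I-\zeta A_0^* )^{-1}\begin{bmatrix}1\\R\end{bmatrix}t^n,\check K_{n,m}\right\rangle$, $n+m=j$, where $A_0h=tP_{\check{\mathcal H}_{n,m+1}}h$ for $h\in\check{\mathcal H}_{n,m}$ and $P$ denotes orthogonal projection.) *)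

theory Defs
  imports "HOL-Analysis.Analysis"
begin

text \<open>Normalized Lebesgue measure on the unit circle. The completion makes ``measurable'' mean
  Lebesgue measurable rather than only Borel measurable. Elements of the function spaces below are
  functions, not classes; equality in these spaces is equality almost everywhere.\<close>

definition circle :: "complex measure" where
  "circle = completion (distr (uniform_measure lborel {0..2 * pi})
                              (restrict_space borel (sphere 0 1)) cis)"

definition L2 :: "(complex \<Rightarrow> complex) set" where
  "L2 = {f \<in> borel_measurable circle. integrable circle (\<lambda>t. (cmod (f t))\<^sup>2)}"

definition L2_inner :: "(complex \<Rightarrow> complex) \<Rightarrow> (complex \<Rightarrow> complex) \<Rightarrow> complex" where
  "L2_inner f g = (LINT t|circle. f t * cnj (g t))"

text \<open>The Hardy space, as a subspace of L2 of the circle: all Fourier coefficients of negative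
  index vanish.\<close>

definition Hardy_plus :: "(complex \<Rightarrow> complex) set" where
  "Hardy_plus = {f \<in> L2. \<forall>k<0. L2_inner f (\<lambda>t. t powi k) = 0}"

definition Hardy_minus :: "(complex \<Rightarrow> complex) set" where
  "Hardy_minus = {f \<in> L2. \<forall>g\<in>Hardy_plus. L2_inner f g = 0}"

text \<open>Membership of \<open>log g\<close> in L1. The positivity clause is needed because \<open>ln 0 = 0\<close> in the library,
  whereas here \<open>log 0\<close> has to count as minus infinity.\<close>

definition log_in_L1 :: "(complex \<Rightarrow> real) \<Rightarrow> bool" where
  "log_in_L1 g \<longleftrightarrow> (AE t in circle. 0 < g t) \<and> integrable circle (\<lambda>t. ln (g t))"

definition weight :: "(complex \<Rightarrow> complex) \<Rightarrow> complex \<Rightarrow> complex^2^2" where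
  "weight R t = vector [vector [1, cnj (R t)], vector [R t, 1]]"

text \<open>\<open>cdot v u\<close> is \<open>u\<^sup>* v\<close>: linear in the first argument.\<close>

definition cdot :: "complex^2 \<Rightarrow> complex^2 \<Rightarrow> complex" where
  "cdot v u = (\<Sum>i\<in>UNIV. cnj (u $ i) * v $ i)"

definition LR :: "(complex \<Rightarrow> complex) \<Rightarrow> (complex \<Rightarrow> complex^2) set" where
  "LR R = {f \<in> borel_measurable circle.
             integrable circle (\<lambda>t. cdot (matrix_inv (weight R t) *v f t) (f t))}"

definition LR_inner ::
  "(complex \<Rightarrow> complex) \<Rightarrow> (complex \<Rightarrow> complex^2) \<Rightarrow> (complex \<Rightarrow> complex^2) \<Rightarrow> complex" where
  "LR_inner R f g = (LINT t|circle. cdot (matrix_inv (weight R t) *v f t) (g t))"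

definition LR_norm :: "(complex \<Rightarrow> complex) \<Rightarrow> (complex \<Rightarrow> complex^2) \<Rightarrow> real" where
  "LR_norm R f = sqrt (Re (LR_inner R f f))"

definition LR_closure ::
  "(complex \<Rightarrow> complex) \<Rightarrow> (complex \<Rightarrow> complex^2) set \<Rightarrow> (complex \<Rightarrow> complex^2) set" where
  "LR_closure R S = {f \<in> LR R. \<forall>e>0. \<exists>g\<in>S. LR_norm R (\<lambda>t. f t - g t) < e}"

definition LR_ominus ::
  "(complex \<Rightarrow> complex) \<Rightarrow> (complex \<Rightarrow> complex^2) set \<Rightarrow> (complex \<Rightarrow> complex^2) set
     \<Rightarrow> (complex \<Rightarrow> complex^2) set" where
  "LR_ominus R S S' = {f \<in> S. \<forall>g\<in>S'. LR_inner R f g = 0}"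

definition H_check :: "(complex \<Rightarrow> complex) \<Rightarrow> int \<Rightarrow> int \<Rightarrow> (complex \<Rightarrow> complex^2) set" where
  "H_check R n m = LR_closure R
     {(\<lambda>t. weight R t *v vector [t powi n * hp t, cnj t powi m * hm t]) | hp hm.
        hp \<in> Hardy_plus \<and> hm \<in> Hardy_minus}"

definition e_plus :: "(complex \<Rightarrow> complex) \<Rightarrow> int \<Rightarrow> complex \<Rightarrow> complex^2" where
  "e_plus R n t = vector [t powi n, R t * t powi n]"

definition e_minus :: "(complex \<Rightarrow> complex) \<Rightarrow> int \<Rightarrow> complex \<Rightarrow> complex^2" where
  "e_minus R m t = vector [cnj (R t) * cnj t powi (m + 1), cnj t powi (m + 1)]"

definition positive_number :: "complex \<Rightarrow> bool" where
  "positive_number z \<longleftrightarrow> Im z = 0 \<and> 0 < Re z"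

definition is_K_check ::
  "(complex \<Rightarrow> complex) \<Rightarrow> int \<Rightarrow> int \<Rightarrow> (complex \<Rightarrow> complex^2) \<Rightarrow> bool" where
  "is_K_check R n m K \<longleftrightarrow>
     K \<in> LR_ominus R (H_check R n m) (H_check R (n + 1) m) \<and> LR_norm R K = 1 \<and>
     positive_number (LR_inner R (e_plus R n) K)"

definition is_K_check_tilde ::
  "(complex \<Rightarrow> complex) \<Rightarrow> int \<Rightarrow> int \<Rightarrow> (complex \<Rightarrow> complex^2) \<Rightarrow> bool" where
  "is_K_check_tilde R n m K \<longleftrightarrow>
     K \<in> LR_ominus R (H_check R n m) (H_check R n (m + 1)) \<and> LR_norm R K = 1 \<and>
     positive_number (LR_inner R K (e_minus R m))"

text \<open>The vectors are determined only almost everywhere, and the numbers below are the common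
  values over all \<open>n\<close>, \<open>m\<close> with \<open>n + m = j\<close> and over all representatives. The description is
  proper only if such vectors exist and the value depends on \<open>n + m\<close> alone.\<close>

definition alpha_check :: "(complex \<Rightarrow> complex) \<Rightarrow> int \<Rightarrow> complex" where
  "alpha_check R j = (THE c. \<forall>n m K K'. n + m = j \<longrightarrow> is_K_check R n m K \<longrightarrow>
     is_K_check_tilde R n m K' \<longrightarrow> c = LR_inner R K K')"

definition a0_check :: "(complex \<Rightarrow> complex) \<Rightarrow> int \<Rightarrow> real" where
  "a0_check R j = (THE c. \<forall>n m K. n + m = j \<longrightarrow> is_K_check R n m K \<longrightarrow>
     complex_of_real c = LR_inner R (e_plus R n) K)"

definition rho_check :: "(complex \<Rightarrow> complex) \<Rightarrow> int \<Rightarrow> real" where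
  "rho_check R j = sqrt (1 - (cmod (alpha_check R j))\<^sup>2)"

end

theory Submission
  imports Defs "HOL-Probability.Probability_Measure" "HOL-Library.Function_Algebras"
    "HOL-Computational_Algebra.Polynomial"
begin

text \<open>
  With \<open>e\<close> the vector \<open>[1, R] t^n\<close>, the number \<open>a\<^sub>j(0)\<close>, \<open>j = n + m\<close>, is the distance in \<open>L\<^sup>R\<close> of \<open>e\<close> from
  \<open>H\<^bsub>n+1,m\<^esub>\<close>. These subspaces decrease in \<open>m\<close>, so the distance increases, and it is at most the norm
  of \<open>e\<close>, which is 1. Comparing the orthogonal decompositions of \<open>e\<close> and of \<open>K\<^bsub>n,m\<^esub>\<close> along the two chains
  from \<open>H\<^bsub>n,m\<^esub>\<close> to \<open>H\<^bsub>n+1,m+1\<^esub>\<close> gives \<open>|\<alpha>\<^sub>j|\<^sup>2 = 1 - (a\<^sub>j(0) / a\<^bsub>j+1\<^esub>(0))\<^sup>2\<close>, so everything follows once the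
  distances are bounded below by a positive constant.

  The squared norm of the image of \<open>(u, v)\<close> under the weight is at least the integral of
  \<open>(1 - |R|) |u|\<^sup>2\<close>, and for \<open>f\<close> in the Hardy space this integral is at least
  \<open>|f(0)|\<^sup>2 exp (integral of log (1 - |R|))\<close>. That inequality needs no factorization theory: for an analytic
  polynomial \<open>p\<close> the integral of \<open>f exp p\<close> is \<open>f(0) exp (p(0))\<close>, hence \<open>|f(0)| exp (integral of Re p)\<close>
  is at most the integral of \<open>|f| exp (Re p)\<close>, and \<open>Re p\<close> can be replaced first by a continuous function
  (Stone-Weierstrass), then by a bounded measurable one, and finally by \<open>log (1 - |R|) / 2\<close>.
\<close>

subsection \<open>The normalized measure on the circle\<close>

text \<open>Vectors here are functions and equality is almost everywhere, so the inner product has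
  null vectors. The Hilbert space argument is therefore carried out in a locale for complete
  semi-inner product spaces, with \<open>sq (x - y) = 0\<close> in the role of equality. Identities
  such as \<open>cnj t = t powi (-1)\<close> moreover hold only on the circle, so even inclusions
  between generating sets are true only up to null vectors. The other obstacle is that the
  coefficients are definite descriptions: they have a value to argue about only once both kinds of
  unit vectors exist and the inner products depend on the index sum alone. Existence needs a
  positive distance in either direction, so the lower bound is proved twice, the second time by
  conjugating from H^2_- to H^2_+. Dependence on n + m comes from multiplication by t^k, a unitary
  that takes \<open>H_check R n m\<close> to \<open>H_check R (n + k) (m - k)\<close>. The factor 1
  - |R| is the smallest eigenvalue of the weight matrix; the 1/2 in log (1 - |R|) / 2 appears
  because the mean inequality concerns |f|, and squaring it (Jensen) yields the one for
  |f|^2.\<close>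

lemma space_circle [simp]: "space circle = sphere 0 1"
  by (simp add: circle_def space_restrict_space)

lemma measurable_cis: "cis \<in> uniform_measure lborel {0..2 * pi} \<rightarrow>\<^sub>M restrict_space borel (sphere 0 1)"
  by (rule measurable_restrict_space2)
    (auto simp: uniform_measure_def intro!: borel_measurable_continuous_onI continuous_intros)

lemma prob_space_circle: "prob_space circle"
proof -
  have "prob_space (uniform_measure lborel {0..2 * pi})"
    by (rule prob_space_uniform_measure) auto
  then have "prob_space (distr (uniform_measure lborel {0..2 * pi}) (restrict_space borel (sphere 0 1)) cis)"
    by (rule prob_space.prob_space_distr[OF _ measurable_cis])
  then show ?thesis
    unfolding circle_def by (rule prob_space.prob_space_completion)
qed

interpretation circle: prob_space circle
  by (rule prob_space_circle)

lemma AE_circle_imp_sphere: "AE t in circle. cmod t = 1"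
  by (rule AE_I2) auto

lemma borel_measurable_circle_continuous:
  "continuous_on (sphere 0 1) f \<Longrightarrow> f \<in> borel_measurable circle"
  unfolding circle_def
  by (intro measurable_completion) (simp add: borel_measurable_continuous_on_restrict)

lemma continuous_on_sphere_powi: "continuous_on (sphere 0 1) (\<lambda>t::complex. t powi k)"
  by (intro continuous_intros) auto

lemma measurable_powi_circle [measurable]: "(\<lambda>t::complex. t powi k) \<in> borel_measurable circle"
  by (intro borel_measurable_circle_continuous continuous_on_sphere_powi)

text \<open>Completeness of the measure is the reason: the two preimages differ by a null set. This
  gives measurability of integrands containing \<open>matrix_inv (weight R t)\<close>, which are
  under control only where |R| < 1.\<close>

lemma borel_measurable_circle_AE:
  fixes f g :: "complex \<Rightarrow> 'b::topological_space"
  assumes f: "f \<in> borel_measurable circle" and eq: "AE t in circle. f t = g t"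
  shows "g \<in> borel_measurable circle"
proof (rule measurableI)
  fix A :: "'b set" assume A: "A \<in> sets borel"
  have "f -` A \<inter> space circle \<in> sets circle"
    using f A by (rule measurable_sets)
  moreover have "AE t in circle. t \<in> f -` A \<inter> space circle \<longleftrightarrow> t \<in> g -` A \<inter> space circle"
    using eq by eventually_elim auto
  moreover have "complete_measure circle"
    unfolding circle_def by (rule completion.complete_measure_axioms)
  ultimately show "g -` A \<inter> space circle \<in> sets circle"
    using complete_measure.in_sets_AE by blast
qed auto

text \<open>Orthogonality of the characters, the one integral computed in the angle; later arguments
  use it algebraically.\<close>

lemma integral_circle_powi:
  assumes "k \<noteq> 0"
  shows "(LINT t|circle. t powi k) = 0"
proof -
  have *: "(\<lambda>t::complex. t powi k) \<in> borel_measurable (restrict_space borel (sphere 0 1))"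
    by (intro borel_measurable_continuous_on_restrict continuous_on_sphere_powi)
  have u: "uniform_measure lborel {0..2 * pi} = density lborel (\<lambda>x. ennreal (indicator {0..2 * pi} x / (2 * pi)))"
    unfolding uniform_measure_def
    by (intro arg_cong2[where f=density] refl ext) (simp add: divide_ennreal[symmetric] indicator_def)
  have "(LINT t|circle. t powi k) = (LINT x|uniform_measure lborel {0..2 * pi}. cis x powi k)"
    unfolding circle_def using * by (simp add: integral_completion integral_distr[OF measurable_cis *])
  also have "\<dots> = (LINT x|lborel. (indicator {0..2 * pi} x / (2 * pi)) *\<^sub>R cis (of_int k * x))"
  proof -
    have "(\<lambda>x. cis (of_int k * x)) \<in> borel_measurable lborel"
      by (simp, intro borel_measurable_continuous_onI continuous_intros)
    then show ?thesis
      unfolding u cis_power_int by (intro integral_density) simp_all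
  qed
  also have "\<dots> = (LINT x|lborel. (indicator {0..2 * pi} x *\<^sub>R (cis (of_int k * x) / of_real (2 * pi))))"
    by (simp add: scaleR_conv_of_real field_simps)
  \<comment> \<open>The antiderivative exists because \<open>k\<close> is nonzero; periodicity then
    makes the boundary terms cancel.\<close>
  also have "\<dots> = exp (\<i> * k * of_real (2*pi)) / (2 * pi * \<i> * k) - exp (\<i> * k * of_real 0) / (2 * pi * \<i> * k)"
  proof (rule integral_FTC_Icc)
    show "((\<lambda>x. exp (\<i> * k * of_real x) / (2 * pi * \<i> * k)) has_vector_derivative
        cis (of_int k * x) / of_real (2 * pi)) (at x within {0..2 * pi})" for x
      by (rule has_vector_derivative_real_field)
        (use assms in \<open>auto simp: cis_conv_exp mult_ac intro!: derivative_eq_intros\<close>)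
  qed (auto intro!: continuous_intros)
  also have "\<dots> = 0"
  proof -
    have "exp (\<i> * k * of_real (2*pi)) = cis (2 * pi * of_int k)"
      by (simp add: cis_conv_exp mult_ac)
    then show ?thesis by simp
  qed
  finally show ?thesis .
qed

subsection \<open>Square integrable functions and Hardy spaces\<close>

lemma norm_add_square_le:
  fixes u v :: "'a::real_normed_vector"
  shows "(norm (u + v))\<^sup>2 \<le> 2 * (norm u)\<^sup>2 + 2 * (norm v)\<^sup>2"
proof -
  have "(norm (u + v))\<^sup>2 \<le> (norm u + norm v)\<^sup>2"
    by (intro power_mono norm_triangle_ineq) auto
  also have "\<dots> \<le> 2 * (norm u)\<^sup>2 + 2 * (norm v)\<^sup>2"
    using sum_squares_bound[of "norm u" "norm v"] by (simp add: power2_sum)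
  finally show ?thesis .
qed

lemma mult_le_sum_squares:
  fixes x y :: real
  assumes "x \<ge> 0" "y \<ge> 0"
  shows "x * y \<le> x\<^sup>2 + y\<^sup>2"
  using sum_squares_bound[of x y] mult_nonneg_nonneg[OF assms] by linarith

lemma measurable_cnj [measurable]: "cnj \<in> borel_measurable borel"
  by (intro borel_measurable_continuous_onI continuous_intros)

lemma L2_measurable [measurable_dest]: "f \<in> L2 \<Longrightarrow> f \<in> borel_measurable circle"
  by (simp add: L2_def)

lemma L2_integrable_square: "f \<in> L2 \<Longrightarrow> integrable circle (\<lambda>t. (cmod (f t))\<^sup>2)"
  by (simp add: L2_def)

lemma L2_integrable_mult_cnj:
  assumes "f \<in> L2" "g \<in> L2"
  shows "integrable circle (\<lambda>t. f t * cnj (g t))"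
proof (rule Bochner_Integration.integrable_bound)
  show "integrable circle (\<lambda>t. (cmod (f t))\<^sup>2 + (cmod (g t))\<^sup>2)"
    using assms by (intro Bochner_Integration.integrable_add L2_integrable_square)
  show "AE t in circle. norm (f t * cnj (g t)) \<le> norm ((cmod (f t))\<^sup>2 + (cmod (g t))\<^sup>2)"
    by (simp add: norm_mult mult_le_sum_squares)
qed (use assms in measurable)

lemma L2_bounded:
  assumes [measurable]: "f \<in> borel_measurable circle" and B: "AE t in circle. cmod (f t) \<le> B"
  shows "f \<in> L2"
proof -
  have "integrable circle (\<lambda>t. (cmod (f t))\<^sup>2)"
    using B by (intro circle.integrable_const_bound[of _ "B\<^sup>2"]) (auto elim!: eventually_mono intro: power_mono)
  then show ?thesis by (simp add: L2_def)
qed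

lemma L2_mult_bounded:
  assumes f: "f \<in> L2" and [measurable]: "g \<in> borel_measurable circle"
    and B: "AE t in circle. cmod (g t) \<le> B"
  shows "(\<lambda>t. g t * f t) \<in> L2"
proof -
  note [measurable] = L2_measurable[OF f]
  have "integrable circle (\<lambda>t. (cmod (g t * f t))\<^sup>2)"
  proof (rule Bochner_Integration.integrable_bound)
    show "integrable circle (\<lambda>t. B\<^sup>2 * (cmod (f t))\<^sup>2)"
      using L2_integrable_square[OF f] by simp
    show "AE t in circle. norm ((cmod (g t * f t))\<^sup>2) \<le> norm (B\<^sup>2 * (cmod (f t))\<^sup>2)"
      using B by eventually_elim (auto simp: norm_mult power_mult_distrib intro!: mult_right_mono power_mono)
  qed measurable
  then show ?thesis by (simp add: L2_def)
qed

lemma L2_add: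
  assumes f: "f \<in> L2" and g: "g \<in> L2"
  shows "(\<lambda>t. f t + g t) \<in> L2"
proof -
  note [measurable] = L2_measurable[OF f] L2_measurable[OF g]
  have "integrable circle (\<lambda>t. (cmod (f t + g t))\<^sup>2)"
  proof (rule Bochner_Integration.integrable_bound)
    show "integrable circle (\<lambda>t. 2 * (cmod (f t))\<^sup>2 + 2 * (cmod (g t))\<^sup>2)"
      using L2_integrable_square[OF f] L2_integrable_square[OF g] by simp
    show "AE t in circle. norm ((cmod (f t + g t))\<^sup>2) \<le> norm (2 * (cmod (f t))\<^sup>2 + 2 * (cmod (g t))\<^sup>2)"
      by (simp add: norm_add_square_le)
  qed measurable
  then show ?thesis by (simp add: L2_def)
qed

lemma L2_scale: "f \<in> L2 \<Longrightarrow> (\<lambda>t. c * f t) \<in> L2"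
  by (rule L2_mult_bounded[where B="cmod c"]) auto

lemma norm_powi_circle: "cmod t = 1 \<Longrightarrow> cmod (t powi k) = 1"
  by (simp add: norm_power_int)

lemma AE_norm_powi: "AE t in circle. cmod (t powi k) \<le> 1"
  using AE_circle_imp_sphere by eventually_elim (simp add: norm_powi_circle)

lemma powi_L2: "(\<lambda>t. t powi k) \<in> L2"
  by (rule L2_bounded[OF _ AE_norm_powi]) measurable

lemma one_L2: "(\<lambda>t. 1) \<in> L2"
  using powi_L2[of 0] by simp

lemma L2_powi_mult: "f \<in> L2 \<Longrightarrow> (\<lambda>t. t powi k * f t) \<in> L2"
  by (rule L2_mult_bounded[OF _ _ AE_norm_powi]) measurable

lemma L2_integrable: "f \<in> L2 \<Longrightarrow> integrable circle f"
  using L2_integrable_mult_cnj[OF _ one_L2] by simp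

lemma powi_add_circle: "cmod t = 1 \<Longrightarrow> t powi k * t powi l = t powi (k + l)"
  by (subst power_int_add) auto

lemma cnj_powi_circle:
  assumes "cmod t = 1"
  shows "cnj (t powi k) = t powi (- k)"
proof -
  have "t * cnj t = 1" using assms by (simp add: complex_norm_square[symmetric])
  then have "cnj t = inverse t" by (simp add: inverse_unique)
  then show ?thesis by (simp add: power_int_minus power_int_inverse)
qed

section \<open>Fourier description, shifts and decompositions of the Hardy spaces\<close>

lemma L2_inner_powi: "L2_inner f (\<lambda>t. t powi k) = (LINT t|circle. f t * t powi (- k))"
  unfolding L2_inner_def
  by (intro Bochner_Integration.integral_cong refl) (simp add: cnj_powi_circle del: complex_cnj_power_int)

text \<open>On the circle the conjugate of t^k is t^(-k). The form without conjugates behaves well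
  under multiplication of \<open>f\<close> by t: every index just moves by one.\<close>

lemma Hardy_plus_iff:
  "f \<in> Hardy_plus \<longleftrightarrow> f \<in> L2 \<and> (\<forall>k>0. (LINT t|circle. f t * t powi k) = 0)"
proof -
  have "(\<forall>k<0. L2_inner f (\<lambda>t. t powi k) = 0) \<longleftrightarrow> (\<forall>k>0. (LINT t|circle. f t * t powi k) = 0)" if "f \<in> L2"
    using that by (auto simp: L2_inner_powi) (metis add.inverse_inverse neg_less_0_iff_less)
  then show ?thesis by (auto simp: Hardy_plus_def)
qed

lemma Hardy_plus_powi:
  assumes "k \<ge> 0"
  shows "(\<lambda>t. t powi k) \<in> Hardy_plus"
proof -
  have "(LINT t|circle. t powi k * t powi l) = 0" if "l > 0" for l
  proof -
    have "(LINT t|circle. t powi k * t powi l) = (LINT t|circle. t powi (k + l))"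
      by (intro Bochner_Integration.integral_cong refl) (simp add: powi_add_circle)
    then show ?thesis using that assms by (simp add: integral_circle_powi)
  qed
  then show ?thesis by (simp add: Hardy_plus_iff powi_L2)
qed

lemma Hardy_plus_one: "(\<lambda>t. 1) \<in> Hardy_plus"
  using Hardy_plus_powi[of 0] by simp

lemma Hardy_plus_shift:
  assumes "f \<in> Hardy_plus"
  shows "(\<lambda>t. t * f t) \<in> Hardy_plus"
proof -
  have "(LINT t|circle. (t * f t) * t powi l) = 0" if "l > 0" for l
  proof -
    have "(LINT t|circle. (t * f t) * t powi l) = (LINT t|circle. f t * t powi (l + 1))"
      using powi_add_circle[of _ 1 l] by (intro Bochner_Integration.integral_cong refl) (simp add: mult_ac add.commute)
    then show ?thesis using that assms by (simp add: Hardy_plus_iff)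
  qed
  moreover have "(\<lambda>t. t * f t) \<in> L2"
    using assms L2_powi_mult[of f 1] by (simp add: Hardy_plus_iff)
  ultimately show ?thesis by (simp add: Hardy_plus_iff)
qed

lemma Hardy_plus_L2: "f \<in> Hardy_plus \<Longrightarrow> f \<in> L2"
  by (simp add: Hardy_plus_iff)

lemma Hardy_minus_L2: "f \<in> Hardy_minus \<Longrightarrow> f \<in> L2"
  by (simp add: Hardy_minus_def)

lemma L2_zero: "(\<lambda>t. 0) \<in> L2"
  by (simp add: L2_def)

lemma L2_integrable_powi: "f \<in> L2 \<Longrightarrow> integrable circle (\<lambda>t. f t * t powi k)"
  using L2_integrable[OF L2_powi_mult, of f k] by (simp add: mult.commute)

lemma Hardy_plus_zero: "(\<lambda>t. 0) \<in> Hardy_plus"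
  by (simp add: Hardy_plus_iff L2_zero)

lemma Hardy_plus_add: "f \<in> Hardy_plus \<Longrightarrow> g \<in> Hardy_plus \<Longrightarrow> (\<lambda>t. f t + g t) \<in> Hardy_plus"
  by (simp add: Hardy_plus_iff L2_add distrib_right L2_integrable_powi)

lemma Hardy_plus_scale: "f \<in> Hardy_plus \<Longrightarrow> (\<lambda>t. c * f t) \<in> Hardy_plus"
  by (simp add: Hardy_plus_iff L2_scale mult.assoc)

lemma Hardy_minus_zero: "(\<lambda>t. 0) \<in> Hardy_minus"
  by (simp add: Hardy_minus_def L2_zero L2_inner_def)

lemma Hardy_minus_add: "f \<in> Hardy_minus \<Longrightarrow> g \<in> Hardy_minus \<Longrightarrow> (\<lambda>t. f t + g t) \<in> Hardy_minus"
  by (simp add: Hardy_minus_def L2_inner_def L2_add distrib_right L2_integrable_mult_cnj Hardy_plus_L2)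

lemma Hardy_minus_scale: "f \<in> Hardy_minus \<Longrightarrow> (\<lambda>t. c * f t) \<in> Hardy_minus"
  by (simp add: Hardy_minus_def L2_inner_def L2_scale mult.assoc)

lemma mult_cnj_circle: "cmod t = 1 \<Longrightarrow> t * cnj t = 1"
  by (simp add: complex_norm_square[symmetric])

lemma cnj_eq_powi_circle: "cmod t = 1 \<Longrightarrow> cnj t = t powi (-1)"
  using cnj_powi_circle[of t 1] by simp

lemma cnj_powi_eq_circle: "cmod t = 1 \<Longrightarrow> cnj t powi k = t powi (-k)"
  using cnj_powi_circle[of t k] by simp

text \<open>Members of \<open>L2\<close> are functions on the whole plane, while rewriting powers of
  \<open>cnj t\<close> as powers of t is valid only for |t| = 1.\<close>

lemma L2_cong_circle:
  assumes "f \<in> L2" "\<And>t. cmod t = 1 \<Longrightarrow> f t = g t"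
  shows "g \<in> L2"
proof -
  have "AE t in circle. f t = g t" using assms(2) by (intro AE_I2) simp
  then have m: "g \<in> borel_measurable circle"
    using L2_measurable[OF assms(1)] by (rule borel_measurable_circle_AE[rotated])
  have "integrable circle (\<lambda>t. (cmod (f t))\<^sup>2) \<longleftrightarrow> integrable circle (\<lambda>t. (cmod (g t))\<^sup>2)"
    by (intro Bochner_Integration.integrable_cong) (use assms(2) in simp_all)
  then show ?thesis using assms(1) m by (simp add: L2_def)
qed

lemma L2_cnj_ident_mult: "f \<in> L2 \<Longrightarrow> (\<lambda>t. cnj t * f t) \<in> L2"
  by (rule L2_cong_circle[OF L2_powi_mult[of f "-1"]]) (simp_all add: cnj_eq_powi_circle)

lemma L2_ident_mult: "f \<in> L2 \<Longrightarrow> (\<lambda>t. t * f t) \<in> L2"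
  using L2_powi_mult[of f 1] by simp

lemma L2_cnj: "f \<in> L2 \<Longrightarrow> (\<lambda>t. cnj (f t)) \<in> L2"
  by (auto simp: L2_def)

lemma L2_cnj_powi_mult: "f \<in> L2 \<Longrightarrow> (\<lambda>t. cnj t powi k * f t) \<in> L2"
  by (rule L2_cong_circle[OF L2_powi_mult[of f "-k"]]) (simp_all add: cnj_powi_eq_circle)

text \<open>Backward shift: subtract the mean, then divide by t. This is the source of codimension
  one when the first index grows.\<close>

lemma Hardy_plus_decompose:
  assumes f: "f \<in> Hardy_plus"
  obtains g where "g \<in> Hardy_plus" "\<And>t. cmod t = 1 \<Longrightarrow> f t = (LINT t|circle. f t) + t * g t"
proof
  let ?c = "LINT t|circle. f t"
  let ?g = "\<lambda>t. cnj t * (f t + (-?c) * 1)"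
  show "f t = ?c + t * ?g t" if "cmod t = 1" for t
    using mult_cnj_circle[OF that] by (simp add: mult.assoc[symmetric])
  have fL2: "f \<in> L2" using f by (rule Hardy_plus_L2)
  have "(LINT t|circle. ?g t * t powi k) = 0" if "k > 0" for k
  proof -
    have "(LINT t|circle. ?g t * t powi k) = (LINT t|circle. f t * t powi (k - 1) - ?c * t powi (k - 1))"
    proof (intro Bochner_Integration.integral_cong refl)
      fix t assume "t \<in> space circle"
      then have t: "cmod t = 1" by simp
      have "cnj t * t powi k = t powi (k - 1)"
        using powi_add_circle[OF t, of "-1" k] by (simp only: cnj_eq_powi_circle[OF t]) (simp add: algebra_simps)
      moreover have "?g t * t powi k = (cnj t * t powi k) * (f t - ?c)" by (simp add: algebra_simps)
      ultimately show "?g t * t powi k = f t * t powi (k - 1) - ?c * t powi (k - 1)"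
        by (simp only:) (simp add: algebra_simps)
    qed
    also have "\<dots> = (LINT t|circle. f t * t powi (k - 1)) - ?c * (LINT t|circle. t powi (k - 1))"
      using L2_integrable_powi[OF fL2] L2_integrable[OF powi_L2] by simp
    also have "\<dots> = 0"
    \<comment> \<open>Only for k = 1 is the subtracted mean needed: the integral of \<open>f\<close>
      cancels against it. For larger k both integrals vanish separately.\<close>
    proof (cases "k = 1")
      case True
      then show ?thesis using circle.prob_space by (simp del: space_circle)
    next
      case False
      then show ?thesis using that f by (simp add: integral_circle_powi Hardy_plus_iff)
    qed
    finally show ?thesis .
  qed
  then show "?g \<in> Hardy_plus"
    unfolding Hardy_plus_iff using L2_cnj_ident_mult[OF L2_add[OF fL2 L2_scale[OF one_L2]]] by blast
qed

lemma Hardy_minus_cnj_ident: "cnj \<in> Hardy_minus"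
proof -
  have "cnj \<in> L2" using L2_cnj_ident_mult[OF one_L2] by simp
  moreover have "L2_inner cnj g = 0" if "g \<in> Hardy_plus" for g
  proof -
    have "L2_inner cnj g = cnj (LINT t|circle. g t * t powi 1)"
      by (simp add: L2_inner_def mult.commute flip: Bochner_Integration.integral_cnj)
    then show ?thesis using that unfolding Hardy_plus_iff by (metis complex_cnj_zero zero_less_one)
  qed
  ultimately show ?thesis by (simp add: Hardy_minus_def)
qed

lemma Hardy_minus_shift:
  assumes "f \<in> Hardy_minus"
  shows "(\<lambda>t. cnj t * f t) \<in> Hardy_minus"
proof -
  have "L2_inner (\<lambda>t. cnj t * f t) g = 0" if "g \<in> Hardy_plus" for g
  proof -
    have "L2_inner (\<lambda>t. cnj t * f t) g = L2_inner f (\<lambda>t. t * g t)"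
      by (simp add: L2_inner_def mult_ac)
    then show ?thesis using assms Hardy_plus_shift[OF that] by (simp add: Hardy_minus_def)
  qed
  then show ?thesis using assms by (simp add: Hardy_minus_def L2_cnj_ident_mult)
qed

text \<open>The counterpart in H^2_-, with \<open>c\<close> the coefficient of t^(-1).\<close>

lemma Hardy_minus_decompose:
  assumes f: "f \<in> Hardy_minus"
  obtains c g where "g \<in> Hardy_minus" "\<And>t. cmod t = 1 \<Longrightarrow> f t = c * cnj t + cnj t * g t"
proof
  define c where "c = (LINT t|circle. t * f t)"
  let ?g = "\<lambda>t. t * f t + (-c) * 1"
  show "f t = c * cnj t + cnj t * ?g t" if "cmod t = 1" for t
    using mult_cnj_circle[OF that] by (simp add: algebra_simps)
  have fL2: "f \<in> L2" using f by (rule Hardy_minus_L2)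
  have tf: "(\<lambda>t. t * f t) \<in> L2" using fL2 by (rule L2_ident_mult)
  have "L2_inner ?g h = 0" if h: "h \<in> Hardy_plus" for h
  proof -
    let ?d = "LINT t|circle. h t"
    \<comment> \<open>H^2_- is defined by orthogonality to all of H^2_+, so the test function is
      decomposed as well: its constant part meets the definition of \<open>c\<close>, its part
      divisible by t reduces to orthogonality of \<open>f\<close> and \<open>k\<close>.\<close>
    obtain k where k: "k \<in> Hardy_plus" "\<And>t. cmod t = 1 \<Longrightarrow> h t = ?d + t * k t"
      using Hardy_plus_decompose[OF h] by blast
    have "L2_inner ?g h = (LINT t|circle. t * f t * cnj (h t)) - c * cnj ?d"
      unfolding L2_inner_def
      using L2_integrable_mult_cnj[OF tf Hardy_plus_L2[OF h]] L2_integrable[OF L2_cnj[OF Hardy_plus_L2[OF h]]]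
      by (simp add: algebra_simps)
    also have "(LINT t|circle. t * f t * cnj (h t)) = (LINT t|circle. cnj ?d * (t * f t) + f t * cnj (k t))"
    proof (intro Bochner_Integration.integral_cong refl)
      fix t assume "t \<in> space circle"
      then have t: "cmod t = 1" by simp
      have "t * f t * cnj (h t) = cnj ?d * (t * f t) + (t * cnj t) * (f t * cnj (k t))"
        by (simp add: k(2)[OF t] algebra_simps)
      then show "t * f t * cnj (h t) = cnj ?d * (t * f t) + f t * cnj (k t)"
        using mult_cnj_circle[OF t] by simp
    qed
    also have "\<dots> = cnj ?d * c + L2_inner f k"
      unfolding c_def L2_inner_def
      using L2_integrable[OF tf] L2_integrable_mult_cnj[OF fL2 Hardy_plus_L2[OF k(1)]] by simp
    also have "L2_inner f k = 0" using f k(1) by (simp add: Hardy_minus_def)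
    finally show ?thesis by simp
  qed
  then show "?g \<in> Hardy_minus"
    unfolding Hardy_minus_def using L2_add[OF tf L2_scale[OF one_L2]] by blast
qed

text \<open>Conjugation carries the Szego inequality from H^2_+ over to the second component; the
  vanishing mean makes 1 minus such a function have mean 1.\<close>

lemma Hardy_minus_cnj:
  assumes f: "f \<in> Hardy_minus"
  shows "(\<lambda>t. cnj (f t)) \<in> Hardy_plus" "(LINT t|circle. cnj (f t)) = 0"
proof -
  have *: "(LINT t|circle. cnj (f t) * t powi k) = 0" if "k \<ge> 0" for k
  proof -
    have "(LINT t|circle. cnj (f t) * t powi k) = cnj (L2_inner f (\<lambda>t. t powi k))"
      by (simp add: L2_inner_def flip: Bochner_Integration.integral_cnj)
    then show ?thesis using f Hardy_plus_powi[OF that] by (simp add: Hardy_minus_def)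
  qed
  show "(\<lambda>t. cnj (f t)) \<in> Hardy_plus"
    using * by (simp add: Hardy_plus_iff L2_cnj Hardy_minus_L2[OF f])
  show "(LINT t|circle. cnj (f t)) = 0" using *[of 0] by simp
qed

subsection \<open>The Szego lower bound\<close>

lemma bounded_poly_circle:
  obtains B where "\<And>t. cmod t = 1 \<Longrightarrow> cmod (poly p t) \<le> B"
proof -
  have "bounded (poly p ` sphere 0 1)"
    by (intro compact_imp_bounded compact_continuous_image continuous_intros compact_sphere)
  then show ?thesis using that by (fastforce simp: bounded_iff)
qed

lemma measurable_poly_circle [measurable]: "poly p \<in> borel_measurable circle"
  by (intro borel_measurable_circle_continuous continuous_intros)

lemma L2_poly_mult: "f \<in> L2 \<Longrightarrow> (\<lambda>t. poly p t * f t) \<in> L2"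
  using bounded_poly_circle[of p] L2_mult_bounded[of f "poly p"] AE_I2[of circle] by (metis (lifting) mem_sphere_0 space_circle measurable_poly_circle)

text \<open>The integral is evaluation at 0, which is multiplicative. The induction peels off the
  constant coefficient and moves the remaining factor t to \<open>f\<close>, hence the
  generalization over \<open>f\<close>; the mean of t f is 0.\<close>

lemma Hardy_plus_integral_poly:
  assumes "f \<in> Hardy_plus"
  shows "(LINT t|circle. f t * poly p t) = (LINT t|circle. f t) * poly p 0"
  using assms
proof (induction p arbitrary: f)
  case (pCons a p)
  have f: "f \<in> L2" and tf: "(\<lambda>t. t * f t) \<in> Hardy_plus"
    using pCons.prems by (simp add: Hardy_plus_iff, rule Hardy_plus_shift)
  have "(LINT t|circle. f t * poly (pCons a p) t) = (LINT t|circle. a * f t + poly p t * (t * f t))"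
    by (simp add: algebra_simps)
  also have "\<dots> = (LINT t|circle. a * f t) + (LINT t|circle. poly p t * (t * f t))"
    using tf by (intro Bochner_Integration.integral_add L2_integrable L2_scale f L2_poly_mult) (auto simp: Hardy_plus_iff)
  also have "(LINT t|circle. poly p t * (t * f t)) = (LINT t|circle. t * f t) * poly p 0"
    using pCons.IH[OF tf] by (simp add: mult_ac)
  also have "(LINT t|circle. t * f t) = (LINT t|circle. f t * t powi 1)"
    by (simp add: mult_ac)
  also have "\<dots> = 0"
    using pCons.prems unfolding Hardy_plus_iff by (meson zero_less_one)
  finally show ?case by (simp add: mult_ac)
qed auto

lemma Hardy_plus_integral_exp_poly:
  assumes f: "f \<in> Hardy_plus"
  shows "(LINT t|circle. f t * exp (poly p t)) = (LINT t|circle. f t) * exp (poly p 0)"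
proof -
  have fL2: "f \<in> L2" using f by (simp add: Hardy_plus_iff)
  note [measurable] = L2_measurable[OF fL2]
  obtain B where B: "\<And>t. cmod t = 1 \<Longrightarrow> cmod (poly p t) \<le> B"
    using bounded_poly_circle by blast
  \<comment> \<open>Taylor polynomials of the exponential composed with \<open>p\<close> are again
    polynomials, bounded on the circle by \<open>exp B\<close>, so the polynomial case passes to the
    limit by dominated convergence.\<close>
  define s where "s n = (\<Sum>k<n. smult (1 / fact k) (p ^ k))" for n
  have s: "poly (s n) t = (\<Sum>k<n. poly p t ^ k /\<^sub>R fact k)" for n t
    by (simp add: s_def poly_sum poly_power scaleR_conv_of_real divide_inverse)
  have lim: "(\<lambda>n. poly (s n) t) \<longlonglongrightarrow> exp (poly p t)" for t
    using exp_converges[of "poly p t"] by (simp add: s sums_def)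
  have bound: "cmod (poly (s n) t) \<le> exp B" if "cmod t = 1" for n t
  proof -
    have "cmod (poly (s n) t) \<le> (\<Sum>k<n. cmod (poly p t) ^ k /\<^sub>R fact k)"
      unfolding s by (intro sum_norm_le) (simp add: norm_power)
    also have "\<dots> \<le> exp (cmod (poly p t))"
      unfolding exp_def by (intro sum_le_suminf summable_exp_generic) auto
    finally show ?thesis using B[OF that] by (smt (verit) exp_le_cancel_iff)
  qed
  have "(\<lambda>n. LINT t|circle. f t * poly (s n) t) \<longlonglongrightarrow> (LINT t|circle. f t * exp (poly p t))"
  proof (rule integral_dominated_convergence)
    show "integrable circle (\<lambda>t. cmod (f t) * exp B)"
      using L2_integrable[OF fL2] by simp
    show "AE t in circle. (\<lambda>n. f t * poly (s n) t) \<longlonglongrightarrow> f t * exp (poly p t)"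
      by (intro AE_I2 tendsto_intros lim)
    show "AE t in circle. norm (f t * poly (s n) t) \<le> cmod (f t) * exp B" for n
      by (intro AE_I2) (auto simp: norm_mult intro!: mult_left_mono bound)
  qed measurable
  moreover have "(\<lambda>n. LINT t|circle. f t * poly (s n) t) \<longlonglongrightarrow> (LINT t|circle. f t) * exp (poly p 0)"
    unfolding Hardy_plus_integral_poly[OF f] by (intro tendsto_intros lim)
  ultimately show ?thesis by (rule LIMSEQ_unique)
qed

text \<open>On the circle the product is a Laurent polynomial and splits into an analytic and a
  conjugate-analytic part. Multiplying \<open>cnj (poly s t)\<close> by t lowers its degree; its
  constant coefficient moves to the linear term of the analytic part.\<close>

lemma poly_mult_cnj_poly_circle:
  "\<exists>r s. \<forall>t. cmod t = 1 \<longrightarrow> poly p t * cnj (poly q t) = poly r t + cnj (poly s t)"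
proof (induction p)
  case 0
  then show ?case by (intro exI[of _ 0]) simp
next
  case (pCons a p)
  then obtain r s where rs: "\<And>t. cmod t = 1 \<Longrightarrow> poly p t * cnj (poly q t) = poly r t + cnj (poly s t)"
    by blast
  obtain b s' where s: "s = pCons b s'"
    using pCons_cases by blast
  have "poly (pCons a p) t * cnj (poly q t)
      = poly (pCons 0 r + [:0, cnj b:]) t + cnj (poly (smult (cnj a) q + s') t)" if "cmod t = 1" for t
  proof -
    have t: "t * cnj t = 1" using that by (simp add: complex_norm_square[symmetric])
    have "poly (pCons a p) t * cnj (poly q t) = a * cnj (poly q t) + t * (poly p t * cnj (poly q t))"
      by (simp add: algebra_simps)
    also have "\<dots> = a * cnj (poly q t) + t * poly r t + t * cnj b + (t * cnj t) * cnj (poly s' t)"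
      unfolding rs[OF that] s by (simp add: algebra_simps)
    finally show ?thesis unfolding t by (simp add: algebra_simps)
  qed
  then show ?case by blast
qed

text \<open>From 2 Re z Re w = Re (z w) + Re (z cnj w), where conjugation does not change the real
  part of the second summand \<open>s\<close>. Stone-Weierstrass demands this closure under
  products.\<close>

lemma Re_poly_mult_circle:
  "\<exists>r. \<forall>t. cmod t = 1 \<longrightarrow> Re (poly p t) * Re (poly q t) = Re (poly r t)"
proof -
  obtain r s where rs: "\<And>t. cmod t = 1 \<Longrightarrow> poly p t * cnj (poly q t) = poly r t + cnj (poly s t)"
    using poly_mult_cnj_poly_circle by blast
  have "Re (poly p t) * Re (poly q t) = Re (poly (smult (1/2) (p * q + r + s)) t)" if "cmod t = 1" for t
  proof -
    have "2 * (Re (poly p t) * Re (poly q t)) = Re (poly p t * poly q t) + Re (poly p t * cnj (poly q t))"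
      by simp
    also have "\<dots> = Re (poly (p * q + r + s) t)"
      unfolding rs[OF that] by simp
    finally show ?thesis by simp
  qed
  then show ?thesis by blast
qed

lemma Re_poly_dense_circle:
  fixes u :: "complex \<Rightarrow> real"
  assumes "continuous_on (sphere 0 1) u" "e > 0"
  obtains p where "\<And>t. cmod t = 1 \<Longrightarrow> \<bar>u t - Re (poly p t)\<bar> < e"
proof -
  have "\<exists>g. (\<exists>p. \<forall>t. cmod t = 1 \<longrightarrow> g t = Re (poly p t)) \<and> (\<forall>t\<in>sphere 0 1. \<bar>u t - g t\<bar> < e)"
  proof (rule Stone_Weierstrass_HOL[of "sphere 0 1"])
    show "\<exists>p. \<forall>t. cmod t = 1 \<longrightarrow> c = Re (poly p t)" for c
      by (rule exI[of _ "[:of_real c:]"]) simp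
    fix f :: "complex \<Rightarrow> real" assume "\<exists>p. \<forall>t. cmod t = 1 \<longrightarrow> f t = Re (poly p t)"
    then obtain p where "\<forall>t. cmod t = 1 \<longrightarrow> f t = Re (poly p t)" by blast
    then show "continuous_on (sphere 0 1) f"
      by (subst continuous_on_cong[OF refl, of _ _ "\<lambda>t. Re (poly p t)"]) (auto intro!: continuous_intros)
  next
    fix f g :: "complex \<Rightarrow> real"
    assume "(\<exists>p. \<forall>t. cmod t = 1 \<longrightarrow> f t = Re (poly p t)) \<and> (\<exists>p. \<forall>t. cmod t = 1 \<longrightarrow> g t = Re (poly p t))"
    then obtain p q where pq: "\<And>t. cmod t = 1 \<Longrightarrow> f t = Re (poly p t)" "\<And>t. cmod t = 1 \<Longrightarrow> g t = Re (poly q t)"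
      by blast
    then show "\<exists>p. \<forall>t. cmod t = 1 \<longrightarrow> f t + g t = Re (poly p t)"
      by (intro exI[of _ "p + q"]) simp
    show "\<exists>p. \<forall>t. cmod t = 1 \<longrightarrow> f t * g t = Re (poly p t)"
      using Re_poly_mult_circle[of p q] pq by simp
  next
    fix x y :: complex assume "x \<in> sphere 0 1 \<and> y \<in> sphere 0 1 \<and> x \<noteq> y"
    then consider "Re x \<noteq> Re y" | "Im x \<noteq> Im y" using complex_eqI by blast
    then show "\<exists>f. (\<exists>p. \<forall>t. cmod t = 1 \<longrightarrow> f t = Re (poly p t)) \<and> f x \<noteq> f y"
    proof cases
      case 1
      then show ?thesis by (intro exI[of _ Re] conjI exI[of _ "[:0, 1:]"]) auto
    next
      case 2
      then show ?thesis by (intro exI[of _ Im] conjI exI[of _ "[:0, -\<i>:]"]) auto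
    qed
  qed (use assms in auto)
  then show ?thesis using that by fastforce
qed

lemma Hardy_plus_Szego_poly:
  assumes f: "f \<in> Hardy_plus"
  shows "cmod (LINT t|circle. f t) * exp (LINT t|circle. Re (poly p t)) \<le> (LINT t|circle. cmod (f t) * exp (Re (poly p t)))"
proof -
  \<comment> \<open>The constant function 1 in the mean value formula identifies p(0) with the mean
    of \<open>p\<close>.\<close>
  have "(LINT t|circle. 1 * poly p t) = (LINT t|circle. 1) * poly p 0"
    by (rule Hardy_plus_integral_poly[OF Hardy_plus_one])
  then have "(LINT t|circle. poly p t) = poly p 0"
    using circle.prob_space by (simp del: space_circle)
  moreover have "integrable circle (poly p)"
    using L2_integrable[OF L2_poly_mult[OF one_L2]] by simp
  ultimately have "(LINT t|circle. Re (poly p t)) = Re (poly p 0)"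
    by simp
  then have "cmod (LINT t|circle. f t) * exp (LINT t|circle. Re (poly p t)) = cmod (LINT t|circle. f t * exp (poly p t))"
    by (simp add: Hardy_plus_integral_exp_poly[OF f] norm_mult)
  also have "\<dots> \<le> (LINT t|circle. cmod (f t * exp (poly p t)))"
    by (rule integral_norm_bound)
  finally show ?thesis by (simp add: norm_mult)
qed

lemma integrable_norm_mult_bounded:
  fixes f :: "'a \<Rightarrow> 'b::{banach, second_countable_topology}" and h :: "'a \<Rightarrow> real"
  assumes "integrable M f" "h \<in> borel_measurable M" "AE x in M. \<bar>h x\<bar> \<le> B"
  shows "integrable M (\<lambda>x. norm (f x) * h x)"
proof (rule Bochner_Integration.integrable_bound)
  show "integrable M (\<lambda>x. norm (f x) * B)"
    using assms by simp
  show "AE x in M. norm (norm (f x) * h x) \<le> norm (norm (f x) * B)"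
    using assms(3) by eventually_elim (auto simp: abs_mult intro!: mult_left_mono)
qed (use assms in measurable)

lemma Hardy_plus_Szego_continuous:
  fixes u :: "complex \<Rightarrow> real"
  assumes f: "f \<in> Hardy_plus" and u: "continuous_on (sphere 0 1) u"
  shows "cmod (LINT t|circle. f t) * exp (LINT t|circle. u t) \<le> (LINT t|circle. cmod (f t) * exp (u t))"
proof -
  let ?c = "cmod (LINT t|circle. f t)" and ?I = "LINT t|circle. cmod (f t) * exp (u t)"
  have fint: "integrable circle f" using f by (simp add: Hardy_plus_iff L2_integrable)
  note [measurable] = borel_measurable_circle_continuous[OF u]
  have bdd: "\<exists>B. \<forall>t. cmod t = 1 \<longrightarrow> \<bar>g t\<bar> \<le> B" if "continuous_on (sphere 0 1) g" for g :: "complex \<Rightarrow> real"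
  proof -
    have "bounded (g ` sphere 0 1)"
      using that by (intro compact_imp_bounded compact_continuous_image) auto
    then show ?thesis by (fastforce simp: bounded_iff)
  qed
  have int: "integrable circle g" if "continuous_on (sphere 0 1) g" for g :: "complex \<Rightarrow> real"
    using bdd[OF that] borel_measurable_circle_continuous[OF that]
    by (auto intro!: circle.integrable_const_bound AE_I2)
  have intexp: "integrable circle (\<lambda>t. cmod (f t) * exp (g t))" if "continuous_on (sphere 0 1) g" for g :: "complex \<Rightarrow> real"
  proof -
    have c: "continuous_on (sphere 0 1) (\<lambda>t. exp (g t))" using that by (intro continuous_intros)
    show ?thesis
      using bdd[OF c] borel_measurable_circle_continuous[OF c]
      by (auto intro!: integrable_norm_mult_bounded fint AE_I2)
  qed
  \<comment> \<open>One factor \<open>exp e\<close> pays for replacing \<open>u\<close> by Re p in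
    the mean on the left, the other for replacing Re p by \<open>u\<close> in the integrand on the
    right.\<close>
  have *: "?c * exp (LINT t|circle. u t) \<le> exp (2 * e) * ?I" if "e > 0" for e
  proof -
    obtain p where p: "\<And>t. cmod t = 1 \<Longrightarrow> \<bar>u t - Re (poly p t)\<bar> < e"
      using Re_poly_dense_circle[OF u \<open>e > 0\<close>] by blast
    have cp: "continuous_on (sphere 0 1) (\<lambda>t. Re (poly p t))" by (intro continuous_intros)
    have "(LINT t|circle. u t) \<le> (LINT t|circle. Re (poly p t) + e)"
    proof (rule integral_mono_AE)
      show "AE t in circle. u t \<le> Re (poly p t) + e"
      proof (rule AE_I2)
        fix t assume "t \<in> space circle" then show "u t \<le> Re (poly p t) + e" using p[of t] by auto
      qed
    qed (use int[OF u] int[OF cp] in auto)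
    also have "\<dots> = (LINT t|circle. Re (poly p t)) + e"
      using int[OF cp] circle.prob_space by (simp del: space_circle)
    finally have "?c * exp (LINT t|circle. u t) \<le> ?c * exp ((LINT t|circle. Re (poly p t)) + e)"
      by (intro mult_left_mono) auto
    also have "\<dots> \<le> (LINT t|circle. cmod (f t) * exp (Re (poly p t))) * exp e"
      using Hardy_plus_Szego_poly[OF f, of p] by (simp add: exp_add mult.assoc[symmetric])
    also have "(LINT t|circle. cmod (f t) * exp (Re (poly p t))) \<le> (LINT t|circle. cmod (f t) * exp (u t) * exp e)"
    proof (rule integral_mono_AE)
      show "AE t in circle. cmod (f t) * exp (Re (poly p t)) \<le> cmod (f t) * exp (u t) * exp e"
      proof (rule AE_I2)
        fix t assume "t \<in> space circle"
        then have "Re (poly p t) \<le> u t + e" using p[of t] by auto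
        then have "cmod (f t) * exp (Re (poly p t)) \<le> cmod (f t) * exp (u t + e)"
          by (intro mult_left_mono) auto
        then show "cmod (f t) * exp (Re (poly p t)) \<le> cmod (f t) * exp (u t) * exp e"
          by (simp add: exp_add mult_ac)
      qed
    qed (use intexp[OF cp] intexp[OF u] in auto)
    finally show ?thesis using exp_double[of e] by (simp add: power2_eq_square mult_ac)
  qed
  have "((\<lambda>e. exp (2 * e) * ?I) \<longlongrightarrow> exp (2 * 0) * ?I) (at_right 0)"
    by (intro tendsto_intros)
  then have "?c * exp (LINT t|circle. u t) \<le> exp (2 * 0) * ?I"
    by (rule tendsto_lowerbound) (auto intro!: eventually_at_rightI[of 0 1] *)
  then show ?thesis by simp
qed

section \<open>Continuous approximation of bounded measurable functions on the circle\<close>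

lemma Arg2pi_cis: "0 \<le> x \<Longrightarrow> x < 2 * pi \<Longrightarrow> Arg2pi (cis x) = x"
  by (rule Arg2pi_unique[of 1]) (auto simp: cis_conv_exp)

text \<open>Countable quantifiers suffice to express convergence to a prescribed limit.
  Measurability of the set is required when an almost-everywhere statement is pulled back along
  \<open>cis\<close>.\<close>

lemma pred_LIMSEQ:
  fixes f :: "nat \<Rightarrow> 'a \<Rightarrow> real"
  assumes [measurable]: "\<And>n. f n \<in> borel_measurable M" "g \<in> borel_measurable M"
  shows "{x \<in> space M. (\<lambda>n. f n x) \<longlonglongrightarrow> g x} \<in> sets M"
proof -
  have "(\<lambda>n. f n x) \<longlonglongrightarrow> g x \<longleftrightarrow> (\<forall>k::nat. \<exists>N. \<forall>n\<ge>N. \<bar>f n x - g x\<bar> < inverse (real (Suc k)))" for x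
  proof
    assume "(\<lambda>n. f n x) \<longlonglongrightarrow> g x"
    then show "\<forall>k::nat. \<exists>N. \<forall>n\<ge>N. \<bar>f n x - g x\<bar> < inverse (real (Suc k))"
      by (auto simp: LIMSEQ_iff simp del: of_nat_Suc)
  next
    assume *: "\<forall>k::nat. \<exists>N. \<forall>n\<ge>N. \<bar>f n x - g x\<bar> < inverse (real (Suc k))"
    show "(\<lambda>n. f n x) \<longlonglongrightarrow> g x"
      unfolding LIMSEQ_iff
    proof (intro allI impI)
      fix r :: real assume "r > 0"
      then obtain k where "inverse (real (Suc k)) < r" using reals_Archimedean by blast
      then show "\<exists>N. \<forall>n\<ge>N. norm (f n x - g x) < r"
        using * by (metis order_less_trans real_norm_def)
    qed
  qed
  then show ?thesis by simp
qed

text \<open>The factor \<open>min 1 (n * cmod (t - 1))\<close> removes the jump of the argument at 1.\<close>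

lemma bounded_measurable_circle_approx:
  fixes v :: "complex \<Rightarrow> real"
  assumes v: "v \<in> borel_measurable circle" and B: "AE t in circle. \<bar>v t\<bar> \<le> B" "0 \<le> B"
  obtains u :: "nat \<Rightarrow> complex \<Rightarrow> real" where
    "\<And>n. continuous_on (sphere 0 1) (u n)" "\<And>n t. \<bar>u n t\<bar> \<le> B"
    "AE t in circle. (\<lambda>n. u n t) \<longlonglongrightarrow> v t"
proof -
  let ?C = "distr (uniform_measure lborel {0..2 * pi}) (restrict_space borel (sphere 0 1)) cis"
  \<comment> \<open>Composition with \<open>cis\<close> is available for Borel functions, so
    \<open>v\<close> is replaced by a Borel representative.\<close>
  obtain v' where v'[measurable]: "v' \<in> borel_measurable ?C" and v'_eq: "AE t in ?C. v t = v' t"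
    using completion_ex_borel_measurable_real[of v ?C] v unfolding circle_def by blast
  have "v' \<in> borel_measurable (restrict_space borel (sphere 0 1))" using v' by simp
  then have "(\<lambda>x. v' (cis x)) \<in> borel_measurable lborel"
    by (rule measurable_compose[rotated])
      (auto intro!: measurable_restrict_space2 borel_measurable_continuous_onI continuous_intros)
  then have "(\<lambda>x. v' (cis x)) measurable_on UNIV"
    by (intro lebesgue_measurable_imp_measurable_on_real measurable_completion) auto
  \<comment> \<open>\<open>measurable_on\<close> supplies continuous functions on the line
    converging off a negligible set; they need not be periodic.\<close>
  then obtain N g where N: "negligible N" and g: "\<And>n. continuous_on UNIV (g n)"
    and lim: "\<And>x. x \<notin> N \<Longrightarrow> (\<lambda>n. g n x) \<longlonglongrightarrow> v' (cis x)"
    unfolding measurable_on_def by auto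
  define c where "c n t = min 1 (real n * cmod (t - 1))" for n t
  define h where "h n x = max (-B) (min B (g n x))" for n x
  define u where "u n t = c n t * h n (Arg2pi t)" for n t
  have c: "0 \<le> c n t" "c n t \<le> 1" "continuous_on UNIV (c n)" for n t
    by (auto simp: c_def intro!: continuous_intros)
  have h: "\<bar>h n x\<bar> \<le> B" for n x
    using B(2) by (auto simp: h_def)
  have ch: "isCont (h n) x" for n x
    using g[of n] unfolding h_def by (intro continuous_intros) (simp add: continuous_on_eq_continuous_at)
  have bound: "\<bar>u n t\<bar> \<le> B * c n t" for n t
    using mult_left_mono[OF h c(1)] c(1) by (simp add: u_def abs_mult mult.commute)
  have cont: "continuous_on (sphere 0 1) (u n)" for n
    unfolding continuous_on_eq_continuous_within
  proof
    fix t :: complex assume t: "t \<in> sphere 0 1"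
    have ct: "isCont (c n) t" using c(3)[of n] by (simp add: continuous_on_eq_continuous_at)
    show "continuous (at t within sphere 0 1) (u n)"
    proof (cases "t = 1")
      case False
      then have "t \<notin> \<real>\<^sub>\<ge>\<^sub>0" using t by (auto simp: nonneg_Reals_def)
      then have "isCont Arg2pi t" by (rule continuous_at_Arg2pi)
      then have "isCont (\<lambda>t. h n (Arg2pi t)) t" using isCont_o2[OF _ ch] by blast
      then have "isCont (u n) t" unfolding u_def using ct by (intro continuous_intros)
      then show ?thesis by (rule continuous_at_imp_continuous_within)
    next
      case True
      have "c n t = 0" by (simp add: True c_def)
      moreover have "(c n \<longlongrightarrow> c n t) (at t)" using ct by (simp add: isCont_def)
      ultimately have "((\<lambda>t. B * c n t) \<longlongrightarrow> B * 0) (at t)" by (intro tendsto_intros) simp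
      then have "(u n \<longlongrightarrow> 0) (at t)"
        unfolding mult_zero_right
        by (rule Lim_null_comparison[rotated]) (auto intro: always_eventually bound)
      then have "isCont (u n) t" by (simp add: isCont_def u_def True c_def)
      then show ?thesis by (rule continuous_at_imp_continuous_within)
    qed
  qed
  have um[measurable]: "u n \<in> borel_measurable ?C" for n
    using borel_measurable_continuous_on_restrict[OF cont] by simp
  \<comment> \<open>\<open>v'\<close> obeys the bound only almost everywhere, so the truncated
    approximants converge to its truncation, which equals \<open>v\<close> almost
    everywhere.\<close>
  define w where "w t = max (-B) (min B (v' t))" for t
  have wm[measurable]: "w \<in> borel_measurable ?C" unfolding w_def by measurable
  have *: "AE x in lborel. x \<in> {0..2*pi} \<longrightarrow> (\<lambda>n. u n (cis x)) \<longlonglongrightarrow> w (cis x)"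
  proof -
    have "AE x in lborel. x \<notin> N"
      using N unfolding negligible_iff_null_sets by (metis AE_not_in AE_completion_iff)
    moreover have "AE x in lborel. x \<noteq> 0" "AE x in lborel. x \<noteq> 2 * pi"
      by (rule AE_lborel_singleton)+
    ultimately show ?thesis
    proof (eventually_elim, intro impI)
      fix x assume x: "x \<notin> N" "x \<noteq> 0" "x \<noteq> 2 * pi" "x \<in> {0..2*pi}"
      then have A: "Arg2pi (cis x) = x" by (intro Arg2pi_cis) auto
      have "cis x \<noteq> 1"
      proof
        assume "cis x = 1"
        then have "Arg2pi (cis x) = 0" using Arg2pi_cis[of 0] by simp
        then show False using A x by simp
      qed
      then have d: "cmod (cis x - 1) > 0" by simp
      obtain k :: nat where k: "1 < real k * cmod (cis x - 1)"
        using reals_Archimedean3[OF d] by blast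
      have "eventually (\<lambda>n. c n (cis x) = 1) sequentially"
        unfolding eventually_sequentially
      proof (intro exI[of _ k] allI impI)
        fix n assume "k \<le> n"
        then have "real k * cmod (cis x - 1) \<le> real n * cmod (cis x - 1)"
          by (intro mult_right_mono) auto
        then show "c n (cis x) = 1" using k by (simp add: c_def)
      qed
      then have "(\<lambda>n. c n (cis x)) \<longlonglongrightarrow> 1" by (rule tendsto_eventually)
      moreover have "(\<lambda>n. h n x) \<longlonglongrightarrow> w (cis x)"
        unfolding h_def w_def by (intro tendsto_intros lim x)
      ultimately have "(\<lambda>n. c n (cis x) * h n x) \<longlonglongrightarrow> 1 * w (cis x)" by (rule tendsto_mult)
      then show "(\<lambda>n. u n (cis x)) \<longlonglongrightarrow> w (cis x)" by (simp add: u_def A)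
    qed
  qed
  have "AE t in ?C. (\<lambda>n. u n t) \<longlonglongrightarrow> w t"
  proof (subst AE_distr_iff[OF measurable_cis])
    show "{t \<in> space (restrict_space borel (sphere 0 1)). (\<lambda>n. u n t) \<longlonglongrightarrow> w t} \<in> sets (restrict_space borel (sphere 0 1))"
      using um wm by (intro pred_LIMSEQ) simp_all
    show "AE x in uniform_measure lborel {0..2 * pi}. (\<lambda>n. u n (cis x)) \<longlonglongrightarrow> w (cis x)"
      by (intro AE_uniform_measureI *) auto
  qed
  then have "AE t in circle. (\<lambda>n. u n t) \<longlonglongrightarrow> w t" unfolding circle_def by (rule AE_completion)
  moreover have "AE t in circle. v t = v' t" using v'_eq unfolding circle_def by (rule AE_completion)
  ultimately have "AE t in circle. (\<lambda>n. u n t) \<longlonglongrightarrow> v t"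
    using B(1) by eventually_elim (simp add: w_def)
  moreover have "\<bar>u n t\<bar> \<le> B" for n t
    using bound[of n t] mult_left_le[OF c(2)[of n t] B(2)] by linarith
  ultimately show ?thesis using that cont by blast
qed

lemma Hardy_plus_Szego_bounded:
  fixes v :: "complex \<Rightarrow> real"
  assumes f: "f \<in> Hardy_plus" and v[measurable]: "v \<in> borel_measurable circle"
    and B: "AE t in circle. \<bar>v t\<bar> \<le> B" "0 \<le> B"
  shows "cmod (LINT t|circle. f t) * exp (LINT t|circle. v t) \<le> (LINT t|circle. cmod (f t) * exp (v t))"
proof -
  obtain u where u: "\<And>n. continuous_on (sphere 0 1) (u n)" "\<And>n t. \<bar>u n t\<bar> \<le> B"
    and lim: "AE t in circle. (\<lambda>n. u n t) \<longlonglongrightarrow> v t"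
    using bounded_measurable_circle_approx[OF v B] by blast
  have fint: "integrable circle f" using f by (simp add: Hardy_plus_iff L2_integrable)
  note [measurable] = borel_measurable_circle_continuous[OF u(1)] borel_measurable_integrable[OF fint]
  have "(\<lambda>n. LINT t|circle. u n t) \<longlonglongrightarrow> (LINT t|circle. v t)"
    by (rule integral_dominated_convergence[where w="\<lambda>_. B"]) (use u(2) lim in auto)
  then have "(\<lambda>n. cmod (LINT t|circle. f t) * exp (LINT t|circle. u n t)) \<longlonglongrightarrow> cmod (LINT t|circle. f t) * exp (LINT t|circle. v t)"
    by (intro tendsto_intros)
  moreover have "(\<lambda>n. LINT t|circle. cmod (f t) * exp (u n t)) \<longlonglongrightarrow> (LINT t|circle. cmod (f t) * exp (v t))"
  proof (rule integral_dominated_convergence)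
    show "integrable circle (\<lambda>t. cmod (f t) * exp B)" using fint by simp
    show "AE t in circle. (\<lambda>n. cmod (f t) * exp (u n t)) \<longlonglongrightarrow> cmod (f t) * exp (v t)"
      using lim by eventually_elim (intro tendsto_intros)
    have "exp (u n t) \<le> exp B" for n t using u(2)[of n t] by simp
    then show "AE t in circle. norm (cmod (f t) * exp (u n t)) \<le> cmod (f t) * exp B" for n
      by (auto simp: abs_mult intro!: mult_left_mono)
  qed measurable
  ultimately show ?thesis
    by (rule LIMSEQ_le) (use Hardy_plus_Szego_continuous[OF f u(1)] in blast)
qed

text \<open>Truncating \<open>v\<close> from below only enlarges its mean, so the left side needs no
  limit. On the right, \<open>v\<close> being nonpositive keeps the exponentials at most 1 and |f|
  dominates.\<close>

lemma Hardy_plus_Szego_integrable: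
  fixes v :: "complex \<Rightarrow> real"
  assumes f: "f \<in> Hardy_plus" and v: "integrable circle v" and neg: "AE t in circle. v t \<le> 0"
  shows "cmod (LINT t|circle. f t) * exp (LINT t|circle. v t) \<le> (LINT t|circle. cmod (f t) * exp (v t))"
proof -
  have fint: "integrable circle f" using f by (simp add: Hardy_plus_iff L2_integrable)
  note [measurable] = borel_measurable_integrable[OF v] borel_measurable_integrable[OF fint]
  define w where "w n t = max (v t) (- real n)" for n t
  have [measurable]: "w n \<in> borel_measurable circle" for n
    unfolding w_def by measurable
  have w: "AE t in circle. \<bar>w n t\<bar> \<le> real n" for n
    using neg by eventually_elim (auto simp: w_def)
  have wint: "integrable circle (w n)" for n
    using w[of n] by (intro circle.integrable_const_bound[of _ "real n"]) auto
  have "cmod (LINT t|circle. f t) * exp (LINT t|circle. v t) \<le> (LINT t|circle. cmod (f t) * exp (w n t))" for n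
  proof -
    have "(LINT t|circle. v t) \<le> (LINT t|circle. w n t)"
      by (intro integral_mono v wint) (simp add: w_def)
    then have "cmod (LINT t|circle. f t) * exp (LINT t|circle. v t) \<le> cmod (LINT t|circle. f t) * exp (LINT t|circle. w n t)"
      by (intro mult_left_mono) auto
    also have "\<dots> \<le> (LINT t|circle. cmod (f t) * exp (w n t))"
      by (rule Hardy_plus_Szego_bounded[OF f _ w]) auto
    finally show ?thesis .
  qed
  moreover have "(\<lambda>n. LINT t|circle. cmod (f t) * exp (w n t)) \<longlonglongrightarrow> (LINT t|circle. cmod (f t) * exp (v t))"
  proof (rule integral_dominated_convergence)
    show "integrable circle (\<lambda>t. cmod (f t))" using fint by simp
    have "(\<lambda>n. w n t) \<longlonglongrightarrow> v t" for t
    proof (rule tendsto_eventually)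
      obtain k :: nat where "- v t < real k" using reals_Archimedean2 by blast
      then show "eventually (\<lambda>n. w n t = v t) sequentially"
        by (intro eventually_sequentiallyI[of k]) (auto simp: w_def)
    qed
    then show "AE t in circle. (\<lambda>n. cmod (f t) * exp (w n t)) \<longlonglongrightarrow> cmod (f t) * exp (v t)"
      by (intro AE_I2 tendsto_intros)
    show "AE t in circle. norm (cmod (f t) * exp (w n t)) \<le> cmod (f t)" for n
      using neg by eventually_elim (auto simp: abs_mult w_def intro!: mult_left_le)
  qed measurable
  ultimately show ?thesis
    by (intro LIMSEQ_le_const) auto
qed

lemma (in prob_space) square_expectation_le:
  fixes X :: "'a \<Rightarrow> real"
  assumes "integrable M X" "integrable M (\<lambda>x. (X x)\<^sup>2)"
  shows "(expectation X)\<^sup>2 \<le> expectation (\<lambda>x. (X x)\<^sup>2)"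
  using variance_positive[of X] variance_eq[OF assms] by simp

text \<open>Apply the previous inequality to half the logarithm, so that the integrand is |f| times
  the root of \<open>w\<close>, and square: on a probability space the squared mean is at most the
  mean of the square. The bound \<open>w t \<le> 1\<close> makes the logarithm nonpositive.\<close>

lemma Hardy_plus_Szego_weighted:
  assumes f: "f \<in> Hardy_plus" and w[measurable]: "w \<in> borel_measurable circle"
    and w01: "AE t in circle. 0 < w t \<and> w t \<le> 1" and ln: "integrable circle (\<lambda>t. ln (w t))"
  shows "(cmod (LINT t|circle. f t))\<^sup>2 * exp (LINT t|circle. ln (w t)) \<le> (LINT t|circle. w t * (cmod (f t))\<^sup>2)"
proof -
  have fL2: "f \<in> L2" using f by (simp add: Hardy_plus_iff)
  note [measurable] = L2_measurable[OF fL2]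
  let ?X = "\<lambda>t. cmod (f t) * exp (ln (w t) / 2)"
  have neg: "AE t in circle. ln (w t) / 2 \<le> 0"
    using w01 by eventually_elim auto
  have "AE t in circle. \<bar>exp (ln (w t) / 2)\<bar> \<le> 1"
    using neg by eventually_elim simp
  then have X: "integrable circle ?X"
    by (intro integrable_norm_mult_bounded[where B=1] L2_integrable fL2) auto
  have X2_eq: "AE t in circle. (?X t)\<^sup>2 = w t * (cmod (f t))\<^sup>2"
    using w01 by eventually_elim (simp add: power_mult_distrib exp_double[symmetric])
  have "AE t in circle. norm (w t * (cmod (f t))\<^sup>2) \<le> norm ((cmod (f t))\<^sup>2)"
    using w01 by eventually_elim (simp add: abs_mult mult_left_le_one_le)
  then have "integrable circle (\<lambda>t. w t * (cmod (f t))\<^sup>2)"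
    by (intro Bochner_Integration.integrable_bound[OF L2_integrable_square[OF fL2]]) measurable
  then have X2: "integrable circle (\<lambda>t. (?X t)\<^sup>2)"
    using X2_eq by (subst integrable_cong_AE) auto
  have "(cmod (LINT t|circle. f t))\<^sup>2 * exp (LINT t|circle. ln (w t))
      = (cmod (LINT t|circle. f t) * exp (LINT t|circle. ln (w t) / 2))\<^sup>2"
    by (simp add: power_mult_distrib exp_double[symmetric])
  also have "\<dots> \<le> (LINT t|circle. ?X t)\<^sup>2"
    by (intro power_mono Hardy_plus_Szego_integrable f neg) (use ln in auto)
  also have "\<dots> \<le> (LINT t|circle. (?X t)\<^sup>2)"
    by (rule circle.square_expectation_le[OF X X2])
  also have "\<dots> = (LINT t|circle. w t * (cmod (f t))\<^sup>2)"
    using X2_eq by (intro integral_cong_AE) auto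
  finally show ?thesis .
qed

subsection \<open>Complete semi-inner product spaces\<close>

text \<open>Only semidefiniteness is required, because functions vanishing almost everywhere are
  nonzero null vectors. The carrier \<open>V\<close> is a subset since the function type also
  contains functions outside the space. Limits, and later projections, exist but are unique only up
  to null vectors.\<close>

locale complete_semi_inner_space = vector_space scale
  for scale :: "complex \<Rightarrow> 'a::ab_group_add \<Rightarrow> 'a" (infixr \<open>*c\<close> 75) +
  fixes V :: "'a set" and ip :: "'a \<Rightarrow> 'a \<Rightarrow> complex"
  assumes subspace_V: "subspace V"
    and ip_add_left: "\<lbrakk>x \<in> V; y \<in> V; z \<in> V\<rbrakk> \<Longrightarrow> ip (x + y) z = ip x z + ip y z"
    and ip_scale_left: "\<lbrakk>x \<in> V; y \<in> V\<rbrakk> \<Longrightarrow> ip (c *c x) y = c * ip x y"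
    and ip_cnj: "\<lbrakk>x \<in> V; y \<in> V\<rbrakk> \<Longrightarrow> cnj (ip x y) = ip y x"
    and ip_nonneg: "x \<in> V \<Longrightarrow> 0 \<le> Re (ip x x)"
    and ip_complete: "\<lbrakk>\<And>n::nat. X n \<in> V;
        \<And>e. e > 0 \<Longrightarrow> \<exists>N. \<forall>m\<ge>N. \<forall>n\<ge>N. Re (ip (X m - X n) (X m - X n)) < e\<rbrakk>
      \<Longrightarrow> \<exists>x\<in>V. (\<lambda>n. Re (ip (X n - x) (X n - x))) \<longlonglongrightarrow> 0"
begin

definition sq :: "'a \<Rightarrow> real" where "sq x = Re (ip x x)"

definition nrm :: "'a \<Rightarrow> real" where "nrm x = sqrt (sq x)"

definition nclosure :: "'a set \<Rightarrow> 'a set" where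
  "nclosure M = {x \<in> V. \<forall>e>0. \<exists>g\<in>M. nrm (x - g) < e}"

definition closed_sub :: "'a set \<Rightarrow> bool" where
  "closed_sub S \<longleftrightarrow> subspace S \<and> S \<subseteq> V \<and> nclosure S \<subseteq> S"

lemma V_closed [simp]:
  "x \<in> V \<Longrightarrow> y \<in> V \<Longrightarrow> x + y \<in> V" "x \<in> V \<Longrightarrow> y \<in> V \<Longrightarrow> x - y \<in> V"
  "x \<in> V \<Longrightarrow> c *c x \<in> V" "0 \<in> V"
  using subspace_V by (auto simp: subspace_add subspace_diff subspace_scale subspace_0)

lemma ip_add_right: "\<lbrakk>x \<in> V; y \<in> V; z \<in> V\<rbrakk> \<Longrightarrow> ip z (x + y) = ip z x + ip z y"
  by (metis V_closed(1) complex_cnj_add ip_add_left ip_cnj)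

lemma ip_scale_right: "\<lbrakk>x \<in> V; y \<in> V\<rbrakk> \<Longrightarrow> ip y (c *c x) = cnj c * ip y x"
  by (metis V_closed(3) complex_cnj_mult ip_scale_left ip_cnj)

lemma ip_diff_left: "\<lbrakk>x \<in> V; y \<in> V; z \<in> V\<rbrakk> \<Longrightarrow> ip (x - y) z = ip x z - ip y z"
  using ip_add_left[of "x - y" y z] by simp

lemma ip_diff_right: "\<lbrakk>x \<in> V; y \<in> V; z \<in> V\<rbrakk> \<Longrightarrow> ip z (x - y) = ip z x - ip z y"
  using ip_add_right[of "x - y" y z] by simp

lemma ip_self: "x \<in> V \<Longrightarrow> ip x x = of_real (sq x)"
  using ip_cnj[of x x] by (simp add: sq_def complex_eq_iff)

lemma sq_nonneg: "x \<in> V \<Longrightarrow> 0 \<le> sq x"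
  by (simp add: sq_def ip_nonneg)

lemma nrm_nonneg: "x \<in> V \<Longrightarrow> 0 \<le> nrm x"
  by (simp add: nrm_def sq_nonneg)

lemma nrm_power2: "x \<in> V \<Longrightarrow> (nrm x)\<^sup>2 = sq x"
  by (simp add: nrm_def sq_nonneg)

lemma Re_ip_commute: "\<lbrakk>x \<in> V; y \<in> V\<rbrakk> \<Longrightarrow> Re (ip y x) = Re (ip x y)"
  by (metis complex_cnj ip_cnj cnj.simps(1))

lemma sq_add: "\<lbrakk>x \<in> V; y \<in> V\<rbrakk> \<Longrightarrow> sq (x + y) = sq x + sq y + 2 * Re (ip x y)"
  by (simp add: sq_def ip_add_left ip_add_right Re_ip_commute)

lemma sq_diff: "\<lbrakk>x \<in> V; y \<in> V\<rbrakk> \<Longrightarrow> sq (x - y) = sq x + sq y - 2 * Re (ip x y)"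
  by (simp add: sq_def ip_diff_left ip_diff_right Re_ip_commute)

lemma sq_scale:
  assumes "x \<in> V"
  shows "sq (c *c x) = (cmod c)\<^sup>2 * sq x"
proof -
  have "ip (c *c x) (c *c x) = of_real ((cmod c)\<^sup>2) * ip x x"
    using assms by (simp add: ip_scale_left ip_scale_right complex_norm_square mult.assoc del: of_real_power)
  then show ?thesis by (simp only: sq_def Re_complex_of_real times_complex.sel Im_complex_of_real mult_zero_left diff_zero)
qed

lemma sq_0 [simp]: "sq 0 = 0"
  using sq_scale[of 0 0] by simp

lemma nrm_scale: "x \<in> V \<Longrightarrow> nrm (c *c x) = cmod c * nrm x"
  by (simp add: nrm_def sq_scale real_sqrt_mult)

lemma nrm_minus_commute: "\<lbrakk>x \<in> V; y \<in> V\<rbrakk> \<Longrightarrow> nrm (x - y) = nrm (y - x)"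
  by (simp add: nrm_def sq_diff Re_ip_commute)

lemma parallelogram: "\<lbrakk>x \<in> V; y \<in> V\<rbrakk> \<Longrightarrow> sq (x - y) = 2 * sq x + 2 * sq y - sq (x + y)"
  by (simp add: sq_add sq_diff)

text \<open>Moving \<open>x\<close> against \<open>y\<close> in the phase of \<open>ip x y\<close>,
  with a free real step \<open>r\<close>: one computation for Cauchy-Schwarz and for the variational
  argument behind \<open>projection\<close>.\<close>

lemma sq_diff_scale_ip:
  assumes "x \<in> V" "y \<in> V"
  shows "sq (x - (of_real r * ip x y) *c y) = sq x - 2 * r * (cmod (ip x y))\<^sup>2 + r\<^sup>2 * (cmod (ip x y))\<^sup>2 * sq y"
proof -
  have "ip x ((of_real r * ip x y) *c y) = of_real (r * (cmod (ip x y))\<^sup>2)"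
    using assms unfolding of_real_mult complex_norm_square by (simp add: ip_scale_right mult_ac)
  then have "Re (ip x ((of_real r * ip x y) *c y)) = r * (cmod (ip x y))\<^sup>2"
    by (simp only: Re_complex_of_real)
  then show ?thesis
    using assms by (simp add: sq_diff sq_scale norm_mult power_mult_distrib)
qed

lemma Cauchy_Schwarz:
  assumes "x \<in> V" "y \<in> V"
  shows "cmod (ip x y) \<le> nrm x * nrm y"
proof (cases "sq y = 0")
  case False
  then have y: "sq y > 0" using sq_nonneg[OF assms(2)] by simp
  have "0 \<le> sq x - 2 * (1 / sq y) * (cmod (ip x y))\<^sup>2 + (1 / sq y)\<^sup>2 * (cmod (ip x y))\<^sup>2 * sq y"
    using assms by (subst sq_diff_scale_ip[symmetric]) (auto intro: sq_nonneg)
  also have "\<dots> = sq x - (cmod (ip x y))\<^sup>2 / sq y"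
    using y by (simp add: power2_eq_square field_simps)
  finally have "(cmod (ip x y))\<^sup>2 \<le> sq x * sq y"
    using y by (simp add: field_simps)
  then have "(cmod (ip x y))\<^sup>2 \<le> (nrm x * nrm y)\<^sup>2"
    using assms by (simp add: power_mult_distrib nrm_power2)
  then show ?thesis
    by (rule power2_le_imp_le) (simp add: assms nrm_nonneg)
next
  case True
  have "ip x y = 0"
  proof (rule ccontr)
    assume "ip x y \<noteq> 0"
    then have c: "(cmod (ip x y))\<^sup>2 > 0" by simp
    \<comment> \<open>With \<open>sq y = 0\<close> the expression is affine in \<open>r\<close>;
      this choice makes it -1.\<close>
    define r where "r = (sq x + 1) / (2 * (cmod (ip x y))\<^sup>2)"
    have "0 \<le> sq x - 2 * r * (cmod (ip x y))\<^sup>2 + r\<^sup>2 * (cmod (ip x y))\<^sup>2 * sq y"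
      using assms by (subst sq_diff_scale_ip[symmetric]) (auto intro: sq_nonneg)
    then show False using c True by (simp add: r_def)
  qed
  then show ?thesis using assms by (simp add: nrm_nonneg)
qed

lemma nrm_triangle:
  assumes "x \<in> V" "y \<in> V"
  shows "nrm (x + y) \<le> nrm x + nrm y"
proof (rule power2_le_imp_le)
  have "Re (ip x y) \<le> nrm x * nrm y"
    using Cauchy_Schwarz[OF assms] complex_Re_le_cmod[of "ip x y"] by linarith
  then show "(nrm (x + y))\<^sup>2 \<le> (nrm x + nrm y)\<^sup>2"
    using assms by (simp add: nrm_power2 sq_add power2_sum)
qed (use assms nrm_nonneg in auto)

lemma ip_null_right: "\<lbrakk>x \<in> V; y \<in> V; sq y = 0\<rbrakk> \<Longrightarrow> ip x y = 0"
  using Cauchy_Schwarz[of x y] by (simp add: nrm_def)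

lemma ip_null_left: "\<lbrakk>x \<in> V; y \<in> V; sq x = 0\<rbrakk> \<Longrightarrow> ip x y = 0"
  using Cauchy_Schwarz[of x y] by (simp add: nrm_def)

text \<open>Both differences are null, hence orthogonal to everything by Cauchy-Schwarz. This makes
  the form independent of representatives.\<close>

lemma ip_cong_null:
  assumes "x \<in> V" "x' \<in> V" "y \<in> V" "y' \<in> V" "sq (x - x') = 0" "sq (y - y') = 0"
  shows "ip x y = ip x' y'"
proof -
  have "ip (x - x') y = 0" "ip x' (y - y') = 0"
    using assms by (auto intro: ip_null_left ip_null_right)
  then show ?thesis using assms by (simp add: ip_diff_left ip_diff_right)
qed

lemma sq_cong_null: "\<lbrakk>x \<in> V; y \<in> V; sq (x - y) = 0\<rbrakk> \<Longrightarrow> sq x = sq y"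
  unfolding sq_def using ip_cong_null[of x y x y] by (simp add: sq_def)

section \<open>Closures, closed subspaces and orthogonal projection\<close>

lemma closed_subD:
  assumes "closed_sub S"
  shows "subspace S" "S \<subseteq> V" "\<And>x. x \<in> V \<Longrightarrow> (\<And>e. e > 0 \<Longrightarrow> \<exists>s\<in>S. nrm (x - s) < e) \<Longrightarrow> x \<in> S"
  using assms by (auto simp: closed_sub_def nclosure_def)

lemma nclosure_subset: "M \<subseteq> V \<Longrightarrow> M \<subseteq> nclosure M"
  by (auto simp: nclosure_def nrm_def sq_diff ip_self intro!: bexI)

text \<open>Generators that agree only on the circle are different functions, so plain set inclusion
  is too strong a hypothesis.\<close>

lemma nclosure_mono_dense:
  assumes "M \<subseteq> V" "\<And>x. x \<in> M' \<Longrightarrow> \<exists>y\<in>M. sq (x - y) = 0" "M' \<subseteq> V"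
  shows "nclosure M' \<subseteq> nclosure M"
proof
  fix x assume x: "x \<in> nclosure M'"
  then have xV: "x \<in> V" by (simp add: nclosure_def)
  have "\<exists>g\<in>M. nrm (x - g) < e" if "e > 0" for e
  proof -
    obtain g where g: "g \<in> M'" "nrm (x - g) < e"
      using x \<open>e > 0\<close> unfolding nclosure_def by blast
    obtain h where h: "h \<in> M" "sq (g - h) = 0" using assms(2)[OF g(1)] by blast
    have V: "g \<in> V" "h \<in> V" using g h assms by auto
    have "sq ((x - h) - (x - g)) = 0" using h(2) V by simp
    then have "sq (x - h) = sq (x - g)"
      using xV V by (intro sq_cong_null) auto
    then show ?thesis using h g by (auto simp: nrm_def intro!: bexI[of _ h])
  qed
  then show "x \<in> nclosure M" using xV by (simp add: nclosure_def)
qed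

lemma closed_sub_nclosure:
  assumes M: "subspace M" "M \<subseteq> V"
  shows "closed_sub (nclosure M)"
proof -
  have MV: "x \<in> V" if "x \<in> M" for x using that M by auto
  have "subspace (nclosure M)"
  proof (rule subspaceI)
    show "0 \<in> nclosure M"
      using nclosure_subset[OF M(2)] subspace_0[OF M(1)] by auto
    fix x y assume "x \<in> nclosure M" "y \<in> nclosure M"
    then have xy: "x \<in> V" "y \<in> V" "\<And>e. e > 0 \<Longrightarrow> \<exists>g\<in>M. nrm (x - g) < e" "\<And>e. e > 0 \<Longrightarrow> \<exists>g\<in>M. nrm (y - g) < e"
      by (auto simp: nclosure_def)
    have "\<exists>g\<in>M. nrm (x + y - g) < e" if "e > 0" for e
    proof -
      obtain g h where g: "g \<in> M" "nrm (x - g) < e / 2" and h: "h \<in> M" "nrm (y - h) < e / 2"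
        using xy(3,4) half_gt_zero[OF \<open>e > 0\<close>] by metis
      have "nrm ((x - g) + (y - h)) \<le> nrm (x - g) + nrm (y - h)"
        using xy g h by (intro nrm_triangle) (auto simp: MV)
      moreover have "nrm (x + y - (g + h)) = nrm ((x - g) + (y - h))"
        by (rule arg_cong[of _ _ nrm]) (simp add: algebra_simps)
      ultimately have "nrm (x + y - (g + h)) < e" using g(2) h(2) by linarith
      then show ?thesis
        using g h subspace_add[OF M(1)] by blast
    qed
    then show "x + y \<in> nclosure M" using xy by (simp add: nclosure_def)
  next
    fix c x assume "x \<in> nclosure M"
    then have x: "x \<in> V" "\<And>e. e > 0 \<Longrightarrow> \<exists>g\<in>M. nrm (x - g) < e"
      by (auto simp: nclosure_def)
    have "\<exists>g\<in>M. nrm (c *c x - g) < e" if "e > 0" for e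
    proof -
      \<comment> \<open>The added 1 covers \<open>c = 0\<close>.\<close>
      have pos: "e / (cmod c + 1) > 0"
        using that by (intro divide_pos_pos) (auto intro: add_nonneg_pos)
      obtain g where g: "g \<in> M" "nrm (x - g) < e / (cmod c + 1)"
        using x(2)[OF pos] by blast
      have "nrm (c *c x - c *c g) = cmod c * nrm (x - g)"
        using x g by (simp add: nrm_scale[symmetric] MV scale_right_diff_distrib)
      also have "\<dots> \<le> cmod c * (e / (cmod c + 1))"
        using g by (intro mult_left_mono) auto
      also have "\<dots> = e * (cmod c / (cmod c + 1))" by simp
      also have "\<dots> < e * 1"
        using that by (intro mult_strict_left_mono) (auto simp: divide_less_eq_1 add_nonneg_pos)
      finally show ?thesis using subspace_scale[OF M(1) g(1)] by auto
    qed
    then show "c *c x \<in> nclosure M" using x by (simp add: nclosure_def)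
  qed
  moreover have "nclosure (nclosure M) \<subseteq> nclosure M"
  proof
    fix x assume x: "x \<in> nclosure (nclosure M)"
    then have xV: "x \<in> V" by (simp add: nclosure_def)
    have "\<exists>g\<in>M. nrm (x - g) < e" if "e > 0" for e
    proof -
      obtain y where y: "y \<in> nclosure M" "nrm (x - y) < e / 2"
        using x half_gt_zero[OF \<open>e > 0\<close>] unfolding nclosure_def by blast
      then obtain g where g: "g \<in> M" "nrm (y - g) < e / 2" and yV: "y \<in> V"
        using half_gt_zero[OF \<open>e > 0\<close>] unfolding nclosure_def by blast
      have "nrm ((x - y) + (y - g)) \<le> nrm (x - y) + nrm (y - g)"
        using xV yV g by (intro nrm_triangle) (auto simp: MV)
      then show ?thesis using y g by (intro bexI[of _ g]) auto
    qed
    then show "x \<in> nclosure M" using xV by (simp add: nclosure_def)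
  qed
  ultimately show ?thesis by (auto simp: closed_sub_def nclosure_def)
qed

text \<open>Closed subspaces are unions of classes modulo null vectors.\<close>

lemma closed_sub_null:
  assumes "closed_sub S" "y \<in> S" "x \<in> V" "sq (x - y) = 0"
  shows "x \<in> S"
proof (rule closed_subD(3)[OF assms(1,3)])
  show "\<exists>s\<in>S. nrm (x - s) < e" if "e > 0" for e
    using assms that by (auto simp: nrm_def intro!: bexI[of _ y])
qed

text \<open>Lets a distance bound be verified on explicit generators instead of their
  closure.\<close>

lemma nclosure_dist_le:
  assumes M: "M \<subseteq> V" and e: "e \<in> V" and d: "\<And>s. s \<in> M \<Longrightarrow> d \<le> nrm (e - s)" and s: "s \<in> nclosure M"
  shows "d \<le> nrm (e - s)"
proof (rule field_le_epsilon)
  fix r :: real assume "r > 0"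
  then obtain g where g: "g \<in> M" "nrm (s - g) < r" and sV: "s \<in> V"
    using s unfolding nclosure_def by blast
  have "nrm ((e - s) + (s - g)) \<le> nrm (e - s) + nrm (s - g)"
    using e sV g M by (intro nrm_triangle) auto
  then show "d \<le> nrm (e - s) + r" using d[OF g(1)] g(2) by simp
qed

lemma projection:
  assumes S: "closed_sub S" and x: "x \<in> V"
  obtains p where "p \<in> S" "\<And>s. s \<in> S \<Longrightarrow> ip (x - p) s = 0"
proof -
  note S' = closed_subD[OF S]
  have SV: "s \<in> V" if "s \<in> S" for s using that S' by auto
  have S0: "0 \<in> S" using subspace_0[OF S'(1)] .
  define d where "d = Inf ((\<lambda>s. sq (x - s)) ` S)"
  have bdd: "bdd_below ((\<lambda>s. sq (x - s)) ` S)"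
    by (rule bdd_belowI[of _ 0]) (auto simp: sq_nonneg SV x)
  have d_le: "d \<le> sq (x - s)" if "s \<in> S" for s
    unfolding d_def using bdd that by (intro cInf_lower) auto
  have "\<exists>s\<in>S. sq (x - s) < d + e" if "e > 0" for e
    using cInf_less_iff[of "(\<lambda>s. sq (x - s)) ` S" "d + e"] bdd S0 that by (auto simp: d_def)
  then have "\<exists>s. \<forall>n. s n \<in> S \<and> sq (x - s n) < d + inverse (real (Suc n))"
    by (intro choice) (auto simp: Bex_def)
  then obtain s where s: "\<And>n. s n \<in> S" "\<And>n. sq (x - s n) < d + inverse (real (Suc n))"
    by blast
  have sV: "s n \<in> V" for n using s(1) SV by auto
  have close: "sq (s m - s n) \<le> 2 * inverse (real (Suc m)) + 2 * inverse (real (Suc n))" for m n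
  proof -
    \<comment> \<open>The midpoint lies in \<open>S\<close>, so the parallelogram law turns
      near-minimality of two terms into closeness: the minimizing sequence is Cauchy.\<close>
    have mid: "(1/2) *c (s m + s n) \<in> S"
      using s(1) S'(1) by (intro subspace_scale subspace_add) auto
    have two: "2 *c v = v + v" for v
      using scale_left_distrib[of 1 1 v] by simp
    have half: "2 *c (1/2) *c v = v" for v
      by simp
    have "(x - s n) + (x - s m) = 2 *c (x - (1/2) *c (s m + s n))"
      unfolding scale_right_diff_distrib half unfolding two by (simp add: algebra_simps)
    then have "sq ((x - s n) + (x - s m)) = 4 * sq (x - (1/2) *c (s m + s n))"
      using x sV by (simp add: sq_scale)
    also have "\<dots> \<ge> 4 * d" using d_le[OF mid] by simp
    finally have "sq ((x - s n) - (x - s m)) \<le> 2 * sq (x - s n) + 2 * sq (x - s m) - 4 * d"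
      using x sV by (subst parallelogram) auto
    moreover have "(x - s n) - (x - s m) = s m - s n" by simp
    ultimately show ?thesis using s(2)[of m] s(2)[of n] by simp
  qed
  have "\<exists>p\<in>V. (\<lambda>n. Re (ip (s n - p) (s n - p))) \<longlonglongrightarrow> 0"
  proof (rule ip_complete[OF sV])
    fix e :: real assume "e > 0"
    then obtain N where N: "inverse (real (Suc N)) < e / 4"
      using reals_Archimedean[of "e/4"] by auto
    show "\<exists>N. \<forall>m\<ge>N. \<forall>n\<ge>N. Re (ip (s m - s n) (s m - s n)) < e"
    proof (intro exI[of _ N] allI impI)
      fix m n assume "N \<le> m" "N \<le> n"
      then have "inverse (real (Suc m)) \<le> inverse (real (Suc N))" "inverse (real (Suc n)) \<le> inverse (real (Suc N))"
        by (auto intro!: le_imp_inverse_le)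
      then show "Re (ip (s m - s n) (s m - s n)) < e"
        using close[of m n] N unfolding sq_def by linarith
    qed
  qed
  then obtain p where p: "p \<in> V" "(\<lambda>n. sq (s n - p)) \<longlonglongrightarrow> 0"
    by (auto simp: sq_def)
  have lim: "(\<lambda>n. nrm (s n - p)) \<longlonglongrightarrow> 0"
    using tendsto_real_sqrt[OF p(2)] by (simp add: nrm_def)
  have pS: "p \<in> S"
  proof (rule S'(3)[OF p(1)])
    fix e :: real assume "e > 0"
    then have "eventually (\<lambda>n. nrm (s n - p) < e) sequentially"
      using lim by (auto intro: order_tendstoD)
    then obtain n where "nrm (s n - p) < e" by (auto simp: eventually_sequentially)
    then have "nrm (p - s n) < e" by (simp add: nrm_minus_commute[OF p(1) sV])
    then show "\<exists>s\<in>S. nrm (p - s) < e" using s(1) by blast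
  qed
  have "nrm (x - p) \<le> sqrt d"
  proof (rule LIMSEQ_le_const)
    have "(\<lambda>n. sqrt (d + inverse (real (Suc n))) + nrm (s n - p)) \<longlonglongrightarrow> sqrt (d + 0) + 0"
      by (intro tendsto_intros lim LIMSEQ_inverse_real_of_nat)
    then show "(\<lambda>n. sqrt (d + inverse (real (Suc n))) + nrm (s n - p)) \<longlonglongrightarrow> sqrt d" by simp
  next
    have "nrm (x - p) \<le> sqrt (d + inverse (real (Suc n))) + nrm (s n - p)" for n
    proof -
      have "nrm ((x - s n) + (s n - p)) \<le> nrm (x - s n) + nrm (s n - p)"
        using x sV p by (intro nrm_triangle) auto
      moreover have "nrm (x - s n) \<le> sqrt (d + inverse (real (Suc n)))"
        unfolding nrm_def using s(2)[of n] by simp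
      ultimately show ?thesis by simp
    qed
    then show "\<exists>N. \<forall>n\<ge>N. nrm (x - p) \<le> sqrt (d + inverse (real (Suc n))) + nrm (s n - p)" by blast
  qed
  then have min: "sq (x - p) \<le> d" by (simp add: nrm_def)
  have "ip (x - p) t = 0" if t: "t \<in> S" for t
  proof (rule ccontr)
    assume "ip (x - p) t \<noteq> 0"
    then have c: "(cmod (ip (x - p) t))\<^sup>2 > 0" by simp
    \<comment> \<open>A step this short strictly lowers the distance; the added 1 allows for a null
      \<open>t\<close>.\<close>
    define r where "r = 1 / (1 + sq t)"
    have t0: "sq t \<ge> 0" using t SV sq_nonneg by auto
    have r: "r > 0" "r * sq t < 1" using t0 by (auto simp: r_def)
    have "p + (of_real r * ip (x - p) t) *c t \<in> S"
      using pS t S'(1) by (intro subspace_add subspace_scale) auto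
    then have "d \<le> sq (x - (p + (of_real r * ip (x - p) t) *c t))" by (rule d_le)
    also have "\<dots> = sq ((x - p) - (of_real r * ip (x - p) t) *c t)" by (simp add: algebra_simps)
    also have "\<dots> = sq (x - p) - 2 * r * (cmod (ip (x - p) t))\<^sup>2 + r\<^sup>2 * (cmod (ip (x - p) t))\<^sup>2 * sq t"
      using x p t SV by (intro sq_diff_scale_ip) auto
    also have "\<dots> = sq (x - p) - r * (cmod (ip (x - p) t))\<^sup>2 * (2 - r * sq t)"
      by (simp add: algebra_simps power2_eq_square)
    also have "\<dots> < sq (x - p)"
      using r c by (simp add: mult_pos_pos)
    finally show False using min by simp
  qed
  then show ?thesis using that pS by blast
qed

text \<open>\<open>hyperplane S T e\<close>: the span of \<open>S\<close> and \<open>e\<close> is dense in \<open>T\<close>, so \<open>S\<close> has codimension at most one in \<open>T\<close>.\<close>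

definition hyperplane :: "'a set \<Rightarrow> 'a set \<Rightarrow> 'a \<Rightarrow> bool" where
  "hyperplane S T e \<longleftrightarrow> closed_sub S \<and> closed_sub T \<and> S \<subseteq> T \<and> e \<in> T \<and>
     (\<forall>x\<in>T. \<forall>r>0. \<exists>c. \<exists>s\<in>S. nrm (x - (c *c e + s)) < r)"

text \<open>The condition on \<open>ip e K\<close> fixes the phase; otherwise a unimodular factor is
  free. Both kinds of vectors in the theorem are instances.\<close>

definition unit_normal :: "'a set \<Rightarrow> 'a set \<Rightarrow> 'a \<Rightarrow> 'a \<Rightarrow> bool" where
  "unit_normal S T e K \<longleftrightarrow> K \<in> T \<and> (\<forall>s\<in>S. ip K s = 0) \<and> nrm K = 1 \<and> Im (ip e K) = 0 \<and> 0 < Re (ip e K)"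

lemma hyperplaneD:
  assumes "hyperplane S T e"
  shows "closed_sub S" "closed_sub T" "S \<subseteq> T" "e \<in> T" "\<And>x. x \<in> S \<Longrightarrow> x \<in> V" "\<And>x. x \<in> T \<Longrightarrow> x \<in> V"
    "\<And>x r. x \<in> T \<Longrightarrow> r > 0 \<Longrightarrow> \<exists>c. \<exists>s\<in>S. nrm (x - (c *c e + s)) < r"
  using assms by (auto simp: hyperplane_def closed_sub_def)

text \<open>\<open>y\<close> is orthogonal to every approximant c e + s of itself, so Cauchy-Schwarz
  gives sq y \<le> nrm y * r for every positive r.\<close>

lemma null_if_orthogonal_to_hyperplane:
  assumes H: "hyperplane S T e" and y: "y \<in> T" "\<And>s. s \<in> S \<Longrightarrow> ip y s = 0" "ip y e = 0"
  shows "sq y = 0"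
proof -
  note H' = hyperplaneD[OF H]
  have yV: "y \<in> V" using y H' by auto
  have "sq y \<le> nrm y * r" if "r > 0" for r
  proof -
    obtain c s where s: "s \<in> S" "nrm (y - (c *c e + s)) < r"
      using H'(7)[OF y(1) \<open>r > 0\<close>] by blast
    have V: "e \<in> V" "s \<in> V" using H' s by auto
    have "ip y (y - (c *c e + s)) = ip y y"
      using V yV y s by (simp add: ip_diff_right ip_add_right ip_scale_right)
    then have "sq y \<le> cmod (ip y (y - (c *c e + s)))"
      using yV by (simp add: ip_self)
    also have "\<dots> \<le> nrm y * nrm (y - (c *c e + s))"
      using V yV by (intro Cauchy_Schwarz) auto
    also have "\<dots> \<le> nrm y * r"
      using s yV by (intro mult_left_mono nrm_nonneg) auto
    finally show ?thesis .
  qed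
  note * = this
  have "nrm y = 0"
  proof (rule ccontr)
    assume "nrm y \<noteq> 0"
    then have "nrm y > 0" using nrm_nonneg[OF yV] by simp
    then have "(nrm y)\<^sup>2 \<le> nrm y * (nrm y / 2)" using *[of "nrm y / 2"] nrm_power2[OF yV] by simp
    then show False using \<open>nrm y > 0\<close> by (simp add: power2_eq_square)
  qed
  then show ?thesis using nrm_power2[OF yV] by simp
qed

text \<open>\<open>T\<close> has at most one direction orthogonal to \<open>S\<close>. Subtracting
  the multiple of \<open>K\<close> that matches \<open>y\<close> against \<open>e\<close> leaves a
  null vector, which forces the coefficient to be \<open>ip y K\<close>.\<close>

lemma unit_normal_expansion:
  assumes H: "hyperplane S T e" and K: "unit_normal S T e K"
    and y: "y \<in> T" "\<And>s. s \<in> S \<Longrightarrow> ip y s = 0"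
  shows "sq (y - ip y K *c K) = 0"
proof -
  note H' = hyperplaneD[OF H]
  have K': "K \<in> T" "\<And>s. s \<in> S \<Longrightarrow> ip K s = 0" "nrm K = 1" "0 < Re (ip e K)"
    using K by (auto simp: unit_normal_def)
  have V: "y \<in> V" "K \<in> V" "e \<in> V" using H' y K' by auto
  have sqK: "sq K = 1" using K'(3) nrm_power2[OF V(2)] by simp
  have Ke: "ip K e \<noteq> 0" using K'(4) ip_cnj[OF V(3) V(2)] by auto
  define c where "c = ip y e / ip K e"
  have *: "sq (y - c *c K) = 0"
  proof (rule null_if_orthogonal_to_hyperplane[OF H])
    show "y - c *c K \<in> T"
      using y K' closed_subD(1)[OF H'(2)] by (intro subspace_diff subspace_scale) auto
    show "ip (y - c *c K) s = 0" if "s \<in> S" for s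
      using V K' y that H' by (simp add: ip_diff_left ip_scale_left)
    show "ip (y - c *c K) e = 0"
      using V Ke by (simp add: ip_diff_left ip_scale_left c_def)
  qed
  then have "ip (y - c *c K) K = 0" using V by (intro ip_null_left) auto
  then have "ip y K = c" using V sqK by (simp add: ip_diff_left ip_scale_left ip_self)
  then show ?thesis using * by simp
qed

text \<open>Each normal is a unimodular multiple of the other; positivity against \<open>e\<close>
  makes the factor a positive real, hence 1.\<close>

lemma unit_normal_unique:
  assumes H: "hyperplane S T e" and K: "unit_normal S T e K" and K': "unit_normal S T e K'"
  shows "sq (K - K') = 0"
proof -
  note H' = hyperplaneD[OF H]
  have V: "K \<in> V" "K' \<in> V" "e \<in> V" using H' K K' by (auto simp: unit_normal_def)
  define c where "c = ip K K'"
  have n: "sq (K - c *c K') = 0"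
    unfolding c_def using K by (intro unit_normal_expansion[OF H K']) (auto simp: unit_normal_def)
  have "ip e K = ip e (c *c K')"
    by (rule ip_cong_null) (use V n in \<open>auto simp: sq_diff ip_self\<close>)
  then have eq: "ip e K = cnj c * ip e K'" using V by (simp add: ip_scale_right)
  have "sq K = sq (c *c K')" using n V by (intro sq_cong_null) auto
  then have "1 = (cmod c)\<^sup>2"
    using K K' V nrm_power2[of K] nrm_power2[of K'] by (simp add: sq_scale unit_normal_def)
  then have c1: "cmod c = 1" using norm_ge_zero[of c] by (metis power2_eq_1_iff abs_norm_cancel abs_neg_one abs_1)
  have r: "ip e K = of_real (Re (ip e K))" "ip e K' = of_real (Re (ip e K'))" "Re (ip e K) > 0" "Re (ip e K') > 0"
    using K K' by (auto simp: unit_normal_def complex_eq_iff)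
  have "cnj c = of_real (Re (ip e K) / Re (ip e K'))"
    using eq r by (metis nonzero_eq_divide_eq of_real_divide of_real_eq_0_iff order_less_irrefl)
  then have "c = of_real (Re (ip e K) / Re (ip e K'))" by (metis complex_cnj_cnj complex_cnj_complex_of_real)
  moreover have "Re (ip e K) / Re (ip e K') > 0" using r by simp
  ultimately have "c = 1" using c1 by (metis abs_of_pos norm_of_real of_real_1)
  then show ?thesis using n by simp
qed

text \<open>\<open>K\<close> is the normalized residual of projecting \<open>e\<close> to
  \<open>S\<close>. Thus \<open>ip e K\<close> is the length of that residual, the distance from
  \<open>e\<close> to \<open>S\<close>, and inherits the bound \<open>d\<close>.\<close>

lemma unit_normal_exists:
  assumes H: "hyperplane S T e" and d: "d > 0" "\<And>s. s \<in> S \<Longrightarrow> d \<le> nrm (e - s)"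
  obtains K where "unit_normal S T e K" "d \<le> Re (ip e K)"
proof -
  note H' = hyperplaneD[OF H]
  have eV: "e \<in> V" using H' by auto
  obtain p where p: "p \<in> S" "\<And>s. s \<in> S \<Longrightarrow> ip (e - p) s = 0"
    using projection[OF H'(1) eV] by blast
  have pV: "p \<in> V" using p H' by auto
  define r where "r = nrm (e - p)"
  have r: "r \<ge> d" "r > 0" using d(2)[OF p(1)] d(1) by (auto simp: r_def)
  define K where "K = of_real (1 / r) *c (e - p)"
  have "ip e (e - p) = ip (e - p) (e - p) + ip p (e - p)"
    using eV pV by (simp add: ip_diff_left)
  also have "ip p (e - p) = 0" using p(2)[OF p(1)] ip_cnj[of "e - p" p] eV pV by simp
  finally have "ip e (e - p) = of_real (r\<^sup>2)" using eV pV by (simp add: ip_self r_def nrm_power2)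
  then have eK: "ip e K = of_real r"
    using eV pV r by (simp add: K_def ip_scale_right power2_eq_square)
  have "K \<in> T"
    unfolding K_def using H' p closed_subD(1)[OF H'(2)] by (intro subspace_scale subspace_diff) auto
  moreover have "ip K s = 0" if "s \<in> S" for s
    using eV pV p that H' by (simp add: K_def ip_scale_left)
  moreover have "nrm K = 1"
    unfolding K_def using r eV pV by (subst nrm_scale) (auto simp: r_def norm_divide)
  ultimately have "unit_normal S T e K" using eK r by (simp add: unit_normal_def)
  then show ?thesis using that eK r by simp
qed

text \<open>Intended reading: \<open>A\<close>, \<open>B\<close>, \<open>A'\<close>,
  \<open>C\<close> are the subspaces with indices (n, m), (n+1, m), (n, m+1), (n+1, m+1). First
  identity: the part of \<open>e\<close> orthogonal to \<open>C\<close> is a multiple of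
  \<open>K'\<close>, and the part in \<open>C\<close> is invisible to \<open>K\<close> since
  \<open>C\<close> lies in \<open>B\<close>. Second: \<open>K\<close> splits into its projection to
  \<open>A'\<close>, a multiple of \<open>K'\<close>, and a multiple of \<open>L\<close>; then
  Pythagoras.\<close>

lemma unit_normal_two_step:
  assumes A: "hyperplane B A e" "unit_normal B A e K"
    and A': "hyperplane C A' e" "unit_normal C A' e K'"
    and F: "hyperplane A' A f" "unit_normal A' A f L"
    and "C \<subseteq> B"
  shows "ip e K = ip e K' * ip K' K" "(cmod (ip K K'))\<^sup>2 + (cmod (ip K L))\<^sup>2 = 1"
proof -
  note hA = hyperplaneD[OF A(1)] and hA' = hyperplaneD[OF A'(1)] and hF = hyperplaneD[OF F(1)]
  have K: "K \<in> A" "\<And>s. s \<in> B \<Longrightarrow> ip K s = 0" "nrm K = 1"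
    and K': "K' \<in> A'" "\<And>s. s \<in> C \<Longrightarrow> ip K' s = 0" "nrm K' = 1"
    and L: "L \<in> A" "\<And>s. s \<in> A' \<Longrightarrow> ip L s = 0" "nrm L = 1"
    using A A' F by (auto simp: unit_normal_def)
  have V: "e \<in> V" "K \<in> V" "K' \<in> V" "L \<in> V" using K K' L hA hA' by auto
  show "ip e K = ip e K' * ip K' K"
  proof -
    obtain p where p: "p \<in> C" "\<And>s. s \<in> C \<Longrightarrow> ip (e - p) s = 0"
      using projection[OF hA'(1) V(1)] by blast
    have pV: "p \<in> V" using p hA' by auto
    have "sq ((e - p) - ip (e - p) K' *c K') = 0"
    proof (rule unit_normal_expansion[OF A' _ p(2)])
      show "e - p \<in> A'"
        using hA' p closed_subD(1)[OF hA'(2)] by (intro subspace_diff) auto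
    qed
    then have "ip (e - p) K = ip (ip (e - p) K' *c K') K"
      using V pV by (intro ip_cong_null) (auto simp: sq_diff ip_self)
    moreover have "ip p K = 0" using K(2)[of p] p \<open>C \<subseteq> B\<close> ip_cnj[OF V(2) pV] by auto
    moreover have "ip p K' = 0" using K'(2)[of p] p ip_cnj[OF V(3) pV] by auto
    ultimately show ?thesis using V pV by (simp add: ip_diff_left ip_scale_left)
  qed
  show "(cmod (ip K K'))\<^sup>2 + (cmod (ip K L))\<^sup>2 = 1"
  proof -
    obtain p where p: "p \<in> A'" "\<And>s. s \<in> A' \<Longrightarrow> ip (K - p) s = 0"
      using projection[OF hA'(2) V(2)] by blast
    have pV: "p \<in> V" using p hA' by auto
    have pA: "p \<in> A" using p hF by auto
    have "sq ((K - p) - ip (K - p) L *c L) = 0"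
      using K pA closed_subD(1)[OF hA(2)] p(2) by (intro unit_normal_expansion[OF F] subspace_diff) auto
    then have "sq (K - p) = sq (ip (K - p) L *c L)"
      using V pV by (intro sq_cong_null) auto
    moreover have "ip p L = 0" using L(2)[OF p(1)] ip_cnj[OF V(4) pV] by auto
    ultimately have 1: "sq (K - p) = (cmod (ip K L))\<^sup>2"
      using V pV L(3) nrm_power2[OF V(4)] by (simp add: sq_scale ip_diff_left)
    \<comment> \<open>\<open>K\<close> is orthogonal to \<open>B\<close> and \<open>K - p\<close> to
      \<open>A'\<close>; \<open>C\<close> lies in both, so \<open>p\<close> is orthogonal to
      \<open>C\<close> and must be a multiple of \<open>K'\<close>.\<close>
    have "ip p s = 0" if "s \<in> C" for s
    proof -
      have "s \<in> A'" "s \<in> V" "s \<in> B" using that hA' \<open>C \<subseteq> B\<close> by auto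
      then show ?thesis using p(2)[of s] K(2)[of s] V pV by (simp add: ip_diff_left)
    qed
    then have "sq (p - ip p K' *c K') = 0"
      using p by (intro unit_normal_expansion[OF A']) auto
    then have "sq p = sq (ip p K' *c K')"
      using V pV by (intro sq_cong_null) auto
    moreover have "ip p K' = ip K K'" using p(2)[OF K'(1)] V pV by (simp add: ip_diff_left)
    ultimately have 2: "sq p = (cmod (ip K K'))\<^sup>2"
      using V pV K'(3) nrm_power2[OF V(3)] by (simp add: sq_scale)
    have "sq ((K - p) + p) = sq (K - p) + sq p"
      using V pV p(2)[OF p(1)] by (subst sq_add) auto
    then show ?thesis using 1 2 K(3) nrm_power2[OF V(2)] by simp
  qed
qed

end

subsection \<open>The weighted space\<close>

text \<open>Riesz-Fischer for vector values: a rapidly convergent subsequence has a limit almost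
  everywhere, and Fatou's lemma identifies it as the limit in mean square.\<close>

lemma (in finite_measure) L2_complete:
  fixes X :: "nat \<Rightarrow> 'a \<Rightarrow> 'b::{banach, second_countable_topology}"
  assumes X[measurable]: "\<And>n. X n \<in> borel_measurable M"
    and int: "\<And>n. integrable M (\<lambda>x. (norm (X n x))\<^sup>2)"
    and Cauchy: "\<And>e. e > 0 \<Longrightarrow> \<exists>N. \<forall>m\<ge>N. \<forall>n\<ge>N. (LINT x|M. (norm (X m x - X n x))\<^sup>2) < e"
  obtains Y where "Y \<in> borel_measurable M" "integrable M (\<lambda>x. (norm (Y x))\<^sup>2)"
    "\<And>n. integrable M (\<lambda>x. (norm (X n x - Y x))\<^sup>2)"
    "(\<lambda>n. LINT x|M. (norm (X n x - Y x))\<^sup>2) \<longlonglongrightarrow> 0"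
proof -
  have intadd: "integrable M (\<lambda>x. (norm (f x + g x))\<^sup>2)"
    if "integrable M (\<lambda>x. (norm (f x))\<^sup>2)" "integrable M (\<lambda>x. (norm (g x))\<^sup>2)"
      "f \<in> borel_measurable M" "g \<in> borel_measurable M" for f g :: "'a \<Rightarrow> 'b"
  proof (rule Bochner_Integration.integrable_bound)
    show "integrable M (\<lambda>x. 2 * (norm (f x))\<^sup>2 + 2 * (norm (g x))\<^sup>2)" using that by simp
    show "AE x in M. norm ((norm (f x + g x))\<^sup>2) \<le> norm (2 * (norm (f x))\<^sup>2 + 2 * (norm (g x))\<^sup>2)"
      by (simp add: norm_add_square_le)
  qed (use that in measurable)
  have intdiff: "integrable M (\<lambda>x. (norm (f x - g x))\<^sup>2)"
    if "integrable M (\<lambda>x. (norm (f x))\<^sup>2)" "integrable M (\<lambda>x. (norm (g x))\<^sup>2)"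
      "f \<in> borel_measurable M" "g \<in> borel_measurable M" for f g :: "'a \<Rightarrow> 'b"
    using intadd[of f "\<lambda>x. - g x"] that by simp
  have "\<exists>N. \<forall>m\<ge>N. \<forall>n\<ge>N. (LINT x|M. (norm (X m x - X n x))\<^sup>2) < (1/4) ^ k" for k :: nat
    by (rule Cauchy) simp
  then obtain N where N: "\<And>k m n. m \<ge> N k \<Longrightarrow> n \<ge> N k \<Longrightarrow> (LINT x|M. (norm (X m x - X n x))\<^sup>2) < (1/4) ^ k"
    by metis
  \<comment> \<open>Summing all thresholds up to \<open>k\<close> and adding \<open>k\<close> makes
    \<open>r k\<close> exceed both \<open>N k\<close> and \<open>k\<close>, and keeps
    \<open>r (Suc k)\<close> above \<open>N k\<close>.\<close>
  define r where "r k = (\<Sum>i\<le>k. N i) + k" for k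
  have rN: "r k \<ge> N k" "r (Suc k) \<ge> N k" "r k \<ge> k" for k
    by (auto simp: r_def intro: member_le_sum[of k "{..k}" N] le_trans trans_le_add1)
  define D where "D k x = X (r (Suc k)) x - X (r k) x" for k x
  have D[measurable]: "D k \<in> borel_measurable M" for k unfolding D_def by measurable
  have D2: "integrable M (\<lambda>x. (norm (D k x))\<^sup>2)" for k
    unfolding D_def by (intro intdiff int X)
  have D2_le: "(LINT x|M. (norm (D k x))\<^sup>2) \<le> (1/4) ^ k" for k
    unfolding D_def using N[of k "r (Suc k)" "r k"] rN by simp
  \<comment> \<open>Either |D| is at most 2^(-k), or 2^k |D| is at least 1. Against the tolerance
    (1/4)^k the factor 2^k leaves a summable (1/2)^k, so square means control first moments without
    Hoelder.\<close>
  have ptw: "norm (D k x) \<le> 2 ^ k * (norm (D k x))\<^sup>2 + (1/2) ^ k" for k x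
  proof (cases "norm (D k x) \<le> (1/2) ^ k")
    case True
    moreover have "0 \<le> 2 ^ k * (norm (D k x))\<^sup>2" by simp
    ultimately show ?thesis by linarith
  next
    case False
    then have "2 ^ k * norm (D k x) \<ge> 1" by (simp add: power_one_over field_simps)
    then have "norm (D k x) * 1 \<le> norm (D k x) * (2 ^ k * norm (D k x))"
      by (intro mult_left_mono) auto
    also have "\<dots> = 2 ^ k * (norm (D k x))\<^sup>2" by (simp add: power2_eq_square)
    finally show ?thesis by (simp add: add_increasing2)
  qed
  have D1: "integrable M (\<lambda>x. norm (D k x))" for k
  proof (rule Bochner_Integration.integrable_bound)
    show "integrable M (\<lambda>x. 2 ^ k * (norm (D k x))\<^sup>2 + (1/2) ^ k)" using D2[of k] by simp
    show "AE x in M. norm (norm (D k x)) \<le> norm (2 ^ k * (norm (D k x))\<^sup>2 + (1/2) ^ k)"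
      using ptw[of k] by (auto intro!: AE_I2)
  qed measurable
  have D1_le: "(LINT x|M. norm (D k x)) \<le> (1 + measure M (space M)) * (1/2) ^ k" for k
  proof -
    have "(LINT x|M. norm (D k x)) \<le> (LINT x|M. 2 ^ k * (norm (D k x))\<^sup>2 + (1/2) ^ k)"
      using D2[of k] by (intro integral_mono D1 ptw) simp
    also have "\<dots> = 2 ^ k * (LINT x|M. (norm (D k x))\<^sup>2) + measure M (space M) * (1/2) ^ k"
      using D2[of k] by simp
    also have "\<dots> \<le> 2 ^ k * (1/4) ^ k + measure M (space M) * (1/2) ^ k"
      using D2_le[of k] by simp
    also have "(2::real) ^ k * (1/4) ^ k = (1/2) ^ k"
      by (simp add: power_mult_distrib[symmetric])
    finally show ?thesis by (simp add: algebra_simps)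
  qed
  have "AE x in M. summable (\<lambda>k. norm (D k x))"
  proof -
    have "(\<integral>\<^sup>+x. (\<Sum>k. ennreal (norm (D k x))) \<partial>M) = (\<Sum>k. (\<integral>\<^sup>+x. ennreal (norm (D k x)) \<partial>M))"
      by (rule nn_integral_suminf) measurable
    also have "\<dots> = (\<Sum>k. ennreal (LINT x|M. norm (D k x)))"
      by (intro suminf_cong nn_integral_eq_integral D1) simp
    also have "\<dots> \<le> (\<Sum>k. ennreal ((1 + measure M (space M)) * (1/2) ^ k))"
      by (intro suminf_le ennreal_leI D1_le) auto
    also have "\<dots> = ennreal (\<Sum>k. (1 + measure M (space M)) * (1/2) ^ k)"
      by (intro suminf_ennreal2) (auto intro!: summable_mult summable_geometric)
    also have "\<dots> < \<infinity>" by simp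
    finally have "AE x in M. (\<Sum>k. ennreal (norm (D k x))) \<noteq> \<infinity>"
      by (intro nn_integral_PInf_AE) auto
    then show ?thesis
      by eventually_elim (auto intro!: summable_suminf_not_top simp: top_unique)
  qed
  then have conv: "AE x in M. convergent (\<lambda>k. X (r k) x)"
  proof eventually_elim
    fix x assume "summable (\<lambda>k. norm (D k x))"
    then have "summable (\<lambda>k. D k x)" by (rule summable_norm_cancel)
    then have "convergent (\<lambda>n. \<Sum>k<n. D k x)" by (simp add: summable_iff_convergent)
    moreover have "(\<Sum>k<n. D k x) = X (r n) x - X (r 0) x" for n
      unfolding D_def by (rule sum_lessThan_telescope)
    ultimately have "convergent (\<lambda>n. X (r n) x - X (r 0) x)" by simp
    then have "convergent (\<lambda>n. (X (r n) x - X (r 0) x) + X (r 0) x)"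
      by (intro convergent_add convergent_const)
    then show "convergent (\<lambda>k. X (r k) x)" by simp
  qed
  define Y where "Y x = lim (\<lambda>k. X (r k) x)" for x
  have Y[measurable]: "Y \<in> borel_measurable M"
    unfolding Y_def by (rule borel_measurable_lim_metric) measurable
  have lim: "AE x in M. (\<lambda>k. X (r k) x) \<longlonglongrightarrow> Y x"
    using conv by eventually_elim (simp add: Y_def convergent_LIMSEQ_iff)
  \<comment> \<open>Fatou along the subsequence compares \<open>Y\<close> with every late
    \<open>X m\<close>, so the whole sequence converges.\<close>
  have bound: "(\<integral>\<^sup>+x. ennreal ((norm (X m x - Y x))\<^sup>2) \<partial>M) \<le> ennreal ((1/4) ^ k)" if m: "m \<ge> N k" for m k
  proof -
    have "(\<integral>\<^sup>+x. ennreal ((norm (X m x - Y x))\<^sup>2) \<partial>M)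
        = (\<integral>\<^sup>+x. liminf (\<lambda>j. ennreal ((norm (X m x - X (r j) x))\<^sup>2)) \<partial>M)"
    proof (rule nn_integral_cong_AE)
      show "AE x in M. ennreal ((norm (X m x - Y x))\<^sup>2) = liminf (\<lambda>j. ennreal ((norm (X m x - X (r j) x))\<^sup>2))"
        using lim
      proof eventually_elim
        fix x assume "(\<lambda>k. X (r k) x) \<longlonglongrightarrow> Y x"
        then have "(\<lambda>j. ennreal ((norm (X m x - X (r j) x))\<^sup>2)) \<longlonglongrightarrow> ennreal ((norm (X m x - Y x))\<^sup>2)"
          by (intro tendsto_intros)
        then show "ennreal ((norm (X m x - Y x))\<^sup>2) = liminf (\<lambda>j. ennreal ((norm (X m x - X (r j) x))\<^sup>2))"
          by (intro lim_imp_Liminf[symmetric]) auto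
      qed
    qed
    also have "\<dots> \<le> liminf (\<lambda>j. \<integral>\<^sup>+x. ennreal ((norm (X m x - X (r j) x))\<^sup>2) \<partial>M)"
      by (rule nn_integral_liminf) measurable
    also have "\<dots> \<le> limsup (\<lambda>j. \<integral>\<^sup>+x. ennreal ((norm (X m x - X (r j) x))\<^sup>2) \<partial>M)"
      by (rule Liminf_le_Limsup) simp
    also have "\<dots> \<le> ennreal ((1/4) ^ k)"
    proof (rule Limsup_bounded)
      have "(\<integral>\<^sup>+x. ennreal ((norm (X m x - X (r j) x))\<^sup>2) \<partial>M) \<le> ennreal ((1/4) ^ k)" if "j \<ge> N k" for j
      proof -
        have "(\<integral>\<^sup>+x. ennreal ((norm (X m x - X (r j) x))\<^sup>2) \<partial>M) = ennreal (LINT x|M. (norm (X m x - X (r j) x))\<^sup>2)"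
          by (intro nn_integral_eq_integral intdiff int X) simp
        also have "\<dots> \<le> ennreal ((1/4) ^ k)"
          using N[of k m "r j"] m that rN(3)[of j] by (intro ennreal_leI) simp
        finally show ?thesis .
      qed
      then show "eventually (\<lambda>j. (\<integral>\<^sup>+x. ennreal ((norm (X m x - X (r j) x))\<^sup>2) \<partial>M) \<le> ennreal ((1/4) ^ k)) sequentially"
        by (rule eventually_sequentiallyI)
    qed
    finally show ?thesis .
  qed
  \<comment> \<open>One finite distance, together with square integrability of
    \<open>X (N 0)\<close>, gives that of \<open>Y\<close>.\<close>
  have diff0: "integrable M (\<lambda>x. (norm (X (N 0) x - Y x))\<^sup>2)"
    using bound[of 0 "N 0"] by (intro integrableI_bounded) (auto simp: top_unique less_top[symmetric] intro: le_less_trans)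
  have Y2: "integrable M (\<lambda>x. (norm (Y x))\<^sup>2)"
    using intdiff[OF int[of "N 0"] diff0 X] by simp
  have diff: "integrable M (\<lambda>x. (norm (X n x - Y x))\<^sup>2)" for n
    by (intro intdiff int Y2 X Y)
  have "(\<lambda>n. LINT x|M. (norm (X n x - Y x))\<^sup>2) \<longlonglongrightarrow> 0"
  proof (rule LIMSEQ_I)
    fix e :: real assume "e > 0"
    then obtain k where k: "(1/4::real) ^ k < e"
      using real_arch_pow_inv[of e "1/4"] by auto
    have "norm ((LINT x|M. (norm (X n x - Y x))\<^sup>2) - 0) < e" if "n \<ge> N k" for n
    proof -
      have "ennreal (LINT x|M. (norm (X n x - Y x))\<^sup>2) \<le> ennreal ((1/4) ^ k)"
        using bound[OF that] nn_integral_eq_integral[OF diff[of n]] by simp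
      then have "(LINT x|M. (norm (X n x - Y x))\<^sup>2) \<le> (1/4) ^ k"
        by (subst (asm) ennreal_le_iff) auto
      then show ?thesis using k by simp
    qed
    then show "\<exists>no. \<forall>n\<ge>no. norm ((LINT x|M. (norm (X n x - Y x))\<^sup>2) - 0) < e" by blast
  qed
  then show ?thesis using that Y Y2 diff by blast
qed

section \<open>Linear algebra of the two-by-two weight\<close>

lemma matrix_inv_eq:
  assumes "A ** B = mat 1" "B ** A = mat 1"
  shows "matrix_inv A = B"
proof -
  have "A ** matrix_inv A = mat 1 \<and> matrix_inv A ** A = mat 1"
    unfolding matrix_inv_def by (rule someI[of _ B]) (use assms in simp)
  then show ?thesis
    by (metis assms(1) matrix_mul_assoc matrix_mul_lid matrix_mul_rid)
qed

lemma cdot_2: "cdot x y = cnj (y $ 1) * x $ 1 + cnj (y $ 2) * x $ 2"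
  by (simp add: cdot_def sum_2)

lemma norm_vec_2: "(norm (x :: complex^2))\<^sup>2 = (cmod (x $ 1))\<^sup>2 + (cmod (x $ 2))\<^sup>2"
  by (simp add: norm_vec_def L2_set_def sum_2)

lemma cdot_self: "cdot x x = of_real ((norm x)\<^sup>2)"
  unfolding norm_vec_2 cdot_2 of_real_add complex_norm_square by (simp add: mult.commute)

lemma norm_cdot_le: "cmod (cdot x y) \<le> (norm x)\<^sup>2 + (norm y)\<^sup>2"
proof -
  have "cmod (cdot x y) \<le> cmod (y $ 1) * cmod (x $ 1) + cmod (y $ 2) * cmod (x $ 2)"
    unfolding cdot_2 by (rule order_trans[OF norm_triangle_ineq]) (simp add: norm_mult)
  also have "\<dots> \<le> (norm x)\<^sup>2 + (norm y)\<^sup>2"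
    using mult_le_sum_squares[of "cmod (y $ 1)" "cmod (x $ 1)"] mult_le_sum_squares[of "cmod (y $ 2)" "cmod (x $ 2)"]
    by (simp add: norm_vec_2)
  finally show ?thesis .
qed

lemma borel_measurable_vec_nth [measurable (raw)]:
  fixes f :: "'a \<Rightarrow> complex^2"
  shows "f \<in> borel_measurable M \<Longrightarrow> (\<lambda>x. f x $ i) \<in> borel_measurable M"
  by (rule borel_measurable_continuous_on[of "\<lambda>v. v $ i"]) (intro continuous_intros)

lemma borel_measurable_vector2 [measurable (raw)]:
  fixes a b :: "'a \<Rightarrow> complex"
  assumes [measurable]: "a \<in> borel_measurable M" "b \<in> borel_measurable M"
  shows "(\<lambda>x. vector [a x, b x] :: complex^2) \<in> borel_measurable M"
proof -
  have "(\<lambda>x. (\<chi> i. if i = 1 then a x else b x) :: complex^2) \<in> borel_measurable M"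
  proof (rule borel_measurable_continuous_Pair[where H="\<lambda>a b. \<chi> i. if i = 1 then a else b"])
    show "continuous_on UNIV (\<lambda>x :: complex \<times> complex. (\<chi> i. if i = 1 then fst x else snd x) :: complex^2)"
    proof (rule continuous_on_vec_lambda)
      show "continuous_on UNIV (\<lambda>x :: complex \<times> complex. if i = 1 then fst x else snd x)" for i :: 2
        by (cases "i = 1") (auto intro!: continuous_intros)
    qed
  qed measurable
  moreover have "(\<chi> i. if i = 1 then a x else b x) = (vector [a x, b x] :: complex^2)" for x
    by (simp add: vec_eq_iff forall_2)
  ultimately show ?thesis by simp
qed

lemma borel_measurable_cdot [measurable (raw)]:
  assumes [measurable]: "f \<in> borel_measurable M" "g \<in> borel_measurable M"
  shows "(\<lambda>x. cdot (f x) (g x)) \<in> borel_measurable M"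
  unfolding cdot_2 by measurable

text \<open>The Cholesky factorization of the inverse weight, read as a map to unweighted \<open>L2 \<oplus> L2\<close>.\<close>

definition LR_to_L2 :: "(complex \<Rightarrow> complex) \<Rightarrow> (complex \<Rightarrow> complex^2) \<Rightarrow> complex \<Rightarrow> complex^2" where
  "LR_to_L2 R f t = vector [f t $ 1, (f t $ 2 - R t * f t $ 1) / of_real (sqrt (1 - (cmod (R t))\<^sup>2))]"

lemma cdot_matrix_inv_weight:
  assumes "cmod (R t) < 1"
  shows "cdot (matrix_inv (weight R t) *v f t) (g t) = cdot (LR_to_L2 R f t) (LR_to_L2 R g t)"
proof -
  define d where "d = (1 - R t * cnj (R t))"
  have d: "d = of_real (1 - (cmod (R t))\<^sup>2)" unfolding d_def of_real_diff complex_norm_square by simp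
  have pos: "1 - (cmod (R t))\<^sup>2 > 0" using assms by (simp add: abs_square_less_1)
  then have d0: "d \<noteq> 0" unfolding d by (simp only: of_real_eq_0_iff)
  let ?s = "of_real (sqrt (1 - (cmod (R t))\<^sup>2)) :: complex"
  have s: "?s * ?s = d" unfolding d using pos by (simp flip: of_real_mult del: of_real_diff)
  have s0: "?s \<noteq> 0" using s d0 by auto
  have cs: "cnj ?s = ?s" by simp
  let ?B = "vector [vector [1 / d, - cnj (R t) / d], vector [- R t / d, 1 / d]] :: complex^2^2"
  have RR: "R t * cnj (R t) = 1 - d" "cnj (R t) * R t = 1 - d" by (simp_all add: d_def mult.commute)
  have "matrix_inv (weight R t) = ?B"
    using d0 by (intro matrix_inv_eq)
      (simp_all add: weight_def matrix_matrix_mult_def mat_def vec_eq_iff forall_2 sum_2 RR diff_divide_distrib)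
  then have "cdot (matrix_inv (weight R t) *v f t) (g t)
    = (cnj (g t $ 1) * (f t $ 1 - cnj (R t) * f t $ 2) + cnj (g t $ 2) * (f t $ 2 - R t * f t $ 1)) / d"
    using d0 by (simp add: cdot_2 matrix_vector_mult_def sum_2 field_simps)
  \<comment> \<open>Completing the square; \<open>d\<close> is the determinant 1 - |R|^2, whose
    positive root is then shared between the two factors.\<close>
  also have "\<dots> = cnj (g t $ 1) * f t $ 1 + cnj (g t $ 2 - R t * g t $ 1) * (f t $ 2 - R t * f t $ 1) / d"
    using d0 by (simp add: field_simps) (simp add: d_def algebra_simps)
  also have "\<dots> = cnj (g t $ 1) * f t $ 1 + (cnj (g t $ 2 - R t * g t $ 1) / ?s) * ((f t $ 2 - R t * f t $ 1) / ?s)"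
    using s s0 by simp
  also have "\<dots> = cdot (LR_to_L2 R f t) (LR_to_L2 R g t)"
    by (simp only: cdot_2 LR_to_L2_def vector_2 complex_cnj_divide cs)
  finally show ?thesis .
qed

lemma LR_to_L2_add: "LR_to_L2 R (f + g) t = LR_to_L2 R f t + LR_to_L2 R g t"
  by (simp add: LR_to_L2_def vec_eq_iff forall_2 algebra_simps flip: add_divide_distrib diff_divide_distrib)

lemma LR_to_L2_diff: "LR_to_L2 R (f - g) t = LR_to_L2 R f t - LR_to_L2 R g t"
  by (simp add: LR_to_L2_def vec_eq_iff forall_2 algebra_simps flip: add_divide_distrib diff_divide_distrib)

text \<open>The factor may depend on t, which covers constants and also multiplication by
  t^k.\<close>

lemma LR_to_L2_scale: "LR_to_L2 R (\<lambda>t. c t *s f t) t = c t *s LR_to_L2 R f t"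
  by (simp add: LR_to_L2_def vec_eq_iff forall_2 algebra_simps)

lemma cdot_add_left: "cdot (x + y) z = cdot x z + cdot y z"
  by (simp add: cdot_2 algebra_simps)

lemma cdot_scale_left: "cdot (c *s x) z = c * cdot x z"
  by (simp add: cdot_2 algebra_simps)

lemma cnj_cdot: "cnj (cdot x y) = cdot y x"
  by (simp add: cdot_2)

lemma norm_vec_scale: "norm (c *s (x :: complex^2)) = cmod c * norm x"
proof -
  have "(norm (c *s x))\<^sup>2 = (cmod c * norm x)\<^sup>2"
    by (simp add: norm_vec_2 power_mult_distrib norm_mult distrib_left)
  then show ?thesis by (simp add: power2_eq_iff_nonneg)
qed

section \<open>The weighted space as a complete semi-inner product space\<close>

locale contractive_symbol =
  fixes R :: "complex \<Rightarrow> complex"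
  assumes R_measurable [measurable]: "R \<in> borel_measurable circle"
    and R_log: "log_in_L1 (\<lambda>t. 1 - cmod (R t))"
begin

text \<open>This is the positivity clause of \<open>log_in_L1\<close>: the logarithm is finite
  almost everywhere.\<close>

lemma AE_R_less_1: "AE t in circle. cmod (R t) < 1"
  using R_log by (auto simp: log_in_L1_def)

lemma measurable_LR_to_L2 [measurable (raw)]:
  assumes [measurable]: "f \<in> borel_measurable circle"
  shows "LR_to_L2 R f \<in> borel_measurable circle"
  unfolding LR_to_L2_def[abs_def] by measurable

lemma AE_cdot_weight:
  "AE t in circle. cdot (LR_to_L2 R f t) (LR_to_L2 R g t) = cdot (matrix_inv (weight R t) *v f t) (g t)"
  using AE_R_less_1 by eventually_elim (simp add: cdot_matrix_inv_weight)

text \<open>Removes the matrix inverse from membership. The original integrand is measurable because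
  it agrees almost everywhere with one built from \<open>LR_to_L2\<close>.\<close>

lemma LR_iff:
  "f \<in> LR R \<longleftrightarrow> f \<in> borel_measurable circle \<and> integrable circle (\<lambda>t. (norm (LR_to_L2 R f t))\<^sup>2)"
proof -
  have "integrable circle (\<lambda>t. cdot (matrix_inv (weight R t) *v f t) (f t)) \<longleftrightarrow>
      integrable circle (\<lambda>t. (norm (LR_to_L2 R f t))\<^sup>2)" if [measurable]: "f \<in> borel_measurable circle"
  proof -
    have "(\<lambda>t. cdot (matrix_inv (weight R t) *v f t) (f t)) \<in> borel_measurable circle"
      by (rule borel_measurable_circle_AE[OF _ AE_cdot_weight]) measurable
    then have "integrable circle (\<lambda>t. cdot (matrix_inv (weight R t) *v f t) (f t)) \<longleftrightarrow>
        integrable circle (\<lambda>t. cdot (LR_to_L2 R f t) (LR_to_L2 R f t))"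
      using AE_cdot_weight[of f f] by (intro integrable_cong_AE) (auto elim!: eventually_mono)
    also have "\<dots> \<longleftrightarrow> integrable circle (\<lambda>t. (norm (LR_to_L2 R f t))\<^sup>2)"
    proof
      assume "integrable circle (\<lambda>t. cdot (LR_to_L2 R f t) (LR_to_L2 R f t))"
      from integrable_Re[OF this] show "integrable circle (\<lambda>t. (norm (LR_to_L2 R f t))\<^sup>2)"
        by (simp only: cdot_self Re_complex_of_real)
    qed (unfold cdot_self, rule integrable_of_real)
    finally show ?thesis .
  qed
  then show ?thesis by (auto simp: LR_def)
qed

lemma LR_measurable: "f \<in> LR R \<Longrightarrow> f \<in> borel_measurable circle"
  by (simp add: LR_iff)

lemma LR_inner_eq:
  assumes "f \<in> borel_measurable circle" "g \<in> borel_measurable circle"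
  shows "LR_inner R f g = (LINT t|circle. cdot (LR_to_L2 R f t) (LR_to_L2 R g t))"
proof -
  note [measurable] = assms
  have "(\<lambda>t. cdot (matrix_inv (weight R t) *v f t) (g t)) \<in> borel_measurable circle"
    by (rule borel_measurable_circle_AE[OF _ AE_cdot_weight]) measurable
  then show ?thesis
    unfolding LR_inner_def using AE_cdot_weight[of f g]
    by (intro integral_cong_AE) (auto elim!: eventually_mono)
qed

lemma integrable_cdot_LR:
  assumes "f \<in> LR R" "g \<in> LR R"
  shows "integrable circle (\<lambda>t. cdot (LR_to_L2 R f t) (LR_to_L2 R g t))"
proof (rule Bochner_Integration.integrable_bound)
  show "integrable circle (\<lambda>t. (norm (LR_to_L2 R f t))\<^sup>2 + (norm (LR_to_L2 R g t))\<^sup>2)"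
    using assms by (simp add: LR_iff)
  show "AE t in circle. norm (cdot (LR_to_L2 R f t) (LR_to_L2 R g t))
      \<le> norm ((norm (LR_to_L2 R f t))\<^sup>2 + (norm (LR_to_L2 R g t))\<^sup>2)"
    using norm_cdot_le by simp
qed (use LR_measurable[OF assms(1)] LR_measurable[OF assms(2)] in measurable)

lemma LR_scale:
  assumes "f \<in> LR R" "c \<in> borel_measurable circle" "AE t in circle. cmod (c t) \<le> B"
  shows "(\<lambda>t. c t *s f t) \<in> LR R"
proof -
  note [measurable] = LR_measurable[OF assms(1)] assms(2)
  have m: "(\<lambda>t. c t *s f t) \<in> borel_measurable circle"
  proof -
    have "(\<lambda>t. c t *s f t) = (\<lambda>t. vector [c t * f t $ 1, c t * f t $ 2])"
      by (simp add: fun_eq_iff vec_eq_iff forall_2)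
    then show ?thesis by simp
  qed
  have "integrable circle (\<lambda>t. (norm (LR_to_L2 R (\<lambda>t. c t *s f t) t))\<^sup>2)"
  proof (rule Bochner_Integration.integrable_bound)
    show "integrable circle (\<lambda>t. B\<^sup>2 * (norm (LR_to_L2 R f t))\<^sup>2)"
      using assms(1) by (simp add: LR_iff)
    show "AE t in circle. norm ((norm (LR_to_L2 R (\<lambda>t. c t *s f t) t))\<^sup>2) \<le> norm (B\<^sup>2 * (norm (LR_to_L2 R f t))\<^sup>2)"
      using assms(3) by eventually_elim
        (auto simp: LR_to_L2_scale norm_vec_scale power_mult_distrib intro!: mult_right_mono power_mono)
  qed (use m in measurable)
  then show ?thesis using m by (simp add: LR_iff)
qed

lemma LR_add:
  assumes "f \<in> LR R" "g \<in> LR R"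
  shows "f + g \<in> LR R"
proof -
  note [measurable] = LR_measurable[OF assms(1)] LR_measurable[OF assms(2)]
  have m: "f + g \<in> borel_measurable circle" unfolding plus_fun_def by measurable
  have "integrable circle (\<lambda>t. (norm (LR_to_L2 R (f + g) t))\<^sup>2)"
  proof (rule Bochner_Integration.integrable_bound)
    show "integrable circle (\<lambda>t. 2 * (norm (LR_to_L2 R f t))\<^sup>2 + 2 * (norm (LR_to_L2 R g t))\<^sup>2)"
      using assms by (simp add: LR_iff)
    show "AE t in circle. norm ((norm (LR_to_L2 R (f + g) t))\<^sup>2)
        \<le> norm (2 * (norm (LR_to_L2 R f t))\<^sup>2 + 2 * (norm (LR_to_L2 R g t))\<^sup>2)"
      by (simp add: LR_to_L2_add norm_add_square_le)
  qed (use m in measurable)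
  then show ?thesis using m by (simp add: LR_iff)
qed

lemma LR_inner_self: "f \<in> borel_measurable circle \<Longrightarrow> Re (LR_inner R f f) = (LINT t|circle. (norm (LR_to_L2 R f t))\<^sup>2)"
  by (simp only: LR_inner_eq cdot_self integral_complex_of_real Re_complex_of_real)

lemma LR_scale_const: "f \<in> LR R \<Longrightarrow> (\<lambda>t. c *s f t) \<in> LR R"
  by (rule LR_scale[where B="cmod c"]) auto

lemma LR_zero: "0 \<in> LR R"
  unfolding LR_iff zero_fun_def LR_to_L2_def by (auto simp: norm_vec_2)

lemma LR_diff: "f \<in> LR R \<Longrightarrow> g \<in> LR R \<Longrightarrow> f - g \<in> LR R"
proof -
  assume a: "f \<in> LR R" "g \<in> LR R"
  have "f - g = f + (\<lambda>t. (-1) *s g t)" by (simp add: fun_eq_iff vec_eq_iff)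
  then show ?thesis using LR_add[OF a(1) LR_scale_const[OF a(2), of "-1"]] by (simp only:)
qed

lemma LR_complete:
  assumes X: "\<And>n::nat. X n \<in> LR R"
    and Cauchy: "\<And>e. e > 0 \<Longrightarrow> \<exists>N. \<forall>m\<ge>N. \<forall>n\<ge>N. Re (LR_inner R (X m - X n) (X m - X n)) < e"
  shows "\<exists>x\<in>LR R. (\<lambda>n. Re (LR_inner R (X n - x) (X n - x))) \<longlonglongrightarrow> 0"
proof -
  have Xm[measurable]: "X n \<in> borel_measurable circle" for n using X LR_measurable by auto
  have diff_eq: "Re (LR_inner R (X m - g) (X m - g)) = (LINT t|circle. (norm (LR_to_L2 R (X m) t - LR_to_L2 R g t))\<^sup>2)"
    if [measurable]: "g \<in> borel_measurable circle" for m g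
  proof -
    have "X m - g \<in> borel_measurable circle" unfolding fun_diff_def by measurable
    then show ?thesis by (simp add: LR_inner_self LR_to_L2_diff)
  qed
  obtain Y where Y[measurable]: "Y \<in> borel_measurable circle" and Y2: "integrable circle (\<lambda>t. (norm (Y t))\<^sup>2)"
    and lim: "(\<lambda>n. LINT t|circle. (norm (LR_to_L2 R (X n) t - Y t))\<^sup>2) \<longlonglongrightarrow> 0"
  proof (rule circle.L2_complete[of "\<lambda>n. LR_to_L2 R (X n)"])
    show "LR_to_L2 R (X n) \<in> borel_measurable circle" for n by measurable
    show "integrable circle (\<lambda>t. (norm (LR_to_L2 R (X n) t))\<^sup>2)" for n using X by (simp add: LR_iff)
    show "\<exists>N. \<forall>m\<ge>N. \<forall>n\<ge>N. (LINT t|circle. (norm (LR_to_L2 R (X m) t - LR_to_L2 R (X n) t))\<^sup>2) < e" if "e > 0" for e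
      using Cauchy[OF that] by (simp only: diff_eq[OF Xm])
  qed blast
  \<comment> \<open>The triangular map is undone: \<open>x\<close> has image \<open>Y\<close>
    wherever |R| < 1, so completeness of the unweighted space transfers.\<close>
  define x :: "complex \<Rightarrow> complex^2" where
    "x t = vector [Y t $ 1, R t * Y t $ 1 + of_real (sqrt (1 - (cmod (R t))\<^sup>2)) * Y t $ 2]" for t
  have x[measurable]: "x \<in> borel_measurable circle" unfolding x_def[abs_def] by measurable
  have xY: "AE t in circle. LR_to_L2 R x t = Y t"
    using AE_R_less_1
  proof eventually_elim
    fix t assume "cmod (R t) < 1"
    then have "(cmod (R t))\<^sup>2 < 1" by (simp add: abs_square_less_1)
    then have "of_real (sqrt (1 - (cmod (R t))\<^sup>2)) \<noteq> (0::complex)" by (simp only: of_real_eq_0_iff) simp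
    then show "LR_to_L2 R x t = Y t" by (simp add: LR_to_L2_def x_def vec_eq_iff forall_2)
  qed
  have "integrable circle (\<lambda>t. (norm (LR_to_L2 R x t))\<^sup>2) \<longleftrightarrow> integrable circle (\<lambda>t. (norm (Y t))\<^sup>2)"
    by (rule integrable_cong_AE) (use xY in \<open>auto elim!: eventually_mono\<close>)
  then have "x \<in> LR R" using Y2 x by (simp add: LR_iff)
  moreover have "(LINT t|circle. (norm (LR_to_L2 R (X n) t - LR_to_L2 R x t))\<^sup>2) = (LINT t|circle. (norm (LR_to_L2 R (X n) t - Y t))\<^sup>2)" for n
    by (rule integral_cong_AE) (use xY in \<open>auto elim!: eventually_mono\<close>)
  ultimately show ?thesis using lim by (auto simp: diff_eq[OF x] intro!: bexI[of _ x])
qed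

lemma vector_space_fun: "vector_space (\<lambda>(c::complex) (f :: complex \<Rightarrow> complex^2) t. c *s f t)"
  by unfold_locales (simp_all add: fun_eq_iff vec_eq_iff algebra_simps)

sublocale LR: complete_semi_inner_space "\<lambda>c f t. c *s f t" "LR R" "LR_inner R"
proof (intro complete_semi_inner_space.intro complete_semi_inner_space_axioms.intro vector_space_fun)
  show "module.subspace (\<lambda>c f t. c *s f t) (LR R)"
    using vector_space_fun LR_add LR_zero LR_scale_const
    by (simp add: module.subspace_def module_iff_vector_space)
next
  fix f g h assume "f \<in> LR R" "g \<in> LR R" "h \<in> LR R"
  moreover have "f + g \<in> LR R" using calculation by (simp add: LR_add)
  ultimately show "LR_inner R (f + g) h = LR_inner R f h + LR_inner R g h"
    by (simp add: LR_inner_eq LR_measurable LR_to_L2_add cdot_add_left integrable_cdot_LR)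
next
  fix f g c assume "f \<in> LR R" "g \<in> LR R"
  then show "LR_inner R (\<lambda>t. c *s f t) g = c * LR_inner R f g"
    using LR_scale_const[of f c]
    by (simp add: LR_inner_eq LR_measurable LR_to_L2_scale cdot_scale_left integrable_cdot_LR)
next
  fix f g assume "f \<in> LR R" "g \<in> LR R"
  then show "cnj (LR_inner R f g) = LR_inner R g f"
    by (simp add: LR_inner_eq LR_measurable cnj_cdot flip: Bochner_Integration.integral_cnj)
next
  fix f assume "f \<in> LR R"
  then show "0 \<le> Re (LR_inner R f f)" by (simp add: LR_inner_self LR_measurable)
qed (rule LR_complete)

end

subsection \<open>The subspaces and their normal vectors\<close>

definition weighted :: "(complex \<Rightarrow> complex) \<Rightarrow> (complex \<Rightarrow> complex) \<Rightarrow> (complex \<Rightarrow> complex) \<Rightarrow> complex \<Rightarrow> complex^2" where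
  "weighted R u v t = weight R t *v vector [u t, v t]"

lemma weighted_eq: "weighted R u v t = vector [u t + cnj (R t) * v t, R t * u t + v t]"
  by (simp add: weighted_def weight_def matrix_vector_mult_def vec_eq_iff forall_2 sum_2)

definition H_gen :: "(complex \<Rightarrow> complex) \<Rightarrow> int \<Rightarrow> int \<Rightarrow> (complex \<Rightarrow> complex^2) set" where
  "H_gen R n m = {weighted R (\<lambda>t. t powi n * hp t) (\<lambda>t. cnj t powi m * hm t) | hp hm.
     hp \<in> Hardy_plus \<and> hm \<in> Hardy_minus}"

lemma H_genI:
  "hp \<in> Hardy_plus \<Longrightarrow> hm \<in> Hardy_minus \<Longrightarrow>
    weighted R (\<lambda>t. t powi n * hp t) (\<lambda>t. cnj t powi m * hm t) \<in> H_gen R n m"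
  by (auto simp: H_gen_def)

lemma H_genE:
  assumes "f \<in> H_gen R n m"
  obtains hp hm where "hp \<in> Hardy_plus" "hm \<in> Hardy_minus"
    "f = weighted R (\<lambda>t. t powi n * hp t) (\<lambda>t. cnj t powi m * hm t)"
  using assms by (auto simp: H_gen_def)

lemma H_check_eq: "H_check R n m = LR_closure R (H_gen R n m)"
  by (simp add: H_check_def H_gen_def weighted_def[abs_def])

text \<open>For x = (u, v) and weight W, pairing W^(-1) W x with W x leaves the quadratic form x^* W
  x.\<close>

lemma norm_LR_to_L2_weighted:
  assumes "cmod (R t) < 1"
  shows "(norm (LR_to_L2 R (weighted R u v) t))\<^sup>2 = (cmod (u t))\<^sup>2 + (cmod (v t))\<^sup>2 + 2 * Re (R t * u t * cnj (v t))"
proof -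
  define s where "s = sqrt (1 - (cmod (R t))\<^sup>2)"
  have "(cmod (R t))\<^sup>2 < 1" using assms by (simp add: abs_square_less_1)
  then have s: "s\<^sup>2 = 1 - (cmod (R t))\<^sup>2" "s \<noteq> 0" by (auto simp: s_def)
  have "R t * u t + v t - R t * (u t + cnj (R t) * v t) = (1 - R t * cnj (R t)) * v t"
    by (simp add: algebra_simps)
  also have "1 - R t * cnj (R t) = of_real (s\<^sup>2)"
    unfolding s of_real_diff complex_norm_square by simp
  finally have 2: "LR_to_L2 R (weighted R u v) t $ 2 = of_real s * v t"
    using s(2) unfolding LR_to_L2_def weighted_eq vector_2 s_def[symmetric]
    by (simp add: power2_eq_square)
  have 1: "LR_to_L2 R (weighted R u v) t $ 1 = u t + cnj (R t) * v t"
    by (simp add: LR_to_L2_def weighted_eq)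
  have "(cmod (u t + cnj (R t) * v t))\<^sup>2 = (cmod (u t))\<^sup>2 + (cmod (R t))\<^sup>2 * (cmod (v t))\<^sup>2 + 2 * Re (R t * u t * cnj (v t))"
    unfolding cmod_power2 plus_complex.sel times_complex.sel cnj.sel by algebra
  moreover have "(cmod (of_real s * v t))\<^sup>2 = (1 - (cmod (R t))\<^sup>2) * (cmod (v t))\<^sup>2"
    using s(1) by (simp add: norm_mult power_mult_distrib)
  ultimately show ?thesis unfolding norm_vec_2 1 2 by (simp add: algebra_simps)
qed

lemma abs_cross_term_le: "\<bar>2 * Re (r * x * cnj y)\<bar> \<le> cmod r * ((cmod x)\<^sup>2 + (cmod y)\<^sup>2)"
proof -
  have "\<bar>Re (r * x * cnj y)\<bar> \<le> cmod r * (cmod x * cmod y)"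
    using abs_Re_le_cmod[of "r * x * cnj y"] by (simp add: norm_mult mult.assoc)
  then have "\<bar>2 * Re (r * x * cnj y)\<bar> \<le> cmod r * (2 * cmod x * cmod y)" by (simp add: abs_mult)
  also have "\<dots> \<le> cmod r * ((cmod x)\<^sup>2 + (cmod y)\<^sup>2)"
    by (intro mult_left_mono sum_squares_bound) simp
  finally show ?thesis .
qed

definition shift :: "int \<Rightarrow> (complex \<Rightarrow> complex^2) \<Rightarrow> complex \<Rightarrow> complex^2" where
  "shift k f t = t powi k *s f t"

context contractive_symbol
begin

lemma LR_norm_eq: "LR_norm R f = LR.nrm f"
  by (simp add: LR_norm_def LR.nrm_def LR.sq_def)

lemma LR_closure_eq: "LR_closure R S = LR.nclosure S"
  by (simp add: LR_closure_def LR.nclosure_def LR_norm_eq fun_diff_def)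

lemma LR_sq_eq: "f \<in> LR R \<Longrightarrow> LR.sq f = (LINT t|circle. (norm (LR_to_L2 R f t))\<^sup>2)"
  by (simp add: LR.sq_def LR_inner_self LR_measurable)

lemma weighted_measurable:
  assumes "u \<in> L2" "v \<in> L2"
  shows "weighted R u v \<in> borel_measurable circle"
proof -
  note [measurable] = L2_measurable[OF assms(1)] L2_measurable[OF assms(2)]
  show ?thesis unfolding weighted_eq[abs_def] by measurable
qed

lemma weighted_LR:
  assumes "u \<in> L2" "v \<in> L2"
  shows "weighted R u v \<in> LR R"
proof -
  note [measurable] = weighted_measurable[OF assms]
  have "integrable circle (\<lambda>t. (norm (LR_to_L2 R (weighted R u v) t))\<^sup>2)"
  proof (rule Bochner_Integration.integrable_bound)
    show "integrable circle (\<lambda>t. 2 * (cmod (u t))\<^sup>2 + 2 * (cmod (v t))\<^sup>2)"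
      using assms[THEN L2_integrable_square] by simp
    show "AE t in circle. norm ((norm (LR_to_L2 R (weighted R u v) t))\<^sup>2) \<le> norm (2 * (cmod (u t))\<^sup>2 + 2 * (cmod (v t))\<^sup>2)"
      using AE_R_less_1
    proof eventually_elim
      fix t assume R: "cmod (R t) < 1"
      have "\<bar>2 * Re (R t * u t * cnj (v t))\<bar> \<le> cmod (R t) * ((cmod (u t))\<^sup>2 + (cmod (v t))\<^sup>2)"
        by (rule abs_cross_term_le)
      also have "\<dots> \<le> 1 * ((cmod (u t))\<^sup>2 + (cmod (v t))\<^sup>2)"
        using R by (intro mult_right_mono) auto
      finally show "norm ((norm (LR_to_L2 R (weighted R u v) t))\<^sup>2) \<le> norm (2 * (cmod (u t))\<^sup>2 + 2 * (cmod (v t))\<^sup>2)"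
        using norm_LR_to_L2_weighted[where R=R and t=t and u=u and v=v, OF R] by simp
    qed
  qed measurable
  then show ?thesis by (simp add: LR_iff)
qed

text \<open>The smallest eigenvalue of the weight is 1 - |R|, so the form dominates (1 - |R|) (|u|^2
  + |v|^2), and either summand may be dropped. The two parts serve \<open>e_plus_dist\<close> and
  \<open>e_minus_dist\<close>.\<close>

lemma weighted_sq_ge:
  assumes "u \<in> L2" "v \<in> L2"
  shows "(LINT t|circle. (1 - cmod (R t)) * (cmod (u t))\<^sup>2) \<le> LR.sq (weighted R u v)"
    "(LINT t|circle. (1 - cmod (R t)) * (cmod (v t))\<^sup>2) \<le> LR.sq (weighted R u v)"
proof -
  note [measurable] = L2_measurable[OF assms(1)] L2_measurable[OF assms(2)]
  have w: "weighted R u v \<in> LR R" using assms by (rule weighted_LR)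
  have ae: "AE t in circle. (1 - cmod (R t)) * ((cmod (u t))\<^sup>2 + (cmod (v t))\<^sup>2) \<le> (norm (LR_to_L2 R (weighted R u v) t))\<^sup>2"
    using AE_R_less_1
  proof eventually_elim
    fix t assume R: "cmod (R t) < 1"
    show "(1 - cmod (R t)) * ((cmod (u t))\<^sup>2 + (cmod (v t))\<^sup>2) \<le> (norm (LR_to_L2 R (weighted R u v) t))\<^sup>2"
      using norm_LR_to_L2_weighted[where R=R and t=t and u=u and v=v, OF R] abs_cross_term_le[of "R t" "u t" "v t"]
      by (simp add: algebra_simps)
  qed
  have int: "integrable circle (\<lambda>t. (1 - cmod (R t)) * (cmod (f t))\<^sup>2)" if f: "f \<in> L2" for f
  proof (rule Bochner_Integration.integrable_bound[OF L2_integrable_square[OF f]])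
    note [measurable] = L2_measurable[OF f]
    show "(\<lambda>t. (1 - cmod (R t)) * (cmod (f t))\<^sup>2) \<in> borel_measurable circle" by measurable
    show "AE t in circle. norm ((1 - cmod (R t)) * (cmod (f t))\<^sup>2) \<le> norm ((cmod (f t))\<^sup>2)"
      using AE_R_less_1 by eventually_elim (simp add: abs_mult mult_left_le_one_le)
  qed
  have int': "integrable circle (\<lambda>t. (norm (LR_to_L2 R (weighted R u v) t))\<^sup>2)"
    using w by (simp add: LR_iff)
  have le: "(1 - cmod (R t)) * x \<le> (1 - cmod (R t)) * (x + y)" "(1 - cmod (R t)) * y \<le> (1 - cmod (R t)) * (x + y)"
    if "cmod (R t) < 1" "x \<ge> 0" "y \<ge> 0" for x y t
    using that by (auto intro!: mult_left_mono)
  have ae1: "AE t in circle. (1 - cmod (R t)) * (cmod (u t))\<^sup>2 \<le> (norm (LR_to_L2 R (weighted R u v) t))\<^sup>2"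
    using ae AE_R_less_1 by eventually_elim (rule order_trans[OF le(1)], auto)
  have ae2: "AE t in circle. (1 - cmod (R t)) * (cmod (v t))\<^sup>2 \<le> (norm (LR_to_L2 R (weighted R u v) t))\<^sup>2"
    using ae AE_R_less_1 by eventually_elim (rule order_trans[OF le(2)], auto)
  show "(LINT t|circle. (1 - cmod (R t)) * (cmod (u t))\<^sup>2) \<le> LR.sq (weighted R u v)"
    unfolding LR_sq_eq[OF w] by (rule integral_mono_AE[OF int[OF assms(1)] int' ae1])
  show "(LINT t|circle. (1 - cmod (R t)) * (cmod (v t))\<^sup>2) \<le> LR.sq (weighted R u v)"
    unfolding LR_sq_eq[OF w] by (rule integral_mono_AE[OF int[OF assms(2)] int' ae2])
qed

text \<open>The bridge from algebra valid for |t| = 1 to equality of vectors.\<close>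

lemma LR_null_circle:
  assumes "f \<in> LR R" "g \<in> LR R" "\<And>t. cmod t = 1 \<Longrightarrow> f t = g t"
  shows "LR.sq (f - g) = 0"
proof -
  have "LR.sq (f - g) = (LINT t|circle. (norm (LR_to_L2 R (f - g) t))\<^sup>2)"
    using assms by (intro LR_sq_eq LR_diff)
  also have "\<dots> = (LINT t|circle. 0)"
    by (intro Bochner_Integration.integral_cong refl) (use assms(3) in \<open>simp add: LR_to_L2_def norm_vec_2\<close>)
  finally show ?thesis by simp
qed

lemma H_gen_LR: "H_gen R n m \<subseteq> LR R"
  by (auto elim!: H_genE intro!: weighted_LR L2_powi_mult L2_cnj_powi_mult intro: Hardy_plus_L2 Hardy_minus_L2)

lemma H_gen_subspace: "LR.subspace (H_gen R n m)"
proof (rule LR.subspaceI)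
  have "0 = weighted R (\<lambda>t. t powi n * 0) (\<lambda>t. cnj t powi m * 0)"
    by (simp add: fun_eq_iff weighted_eq vec_eq_iff forall_2)
  then show "0 \<in> H_gen R n m" using H_genI[OF Hardy_plus_zero Hardy_minus_zero] by metis
next
  fix f g assume "f \<in> H_gen R n m" "g \<in> H_gen R n m"
  then obtain hp hm kp km where h: "hp \<in> Hardy_plus" "hm \<in> Hardy_minus" "kp \<in> Hardy_plus" "km \<in> Hardy_minus"
    and f: "f = weighted R (\<lambda>t. t powi n * hp t) (\<lambda>t. cnj t powi m * hm t)"
    and g: "g = weighted R (\<lambda>t. t powi n * kp t) (\<lambda>t. cnj t powi m * km t)"
    by (auto elim!: H_genE)
  have "f + g = weighted R (\<lambda>t. t powi n * (hp t + kp t)) (\<lambda>t. cnj t powi m * (hm t + km t))"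
    by (simp add: f g fun_eq_iff weighted_eq vec_eq_iff forall_2 algebra_simps)
  then show "f + g \<in> H_gen R n m"
    using H_genI[OF Hardy_plus_add[OF h(1,3)] Hardy_minus_add[OF h(2,4)]] by simp
next
  fix c f assume "f \<in> H_gen R n m"
  then obtain hp hm where h: "hp \<in> Hardy_plus" "hm \<in> Hardy_minus"
    and f: "f = weighted R (\<lambda>t. t powi n * hp t) (\<lambda>t. cnj t powi m * hm t)"
    by (auto elim!: H_genE)
  have "(\<lambda>t. c *s f t) = weighted R (\<lambda>t. t powi n * (c * hp t)) (\<lambda>t. cnj t powi m * (c * hm t))"
    by (simp add: f fun_eq_iff weighted_eq vec_eq_iff forall_2 algebra_simps)
  then show "(\<lambda>t. c *s f t) \<in> H_gen R n m"
    using H_genI[OF Hardy_plus_scale[OF h(1)] Hardy_minus_scale[OF h(2)]] by simp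
qed

lemma H_check_nclosure: "H_check R n m = LR.nclosure (H_gen R n m)"
  by (simp add: H_check_eq LR_closure_eq)

lemma H_check_closed: "LR.closed_sub (H_check R n m)"
  unfolding H_check_nclosure by (rule LR.closed_sub_nclosure[OF H_gen_subspace H_gen_LR])

lemma H_check_LR: "H_check R n m \<subseteq> LR R"
  by (auto simp: H_check_nclosure LR.nclosure_def)

lemma H_gen_subset: "H_gen R n m \<subseteq> H_check R n m"
  unfolding H_check_nclosure by (rule LR.nclosure_subset[OF H_gen_LR])

lemma H_check_circle:
  assumes "f \<in> LR R" "g \<in> H_gen R n m" "\<And>t. cmod t = 1 \<Longrightarrow> f t = g t"
  shows "f \<in> H_check R n m"
proof (rule LR.closed_sub_null[OF H_check_closed _ assms(1)])
  show "g \<in> H_check R n m" using assms(2) H_gen_subset by blast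
  show "LR.sq (f - g) = 0"
    by (rule LR_null_circle[OF assms(1) _ assms(3)]) (use assms(2) H_gen_LR in blast)+
qed

lemma powi_Suc_circle: "cmod t = 1 \<Longrightarrow> t powi (n + 1) = t powi n * t"
  using powi_add_circle[of t n 1] by simp

lemma cnj_powi_Suc_circle: "cmod t = 1 \<Longrightarrow> cnj t powi (n + 1) = cnj t powi n * cnj t"
  using powi_Suc_circle[of "cnj t" n] by simp

text \<open>Moving one factor t from the power into \<open>hp\<close> can fail at t = 0, so
  generators are matched up to null vectors and the inclusion is obtained for closures.\<close>

lemma H_check_mono_plus: "H_check R (n + 1) m \<subseteq> H_check R n m"
  unfolding H_check_nclosure
proof (rule LR.nclosure_mono_dense[OF H_gen_LR _ H_gen_LR])
  fix f assume f: "f \<in> H_gen R (n + 1) m"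
  then obtain hp hm where h: "hp \<in> Hardy_plus" "hm \<in> Hardy_minus"
    and f_eq: "f = weighted R (\<lambda>t. t powi (n + 1) * hp t) (\<lambda>t. cnj t powi m * hm t)"
    by (auto elim!: H_genE)
  let ?g = "weighted R (\<lambda>t. t powi n * (t * hp t)) (\<lambda>t. cnj t powi m * hm t)"
  have g: "?g \<in> H_gen R n m" using h by (intro H_genI Hardy_plus_shift)
  have "LR.sq (f - ?g) = 0"
    using f g H_gen_LR by (intro LR_null_circle) (auto simp: f_eq weighted_eq powi_Suc_circle mult.assoc)
  then show "\<exists>g\<in>H_gen R n m. LR.sq (f - g) = 0" using g by blast
qed

lemma H_check_mono_minus: "H_check R n (m + 1) \<subseteq> H_check R n m"
  unfolding H_check_nclosure
proof (rule LR.nclosure_mono_dense[OF H_gen_LR _ H_gen_LR])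
  fix f assume f: "f \<in> H_gen R n (m + 1)"
  then obtain hp hm where h: "hp \<in> Hardy_plus" "hm \<in> Hardy_minus"
    and f_eq: "f = weighted R (\<lambda>t. t powi n * hp t) (\<lambda>t. cnj t powi (m + 1) * hm t)"
    by (auto elim!: H_genE)
  let ?g = "weighted R (\<lambda>t. t powi n * hp t) (\<lambda>t. cnj t powi m * (cnj t * hm t))"
  have g: "?g \<in> H_gen R n m" using h by (intro H_genI Hardy_minus_shift)
  have "LR.sq (f - ?g) = 0"
    using f g H_gen_LR by (intro LR_null_circle) (auto simp: f_eq weighted_eq cnj_powi_Suc_circle mult.assoc)
  then show "\<exists>g\<in>H_gen R n m. LR.sq (f - g) = 0" using g by blast
qed

section \<open>The vectors \<open>e_plus\<close>, \<open>e_minus\<close> and codimension one\<close>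

lemma e_plus_eq: "e_plus R n = weighted R (\<lambda>t. t powi n * 1) (\<lambda>t. cnj t powi m * 0)"
  by (simp add: fun_eq_iff e_plus_def weighted_eq)

lemma e_minus_eq: "e_minus R m = weighted R (\<lambda>t. t powi n * 0) (\<lambda>t. cnj t powi (m + 1) * 1)"
  by (simp add: fun_eq_iff e_minus_def weighted_eq)

lemma e_plus_H_gen: "e_plus R n \<in> H_gen R n m"
  unfolding e_plus_eq[of n m] by (intro H_genI Hardy_plus_one Hardy_minus_zero)

lemma e_plus_LR: "e_plus R n \<in> LR R"
  using e_plus_H_gen H_gen_LR by blast

lemma e_minus_LR: "e_minus R m \<in> LR R"
  unfolding e_minus_eq[of m 0] by (intro weighted_LR L2_powi_mult L2_cnj_powi_mult one_L2 L2_zero)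

text \<open>The exponent m + 1 leaves one factor \<open>cnj t\<close> over. It plays the part of
  \<open>hm\<close>, as the constant 1 is not in H^2_-.\<close>

lemma e_minus_H_check: "e_minus R m \<in> H_check R n m"
  by (rule H_check_circle[OF e_minus_LR H_genI[OF Hardy_plus_zero Hardy_minus_cnj_ident]])
    (simp add: e_minus_eq[of m n] weighted_eq cnj_powi_Suc_circle)

text \<open>A nearby generator suffices: the mean of \<open>hp\<close> becomes the coefficient of
  \<open>e_plus\<close>, and the rest of \<open>hp\<close> is divisible by t, which gives a
  generator with first index n + 1.\<close>

lemma hyperplane_plus: "LR.hyperplane (H_check R (n + 1) m) (H_check R n m) (e_plus R n)"
  unfolding LR.hyperplane_def
proof (intro conjI H_check_closed H_check_mono_plus ballI allI impI)
  show "e_plus R n \<in> H_check R n m" using e_plus_H_gen H_gen_subset by blast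
  fix f r assume f: "f \<in> H_check R n m" and "r > (0::real)"
  then obtain g where g: "g \<in> H_gen R n m" and fg: "LR.nrm (f - g) < r"
    unfolding H_check_nclosure LR.nclosure_def by blast
  then obtain hp hm where h: "hp \<in> Hardy_plus" "hm \<in> Hardy_minus"
    and g_eq: "g = weighted R (\<lambda>t. t powi n * hp t) (\<lambda>t. cnj t powi m * hm t)"
    by (auto elim!: H_genE)
  let ?c = "LINT t|circle. hp t"
  obtain k where k: "k \<in> Hardy_plus" "\<And>t. cmod t = 1 \<Longrightarrow> hp t = ?c + t * k t"
    using Hardy_plus_decompose[OF h(1)] by blast
  let ?s = "weighted R (\<lambda>t. t powi (n + 1) * k t) (\<lambda>t. cnj t powi m * hm t)"
  have s: "?s \<in> H_gen R (n + 1) m" using k h by (intro H_genI)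
  let ?y = "(\<lambda>t. ?c *s e_plus R n t) + ?s"
  have y: "?y \<in> LR R"
    using s H_gen_LR by (intro LR_add LR_scale_const e_plus_LR) blast
  have V: "f \<in> LR R" "g \<in> LR R" using f g H_check_LR H_gen_LR by blast+
  have "LR.sq ((f - g) - (f - ?y)) = 0"
  proof (rule LR_null_circle)
    fix t :: complex assume t: "cmod t = 1"
    have "g t = ?y t"
      by (simp only: g_eq e_plus_def weighted_eq k(2)[OF t] powi_Suc_circle[OF t] plus_fun_apply)
        (simp add: vec_eq_iff forall_2 algebra_simps)
    then show "(f - g) t = (f - ?y) t" by simp
  qed (use V y LR_diff in auto)
  then have "LR.sq (f - g) = LR.sq (f - ?y)"
    using V y LR_diff by (intro LR.sq_cong_null) auto
  then have "LR.nrm (f - ?y) < r" using fg by (simp add: LR.nrm_def)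
  then show "\<exists>c. \<exists>s\<in>H_check R (n + 1) m. LR.nrm (f - ((\<lambda>t. c *s e_plus R n t) + s)) < r"
    using s H_gen_subset by blast
qed

lemma hyperplane_minus: "LR.hyperplane (H_check R n (m + 1)) (H_check R n m) (e_minus R m)"
  unfolding LR.hyperplane_def
proof (intro conjI H_check_closed H_check_mono_minus e_minus_H_check ballI allI impI)
  fix f r assume f: "f \<in> H_check R n m" and "r > (0::real)"
  then obtain g where g: "g \<in> H_gen R n m" and fg: "LR.nrm (f - g) < r"
    unfolding H_check_nclosure LR.nclosure_def by blast
  then obtain hp hm where h: "hp \<in> Hardy_plus" "hm \<in> Hardy_minus"
    and g_eq: "g = weighted R (\<lambda>t. t powi n * hp t) (\<lambda>t. cnj t powi m * hm t)"
    by (auto elim!: H_genE)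
  obtain c k where k: "k \<in> Hardy_minus" "\<And>t. cmod t = 1 \<Longrightarrow> hm t = c * cnj t + cnj t * k t"
    using Hardy_minus_decompose[OF h(2)] by blast
  let ?s = "weighted R (\<lambda>t. t powi n * hp t) (\<lambda>t. cnj t powi (m + 1) * k t)"
  have s: "?s \<in> H_gen R n (m + 1)" using k h by (intro H_genI)
  let ?y = "(\<lambda>t. c *s e_minus R m t) + ?s"
  have y: "?y \<in> LR R"
    using s H_gen_LR by (intro LR_add LR_scale_const e_minus_LR) blast
  have V: "f \<in> LR R" "g \<in> LR R" using f g H_check_LR H_gen_LR by blast+
  have "LR.sq ((f - g) - (f - ?y)) = 0"
  proof (rule LR_null_circle)
    fix t :: complex assume t: "cmod t = 1"
    have "g t = ?y t"
      by (simp only: g_eq e_minus_def weighted_eq k(2)[OF t] cnj_powi_Suc_circle[OF t] plus_fun_apply)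
        (simp add: vec_eq_iff forall_2 algebra_simps)
    then show "(f - g) t = (f - ?y) t" by simp
  qed (use V y LR_diff in auto)
  then have "LR.sq (f - g) = LR.sq (f - ?y)"
    using V y LR_diff by (intro LR.sq_cong_null) auto
  then have "LR.nrm (f - ?y) < r" using fg by (simp add: LR.nrm_def)
  then show "\<exists>c. \<exists>s\<in>H_check R n (m + 1). LR.nrm (f - ((\<lambda>t. c *s e_minus R m t) + s)) < r"
    using s H_gen_subset by blast
qed

text \<open>The root of the geometric mean of 1 - |R|; a root because it bounds distances, while the
  Szego inequality bounds squares.\<close>

definition szego_bound :: real where
  "szego_bound = sqrt (exp (LINT t|circle. ln (1 - cmod (R t))))"

lemma szego_bound_pos: "szego_bound > 0"
  by (simp add: szego_bound_def)

lemma weighted_Szego: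
  assumes "f \<in> Hardy_plus"
  shows "(cmod (LINT t|circle. f t))\<^sup>2 * szego_bound\<^sup>2 \<le> (LINT t|circle. (1 - cmod (R t)) * (cmod (f t))\<^sup>2)"
  unfolding szego_bound_def real_sqrt_pow2[OF exp_ge_zero]
proof (rule Hardy_plus_Szego_weighted[OF assms])
  show "AE t in circle. 0 < 1 - cmod (R t) \<and> 1 - cmod (R t) \<le> 1"
    using AE_R_less_1 by eventually_elim auto
  show "integrable circle (\<lambda>t. ln (1 - cmod (R t)))" using R_log by (simp add: log_in_L1_def)
qed measurable

text \<open>With the unimodular t^n factored out, the first component of the difference is 1 - t hp,
  which lies in H^2_+ and has mean 1.\<close>

lemma e_plus_dist:
  assumes "f \<in> H_check R (n + 1) m"
  shows "szego_bound \<le> LR.nrm (e_plus R n - f)"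
proof (rule LR.nclosure_dist_le[OF H_gen_LR e_plus_LR _ assms[unfolded H_check_nclosure]])
  fix g assume "g \<in> H_gen R (n + 1) m"
  then obtain hp hm where h: "hp \<in> Hardy_plus" "hm \<in> Hardy_minus"
    and g: "g = weighted R (\<lambda>t. t powi (n + 1) * hp t) (\<lambda>t. cnj t powi m * hm t)"
    by (auto elim!: H_genE)
  let ?u = "\<lambda>t. t powi n * 1 + (-1) * (t powi (n + 1) * hp t)" and ?v = "\<lambda>t. cnj t powi m * ((-1) * hm t)"
  let ?k = "\<lambda>t. 1 + (-1) * (t * hp t)"
  have k: "?k \<in> Hardy_plus"
    using h by (intro Hardy_plus_add Hardy_plus_one Hardy_plus_scale Hardy_plus_shift)
  have L2: "?u \<in> L2" "?v \<in> L2"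
    by (intro L2_add L2_scale L2_powi_mult one_L2 L2_cnj_powi_mult Hardy_plus_L2[OF h(1)] Hardy_minus_L2[OF h(2)])+
  have th: "(\<lambda>t. t * hp t) \<in> L2" using h by (intro L2_ident_mult Hardy_plus_L2)
  have "(LINT t|circle. t * hp t) = (LINT t|circle. hp t * t powi 1)" by (simp add: mult.commute)
  also have "\<dots> = 0" using h(1) unfolding Hardy_plus_iff by (metis zero_less_one)
  finally have "(LINT t|circle. ?k t) = 1"
    using L2_integrable[OF th] circle.prob_space by (simp del: space_circle)
  then have "szego_bound\<^sup>2 \<le> (LINT t|circle. (1 - cmod (R t)) * (cmod (?k t))\<^sup>2)"
    using weighted_Szego[OF k] by simp
  also have "\<dots> = (LINT t|circle. (1 - cmod (R t)) * (cmod (?u t))\<^sup>2)"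
  proof (intro Bochner_Integration.integral_cong refl)
    fix t assume "t \<in> space circle"
    then have t: "cmod t = 1" by simp
    have "?u t = t powi n * ?k t" by (simp only: powi_Suc_circle[OF t]) (simp add: algebra_simps)
    then have "cmod (?u t) = cmod (?k t)" using norm_powi_circle[OF t] by (simp add: norm_mult)
    then show "(1 - cmod (R t)) * (cmod (?k t))\<^sup>2 = (1 - cmod (R t)) * (cmod (?u t))\<^sup>2" by simp
  qed
  also have "\<dots> \<le> LR.sq (weighted R ?u ?v)" by (rule weighted_sq_ge(1)[OF L2])
  also have "weighted R ?u ?v = e_plus R n - g"
    by (simp add: g fun_eq_iff e_plus_def weighted_eq vec_eq_iff forall_2 algebra_simps)
  finally show "szego_bound \<le> LR.nrm (e_plus R n - g)"
    unfolding LR.nrm_def by (rule real_le_rsqrt)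
qed

text \<open>Now the second component is used: up to a unimodular factor it is 1 - hm, whose
  conjugate lies in H^2_+ with mean 1. This bound yields existence of the vectors of the second
  kind.\<close>

lemma e_minus_dist:
  assumes "f \<in> H_check R n (m + 1)"
  shows "szego_bound \<le> LR.nrm (e_minus R m - f)"
proof (rule LR.nclosure_dist_le[OF H_gen_LR e_minus_LR _ assms[unfolded H_check_nclosure]])
  fix g assume "g \<in> H_gen R n (m + 1)"
  then obtain hp hm where h: "hp \<in> Hardy_plus" "hm \<in> Hardy_minus"
    and g: "g = weighted R (\<lambda>t. t powi n * hp t) (\<lambda>t. cnj t powi (m + 1) * hm t)"
    by (auto elim!: H_genE)
  let ?u = "\<lambda>t. t powi n * ((-1) * hp t)" and ?v = "\<lambda>t. cnj t powi (m + 1) * (1 + (-1) * hm t)"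
  let ?k = "\<lambda>t. 1 + (-1) * cnj (hm t)"
  have k: "?k \<in> Hardy_plus"
    by (intro Hardy_plus_add Hardy_plus_one Hardy_plus_scale Hardy_minus_cnj h)
  have L2: "?u \<in> L2" "?v \<in> L2"
    by (intro L2_add L2_scale L2_powi_mult one_L2 L2_cnj_powi_mult Hardy_plus_L2[OF h(1)] Hardy_minus_L2[OF h(2)])+
  have "(LINT t|circle. ?k t) = 1"
    using L2_integrable[OF Hardy_plus_L2[OF Hardy_minus_cnj(1)[OF h(2)]]] circle.prob_space Hardy_minus_cnj(2)[OF h(2)]
    by (simp del: space_circle Bochner_Integration.integral_cnj)
  then have "szego_bound\<^sup>2 \<le> (LINT t|circle. (1 - cmod (R t)) * (cmod (?k t))\<^sup>2)"
    using weighted_Szego[OF k] by simp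
  also have "\<dots> = (LINT t|circle. (1 - cmod (R t)) * (cmod (?v t))\<^sup>2)"
  proof (intro Bochner_Integration.integral_cong refl)
    fix t assume "t \<in> space circle"
    then have t: "cmod t = 1" by simp
    have "cmod (?v t) = cmod (1 + (-1) * hm t)" using norm_powi_circle[of "cnj t"] t by (simp add: norm_mult)
    also have "\<dots> = cmod (cnj (1 + (-1) * hm t))" by (simp only: complex_mod_cnj)
    also have "\<dots> = cmod (?k t)" by simp
    finally show "(1 - cmod (R t)) * (cmod (?k t))\<^sup>2 = (1 - cmod (R t)) * (cmod (?v t))\<^sup>2" by simp
  qed
  also have "\<dots> \<le> LR.sq (weighted R ?u ?v)" by (rule weighted_sq_ge(2)[OF L2])
  also have "weighted R ?u ?v = e_minus R m - g"
    by (simp add: g fun_eq_iff e_minus_def weighted_eq vec_eq_iff forall_2 algebra_simps)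
  finally show "szego_bound \<le> LR.nrm (e_minus R m - g)"
    unfolding LR.nrm_def by (rule real_le_rsqrt)
qed

lemma e_plus_norm: "LR.nrm (e_plus R n) = 1"
proof -
  have "LR.sq (e_plus R n) = (LINT t|circle. 1)"
    unfolding LR_sq_eq[OF e_plus_LR]
  proof (rule integral_cong_AE)
    show "AE t in circle. (norm (LR_to_L2 R (e_plus R n) t))\<^sup>2 = 1"
      using AE_R_less_1 AE_circle_imp_sphere
    proof eventually_elim
      fix t assume t: "cmod (R t) < 1" "cmod t = 1"
      show "(norm (LR_to_L2 R (e_plus R n) t))\<^sup>2 = 1"
        unfolding e_plus_eq[of n 0] norm_LR_to_L2_weighted[where R=R and t=t, OF t(1)] using norm_powi_circle[OF t(2)] by simp
    qed
  qed (use LR_measurable[OF e_plus_LR] in measurable)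
  then show ?thesis using circle.prob_space by (simp add: LR.nrm_def del: space_circle)
qed

section \<open>The defining vectors as unit normals\<close>

lemma is_K_check_iff:
  "is_K_check R n m K \<longleftrightarrow> LR.unit_normal (H_check R (n + 1) m) (H_check R n m) (e_plus R n) K"
  by (auto simp: is_K_check_def LR.unit_normal_def LR_ominus_def LR_norm_eq positive_number_def)

text \<open>The two positivity conditions have their arguments in opposite order; a positive number
  is its own conjugate.\<close>

lemma is_K_check_tilde_iff:
  "is_K_check_tilde R n m K \<longleftrightarrow> LR.unit_normal (H_check R n (m + 1)) (H_check R n m) (e_minus R m) K"
proof (cases "K \<in> H_check R n m")
  case True
  then have "LR_inner R K (e_minus R m) = cnj (LR_inner R (e_minus R m) K)"
    using LR.ip_cnj[OF e_minus_LR, of K] H_check_LR by (simp add: subset_iff)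
  then show ?thesis
    by (auto simp: is_K_check_tilde_def LR.unit_normal_def LR_ominus_def LR_norm_eq positive_number_def)
qed (auto simp: is_K_check_tilde_def LR.unit_normal_def LR_ominus_def)


subsection \<open>Dependence on the index sum only\<close>

lemma shift_LR: "f \<in> LR R \<Longrightarrow> shift k f \<in> LR R"
  unfolding shift_def[abs_def] by (rule LR_scale[OF _ measurable_powi_circle AE_norm_powi])

lemma shift_ip:
  assumes "f \<in> LR R" "g \<in> LR R"
  shows "LR_inner R (shift k f) (shift k g) = LR_inner R f g"
proof -
  have "cdot (LR_to_L2 R (shift k f) t) (LR_to_L2 R (shift k g) t) = cdot (LR_to_L2 R f t) (LR_to_L2 R g t)"
    if "cmod t = 1" for t
  proof -
    have u: "t powi k * cnj (t powi k) = 1" using mult_cnj_circle[OF norm_powi_circle[OF that]] .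
    have "cdot (c *s x) (c *s y) = (c * cnj c) * cdot x y" for c x y
      by (simp add: cdot_2 algebra_simps)
    then show ?thesis unfolding shift_def[abs_def] LR_to_L2_scale by (simp only: u mult_1)
  qed
  then have "(LINT t|circle. cdot (LR_to_L2 R (shift k f) t) (LR_to_L2 R (shift k g) t)) = (LINT t|circle. cdot (LR_to_L2 R f t) (LR_to_L2 R g t))"
    by (intro Bochner_Integration.integral_cong) auto
  then show ?thesis using assms by (simp add: LR_inner_eq LR_measurable shift_LR)
qed

lemma shift_nrm: "f \<in> LR R \<Longrightarrow> LR.nrm (shift k f) = LR.nrm f"
  by (simp add: LR.nrm_def LR.sq_def shift_ip)

lemma shift_diff: "shift k (f - g) = shift k f - shift k g"
  by (simp add: fun_eq_iff shift_def vec_eq_iff algebra_simps)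

lemma shift_shift_circle: "cmod t = 1 \<Longrightarrow> shift k (shift l f) t = shift (k + l) f t"
  using powi_add_circle[of t k l] by (simp add: shift_def vec_eq_iff mult.assoc[symmetric])

text \<open>As \<open>cnj t\<close> is 1/t on the circle, multiplication by t^k raises the first
  index by k and lowers the second by k. Hence only n + m can matter.\<close>

lemma shift_H_gen_circle:
  assumes "g \<in> H_gen R n m"
  obtains g' where "g' \<in> H_gen R (n + k) (m - k)" "\<And>t. cmod t = 1 \<Longrightarrow> shift k g t = g' t"
proof -
  obtain hp hm where h: "hp \<in> Hardy_plus" "hm \<in> Hardy_minus"
    and g: "g = weighted R (\<lambda>t. t powi n * hp t) (\<lambda>t. cnj t powi m * hm t)"
    using assms by (auto elim!: H_genE)
  have "shift k g t = weighted R (\<lambda>t. t powi (n + k) * hp t) (\<lambda>t. cnj t powi (m - k) * hm t) t"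
    if t: "cmod t = 1" for t
  proof -
    have 1: "t powi (n + k) = t powi k * t powi n"
      using powi_add_circle[OF t, of k n] by (simp add: add.commute)
    have 2: "cnj t powi (m - k) = t powi k * cnj t powi m"
      using powi_add_circle[OF t, of k "- m"] by (simp add: cnj_powi_eq_circle[OF t])
    show ?thesis by (simp only: shift_def g weighted_eq 1 2) (simp add: vec_eq_iff forall_2 algebra_simps)
  qed
  then show ?thesis using that[OF H_genI[OF h]] by blast
qed

lemma shift_H_check:
  assumes "f \<in> H_check R n m"
  shows "shift k f \<in> H_check R (n + k) (m - k)"
proof -
  have f: "f \<in> LR R" using assms H_check_LR by blast
  have "\<exists>g\<in>H_gen R (n + k) (m - k). LR.nrm (shift k f - g) < e" if "e > 0" for e
  proof -
    obtain g where g: "g \<in> H_gen R n m" "LR.nrm (f - g) < e"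
      using assms \<open>e > 0\<close> unfolding H_check_nclosure LR.nclosure_def by blast
    obtain g' where g': "g' \<in> H_gen R (n + k) (m - k)" "\<And>t. cmod t = 1 \<Longrightarrow> shift k g t = g' t"
      using shift_H_gen_circle[OF g(1)] by blast
    have V: "g \<in> LR R" "g' \<in> LR R" using g g' H_gen_LR by blast+
    have "LR.sq ((shift k f - g') - shift k (f - g)) = 0"
      by (rule LR_null_circle) (use f V g'(2) in \<open>simp_all add: LR_diff shift_LR shift_diff\<close>)
    then have "LR.sq (shift k f - g') = LR.sq (shift k (f - g))"
      using f V by (intro LR.sq_cong_null) (simp_all add: LR_diff shift_LR)
    then have "LR.nrm (shift k f - g') = LR.nrm (shift k (f - g))" by (simp add: LR.nrm_def)
    also have "\<dots> < e" using g f V by (simp add: shift_nrm LR_diff)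
    finally show ?thesis using g' by blast
  qed
  then show ?thesis using shift_LR[OF f] unfolding H_check_nclosure LR.nclosure_def by blast
qed

text \<open>The test vector is moved back by t^(-k), where the hypothesis applies; the two shifts
  cancel up to a null vector.\<close>

lemma shift_orthogonal:
  assumes K: "K \<in> LR R" and orth: "\<And>s. s \<in> H_check R n m \<Longrightarrow> LR_inner R K s = 0"
    and s: "s \<in> H_check R (n + k) (m - k)"
  shows "LR_inner R (shift k K) s = 0"
proof -
  have s': "shift (- k) s \<in> H_check R n m" using shift_H_check[OF s, of "- k"] by simp
  have V: "s \<in> LR R" "shift (- k) s \<in> LR R" using s s' H_check_LR by blast+
  have "LR.sq (s - shift k (shift (- k) s)) = 0"
  proof (rule LR_null_circle)
    show "s t = shift k (shift (- k) s) t" if "cmod t = 1" for t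
      unfolding shift_shift_circle[OF that] by (simp add: shift_def)
  qed (use V shift_LR in auto)
  then have "LR_inner R (shift k K) s = LR_inner R (shift k K) (shift k (shift (- k) s))"
    using V K by (intro LR.ip_cong_null) (simp_all add: shift_LR)
  also have "\<dots> = LR_inner R K (shift (- k) s)" using K V by (intro shift_ip) auto
  finally show ?thesis using orth[OF s'] by simp
qed

text \<open>The indices \<open>a\<close>, \<open>b\<close> stay free so that one proof serves both
  kinds of normals: (n+1, m) and (n, m+1).\<close>

lemma shift_unit_normal:
  assumes e: "e \<in> LR R" "e' \<in> LR R" "\<And>t. cmod t = 1 \<Longrightarrow> shift k e t = e' t"
    and K: "LR.unit_normal (H_check R a b) (H_check R n m) e K"
  shows "LR.unit_normal (H_check R (a + k) (b - k)) (H_check R (n + k) (m - k)) e' (shift k K)"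
    "LR_inner R e' (shift k K) = LR_inner R e K"
proof -
  have K': "K \<in> H_check R n m" "\<And>s. s \<in> H_check R a b \<Longrightarrow> LR_inner R K s = 0" "LR.nrm K = 1"
    "Im (LR_inner R e K) = 0" "0 < Re (LR_inner R e K)"
    using K by (auto simp: LR.unit_normal_def)
  have KV: "K \<in> LR R" using K' H_check_LR by blast
  have "LR.sq (shift k e - e') = 0" using e by (intro LR_null_circle shift_LR)
  then have "LR_inner R (shift k e) (shift k K) = LR_inner R e' (shift k K)"
    using e KV by (intro LR.ip_cong_null) (simp_all add: shift_LR)
  then show *: "LR_inner R e' (shift k K) = LR_inner R e K"
    using e KV by (simp add: shift_ip)
  show "LR.unit_normal (H_check R (a + k) (b - k)) (H_check R (n + k) (m - k)) e' (shift k K)"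
    unfolding LR.unit_normal_def *
    using K' shift_H_check[OF K'(1)] shift_nrm[OF KV] shift_orthogonal[OF KV K'(2)] by auto
qed

lemma shift_e_plus: "cmod t = 1 \<Longrightarrow> shift k (e_plus R n) t = e_plus R (n + k) t"
  using powi_add_circle[of t k n] by (simp add: shift_def e_plus_def vec_eq_iff forall_2 add.commute mult_ac)

lemma shift_e_minus:
  assumes t: "cmod t = 1"
  shows "shift k (e_minus R m) t = e_minus R (m - k) t"
proof -
  have "cnj t powi (m - k + 1) = t powi k * cnj t powi (m + 1)"
    using powi_add_circle[OF t, of k "- (m + 1)"] by (simp add: cnj_powi_eq_circle[OF t] algebra_simps)
  then show ?thesis by (simp only: shift_def e_minus_def) (simp add: vec_eq_iff forall_2 mult_ac)
qed

lemma shift_is_K_check: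
  assumes "is_K_check R n m K"
  shows "is_K_check R (n + k) (m - k) (shift k K)"
    "LR_inner R (e_plus R (n + k)) (shift k K) = LR_inner R (e_plus R n) K"
  using shift_unit_normal[OF e_plus_LR e_plus_LR shift_e_plus assms[unfolded is_K_check_iff], of k]
  by (simp_all add: is_K_check_iff add_ac)

lemma shift_is_K_check_tilde:
  assumes "is_K_check_tilde R n m K"
  shows "is_K_check_tilde R (n + k) (m - k) (shift k K)"
  using shift_unit_normal(1)[OF e_minus_LR e_minus_LR shift_e_minus assms[unfolded is_K_check_tilde_iff], of k]
  by (simp add: is_K_check_tilde_iff algebra_simps)

lemma is_K_check_LR: "is_K_check R n m K \<Longrightarrow> K \<in> LR R"
  using H_check_LR by (auto simp: is_K_check_iff LR.unit_normal_def)

lemma is_K_check_tilde_LR: "is_K_check_tilde R n m K \<Longrightarrow> K \<in> LR R"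
  using H_check_LR by (auto simp: is_K_check_tilde_iff LR.unit_normal_def)

section \<open>Existence, uniqueness and well-defined coefficients\<close>

lemma K_check_exists:
  obtains K where "is_K_check R n m K" "szego_bound \<le> Re (LR_inner R (e_plus R n) K)"
  using LR.unit_normal_exists[OF hyperplane_plus szego_bound_pos e_plus_dist[where n=n and m=m]] that
  by (auto simp: is_K_check_iff)

lemma K_check_tilde_exists:
  obtains K where "is_K_check_tilde R n m K"
  using LR.unit_normal_exists[OF hyperplane_minus szego_bound_pos e_minus_dist[where n=n and m=m]] that
  by (auto simp: is_K_check_tilde_iff)

lemma K_check_unique: "is_K_check R n m K \<Longrightarrow> is_K_check R n m K' \<Longrightarrow> LR.sq (K - K') = 0"
  unfolding is_K_check_iff by (rule LR.unit_normal_unique[OF hyperplane_plus])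

lemma K_check_tilde_unique: "is_K_check_tilde R n m K \<Longrightarrow> is_K_check_tilde R n m K' \<Longrightarrow> LR.sq (K - K') = 0"
  unfolding is_K_check_tilde_iff by (rule LR.unit_normal_unique[OF hyperplane_minus])

text \<open>The shift by n' - n reaches the second index pair exactly because the sums agree; there,
  uniqueness up to null vectors applies.\<close>

lemma e_plus_K_check_cong:
  assumes K: "is_K_check R n m K" and K': "is_K_check R n' m' K'" and sum: "n + m = n' + m'"
  shows "LR_inner R (e_plus R n) K = LR_inner R (e_plus R n') K'"
proof -
  have s: "is_K_check R n' m' (shift (n' - n) K)" "LR_inner R (e_plus R n') (shift (n' - n) K) = LR_inner R (e_plus R n) K"
    using shift_is_K_check[OF K, of "n' - n"] sum by (auto simp: algebra_simps)
  have "LR_inner R (e_plus R n') (shift (n' - n) K) = LR_inner R (e_plus R n') K'"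
    using K_check_unique[OF s(1) K'] is_K_check_LR[OF s(1)] is_K_check_LR[OF K'] e_plus_LR
    by (intro LR.ip_cong_null) auto
  then show ?thesis using s(2) by simp
qed

lemma K_check_ip_cong:
  assumes K: "is_K_check R n m K" and L: "is_K_check_tilde R n m L"
    and K': "is_K_check R n' m' K'" and L': "is_K_check_tilde R n' m' L'" and sum: "n + m = n' + m'"
  shows "LR_inner R K L = LR_inner R K' L'"
proof -
  have sK: "is_K_check R n' m' (shift (n' - n) K)" and sL: "is_K_check_tilde R n' m' (shift (n' - n) L)"
    using shift_is_K_check(1)[OF K, of "n' - n"] shift_is_K_check_tilde[OF L, of "n' - n"] sum
    by (auto simp: algebra_simps)
  have "LR_inner R K L = LR_inner R (shift (n' - n) K) (shift (n' - n) L)"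
    by (rule shift_ip[symmetric]) (use is_K_check_LR[OF K] is_K_check_tilde_LR[OF L] in auto)
  also have "\<dots> = LR_inner R K' L'"
    using K_check_unique[OF sK K'] K_check_tilde_unique[OF sL L'] is_K_check_LR[OF sK] is_K_check_LR[OF K']
      is_K_check_tilde_LR[OF sL] is_K_check_tilde_LR[OF L']
    by (intro LR.ip_cong_null) auto
  finally show ?thesis .
qed

text \<open>The given \<open>K\<close> pins the described value down, and independence of indices
  and representatives shows that this value is admissible.\<close>

lemma a0_check_eq:
  assumes "is_K_check R n m K"
  shows "complex_of_real (a0_check R (n + m)) = LR_inner R (e_plus R n) K"
proof -
  let ?P = "\<lambda>c. \<forall>n' m' K'. n' + m' = n + m \<longrightarrow> is_K_check R n' m' K' \<longrightarrow> complex_of_real c = LR_inner R (e_plus R n') K'"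
  let ?c = "Re (LR_inner R (e_plus R n) K)"
  have "Im (LR_inner R (e_plus R n) K) = 0" using assms by (simp add: is_K_check_def positive_number_def)
  then have c: "complex_of_real ?c = LR_inner R (e_plus R n) K" by (simp add: complex_eq_iff)
  have "?P ?c" using c e_plus_K_check_cong[OF assms] by metis
  moreover have "d = ?c" if "?P d" for d using that assms c by (metis Re_complex_of_real)
  ultimately have "(THE c. ?P c) = ?c" by (rule the_equality)
  then show ?thesis using c by (simp add: a0_check_def)
qed

lemma alpha_check_eq:
  assumes "is_K_check R n m K" "is_K_check_tilde R n m L"
  shows "alpha_check R (n + m) = LR_inner R K L"
  unfolding alpha_check_def
proof (rule the_equality)
  show "\<forall>n' m' K' L'. n' + m' = n + m \<longrightarrow> is_K_check R n' m' K' \<longrightarrow> is_K_check_tilde R n' m' L' \<longrightarrow> LR_inner R K L = LR_inner R K' L'"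
    using K_check_ip_cong[OF assms] by metis
qed (use assms in metis)

section \<open>Bounds, the identity for the coefficients, and limits\<close>

lemma a0_check_bounds: "szego_bound \<le> a0_check R j" "a0_check R j \<le> 1"
proof -
  obtain K where K: "is_K_check R j 0 K" "szego_bound \<le> Re (LR_inner R (e_plus R j) K)"
    using K_check_exists by blast
  have a: "complex_of_real (a0_check R j) = LR_inner R (e_plus R j) K" using a0_check_eq[OF K(1)] by simp
  then show "szego_bound \<le> a0_check R j" using K(2) by (metis Re_complex_of_real)
  have "LR.nrm K = 1" using K(1) by (simp add: is_K_check_def LR_norm_eq)
  then have "cmod (complex_of_real (a0_check R j)) \<le> 1"
    unfolding a using LR.Cauchy_Schwarz[OF e_plus_LR is_K_check_LR[OF K(1)], of j] by (simp add: e_plus_norm)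
  then show "a0_check R j \<le> 1" by simp
qed

text \<open>The two-step lemma at n = j, m = 0. The same \<open>e_plus R j\<close> belongs to both
  \<open>K\<close> and \<open>K'\<close>, so its first identity makes their inner product the
  quotient of consecutive values, and the second gives |\<alpha>|^2.\<close>

lemma alpha_check_a0_check:
  "(cmod (alpha_check R j))\<^sup>2 = 1 - (a0_check R j / a0_check R (j + 1))\<^sup>2"
proof -
  obtain K where K: "is_K_check R j 0 K" using K_check_exists by blast
  obtain K' where K': "is_K_check R j 1 K'" using K_check_exists by blast
  obtain L where L: "is_K_check_tilde R j 0 L" using K_check_tilde_exists by blast
  have V: "K \<in> LR R" "K' \<in> LR R" using K K' is_K_check_LR by auto
  have a: "complex_of_real (a0_check R j) = LR_inner R (e_plus R j) K"
    "complex_of_real (a0_check R (j + 1)) = LR_inner R (e_plus R j) K'"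
    "alpha_check R j = LR_inner R K L"
    using a0_check_eq[OF K] a0_check_eq[OF K'] alpha_check_eq[OF K L] by auto
  have H: "LR.hyperplane (H_check R (j + 1) 1) (H_check R j 1) (e_plus R j)"
    "LR.hyperplane (H_check R (j + 1) 0) (H_check R j 0) (e_plus R j)"
    "LR.hyperplane (H_check R j 1) (H_check R j 0) (e_minus R 0)"
    using hyperplane_plus[of j] hyperplane_minus[of j 0] by auto
  have sub: "H_check R (j + 1) 1 \<subseteq> H_check R (j + 1) 0" using H_check_mono_minus[of "j + 1" 0] by simp
  have L': "LR.unit_normal (H_check R j 1) (H_check R j 0) (e_minus R 0) L"
    using L unfolding is_K_check_tilde_iff by simp
  note two = LR.unit_normal_two_step[OF H(2) K[unfolded is_K_check_iff] H(1) K'[unfolded is_K_check_iff] H(3) L' sub]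
  have pos: "a0_check R (j + 1) > 0" using a0_check_bounds(1)[of "j + 1"] szego_bound_pos by linarith
  have "LR_inner R K' K = complex_of_real (a0_check R j / a0_check R (j + 1))"
    using two(1) pos unfolding a(1,2)[symmetric] by (simp add: field_simps)
  then have "cmod (LR_inner R K K') = \<bar>a0_check R j / a0_check R (j + 1)\<bar>"
    using LR.ip_cnj[OF V] by (metis complex_mod_cnj norm_of_real)
  then show ?thesis using two(2) by (simp add: a(3) power_divide)
qed

lemma a0_check_pos: "0 < a0_check R j"
  using a0_check_bounds(1)[of j] szego_bound_pos by linarith

text \<open>Nonnegativity of |\<alpha>|^2 in the identity already makes consecutive quotients at
  most 1.\<close>

lemma a0_check_mono: "mono (a0_check R)"
proof
  have step: "a0_check R j \<le> a0_check R (j + 1)" for j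
  proof -
    have "(a0_check R j / a0_check R (j + 1))\<^sup>2 \<le> 1"
      using alpha_check_a0_check[of j] zero_le_power2[of "cmod (alpha_check R j)"] by linarith
    then show ?thesis using a0_check_pos[of j] a0_check_pos[of "j + 1"]
      by (simp add: power_le_one_iff abs_square_le_1)
  qed
  show "a0_check R i \<le> a0_check R j" if "i \<le> j" for i j
    using that by (induction j rule: int_ge_induct) (auto intro: order_trans step)
qed

lemma a0_check_limit:
  obtains l where "(a0_check R \<longlongrightarrow> l) at_top" "0 < l" "l \<le> 1"
proof -
  let ?l = "SUP j. a0_check R j"
  have bdd: "bdd_above (range (a0_check R))" using a0_check_bounds(2) by (auto intro!: bdd_aboveI)
  have "(a0_check R \<longlongrightarrow> ?l) at_top"
  proof (rule increasing_tendsto)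
    show "eventually (\<lambda>j. a0_check R j \<le> ?l) at_top"
      by (intro always_eventually allI cSUP_upper bdd) simp
    fix x assume "x < ?l"
    then obtain j where "x < a0_check R j" using less_cSUP_iff[OF _ bdd] by auto
    then have "x < a0_check R i" if "i \<ge> j" for i
      using monoD[OF a0_check_mono that] by linarith
    then show "eventually (\<lambda>j. x < a0_check R j) at_top" by (auto simp: eventually_at_top_linorder)
  qed
  moreover have "0 < ?l" using cSUP_upper[OF _ bdd, of 0] a0_check_pos[of 0] by simp
  moreover have "?l \<le> 1" by (rule cSUP_least) (auto intro: a0_check_bounds)
  ultimately show ?thesis using that by blast
qed

lemma alpha_check_tendsto: "(alpha_check R \<longlongrightarrow> 0) at_top"
proof -
  obtain l where l: "(a0_check R \<longlongrightarrow> l) at_top" "0 < l" using a0_check_limit by blast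
  have "filterlim (\<lambda>j::int. j + 1) at_top at_top"
    by (rule filterlim_at_top_mono[OF filterlim_ident]) simp
  then have "((\<lambda>j. a0_check R (j + 1)) \<longlongrightarrow> l) at_top" using filterlim_compose[OF l(1)] by blast
  \<comment> \<open>Numerator and denominator share the limit \<open>l\<close>; its positivity makes
    the quotient tend to 1.\<close>
  then have "((\<lambda>j. 1 - (a0_check R j / a0_check R (j + 1))\<^sup>2) \<longlongrightarrow> 1 - (l / l)\<^sup>2) at_top"
    using l by (intro tendsto_intros) auto
  then have "((\<lambda>j. (cmod (alpha_check R j))\<^sup>2) \<longlongrightarrow> 0) at_top"
    using l(2) by (simp add: alpha_check_a0_check)
  then have "((\<lambda>j. sqrt ((cmod (alpha_check R j))\<^sup>2)) \<longlongrightarrow> sqrt 0) at_top" by (rule tendsto_real_sqrt)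
  then show ?thesis by (simp add: tendsto_norm_zero_iff)
qed

lemma rho_check_tendsto: "(rho_check R \<longlongrightarrow> 1) at_top"
proof -
  have "((\<lambda>j. sqrt (1 - (cmod (alpha_check R j))\<^sup>2)) \<longlongrightarrow> sqrt (1 - (cmod 0)\<^sup>2)) at_top"
    by (intro tendsto_intros alpha_check_tendsto)
  then show ?thesis by (simp add: rho_check_def[abs_def])
qed

end

theorem mainTheorem4:
  fixes R :: "complex \<Rightarrow> complex"
  assumes "R \<in> borel_measurable circle"
    and "AE t in circle. cmod (R t) \<le> 1"
    and "log_in_L1 (\<lambda>t. 1 - cmod (R t))"
  shows "mono (a0_check R)
    \<and> (\<exists>L. (a0_check R \<longlongrightarrow> L) at_top \<and> 0 < L \<and> L \<le> 1)
    \<and> (rho_check R \<longlongrightarrow> 1) at_top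
    \<and> (alpha_check R \<longlongrightarrow> 0) at_top"
proof -
  interpret contractive_symbol R by unfold_locales (fact assms)+
  show ?thesis
    using a0_check_mono a0_check_limit rho_check_tendsto alpha_check_tendsto by metis
qed

end
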